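(* Let $I$ be a monomial ideal of $\mathcal O_n$ of finite colength. Then, for all $i\in\{1,\dots,n\}$, $$\mathcal L_0^{(i)}(I)=\max\big\{\operatorname{ord}(I^{\{j_1,\dots,j_{n+1-i}\}}):1\leq j_1<\cdots<j_{n+1-i}\leq n\big\}.$$
   Context: $\mathcal O_n$ is the ring of complex analytic function germs $(\mathbb C^n,0)\to\mathbb C$, with maximal ideal $\mathfrak m$. Ideals are understood to be proper. A monomial ideal is one generated by monomials. For a nonempty $L\subseteq\{1,\dots,n\}$ let $\mathbb R^n_L=\{x\in\mathbb R^n:x_i=0\text{ for all }i\notin L\}$. For $h=\sum_k a_kx^k\in\mathcal O_n$ let $h_L$ be the sum of all terms $a_kx^k$ with $k\in\mathbb R^n_L$ ($h_L=0$ if there are none). $\mathcal O_{n,L}$ is the subring of germs depending only on the variables $x_i$, $i\in L$, and $I^L$ is the ideal of $\mathcal O_{n,L}$ generated by all $h_L$, $h\in I$. The order $\operatorname{ord}$ of an ideal is the maximum $r$ such that the ideal is contained in the $r$-th power of the maximal ideal (of $\mathcal O_{n,L}$, for $I^L$). Relative Łojasiewicz exponents. Let $(R,\mathfrak m)$ be a Noetherian local ring of dimension $n$. For ideals $I_1,\dots,I_n$ of finite colength, $e(I_1,\dots,I_n)$ is the coefficient of $x_1\cdots x_n$ in the polynomial $P\in\mathbb Q[x_1,\dots,x_n]$ of degree $n$ such that $P(r_1,\dots,r_n)$ equals the length of $R/I_1^{r_1}\cdots I_n^{r_n}$ for all large $r_1,\dots,r_n$. For ideals of finite colength put $$r_0(I_1,\dots,I_n)=\min\{r\in\mathbb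 Z_{\geq0}: e(I_1,\dots,I_n)=e(I_1+\mathfrak m^r,\dots,I_n+\mathfrak m^r)\},\quad \mathcal L_0(I_1,\dots,I_n)=\inf_{s\geq1}\frac{r_0(I_1^s,\dots,I_n^s)}{s}.$$ For an ideal $I$ of finite colength, $\mathcal L_0^{(i)}(I)=\mathcal L_0(I,\dots,I,\mathfrak m,\dots,\mathfrak m)$ with $I$ repeated $i$ times and $\mathfrak m$ repeated $n-i$ times. *)

theory Defs
  imports
    "HOL-Analysis.Analysis"
    "HOL-Algebra.QuotRing"
    "HOL-Algebra.Ideal_Product"
    "HOL-Library.Poly_Mapping"
    "HOL-Library.Extended_Nat"
begin

section \<open>Mixed multiplicities and Lojasiewicz exponents\<close>

text \<open>
  The length of \<open>Q\<close> as a module over itself, as the supremum of the lengths of the strict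
  chains of its ideals.  For \<open>Q = R Quot J\<close> the ideals are precisely the \<open>R\<close>-submodules, so
  this is also the length of \<open>R / J\<close> as an \<open>R\<close>-module.
\<close>

definition ring_length :: "('a, 'b) ring_scheme \<Rightarrow> enat" where
  "ring_length Q = (SUP k \<in> {k. \<exists>C. (\<forall>j\<le>k. ideal (C j) Q) \<and> (\<forall>j<k. C j \<subset> C (Suc j))}. enat k)"

definition finite_colength :: "('a, 'b) ring_scheme \<Rightarrow> 'a set \<Rightarrow> bool" where
  "finite_colength R J \<longleftrightarrow> ideal J R \<and> ring_length (R Quot J) \<noteq> \<infinity>"

text \<open>Meaningful for local rings only.\<close>

definition max_ideal :: "('a, 'b) ring_scheme \<Rightarrow> 'a set" where
  "max_ideal R = (THE M. maximalideal M R)"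

abbreviation ideal_power :: "('a, 'b) ring_scheme \<Rightarrow> 'a set \<Rightarrow> nat \<Rightarrow> 'a set" where
  "ideal_power R J r \<equiv> J [^]\<^bsub>ideals_set R\<^esub> r"

text \<open>Meaningful only if the maximum exists; in particular not for the zero ideal of a domain.\<close>

definition ideal_ord :: "('a, 'b) ring_scheme \<Rightarrow> 'a set \<Rightarrow> nat" where
  "ideal_ord R J = (GREATEST r. J \<subseteq> ideal_power R (max_ideal R) r)"

text \<open>
  A polynomial in variables \<open>x\<^sub>j\<close> is a finitely supported map from monomials to coefficients,
  a monomial being a finitely supported map from variable indices to exponents.
\<close>

type_synonym rat_mpoly = "(nat \<Rightarrow>\<^sub>0 nat) \<Rightarrow>\<^sub>0 rat"

definition mpoly_eval :: "rat_mpoly \<Rightarrow> (nat \<Rightarrow> nat) \<Rightarrow> rat" where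
  "mpoly_eval P r =
     (\<Sum>m\<in>Poly_Mapping.keys P. Poly_Mapping.lookup P m *
        (\<Prod>j\<in>Poly_Mapping.keys m. of_nat (r j) ^ Poly_Mapping.lookup m j))"

definition mpoly_vars_degree_le :: "nat \<Rightarrow> nat \<Rightarrow> rat_mpoly \<Rightarrow> bool" where
  "mpoly_vars_degree_le n d P \<longleftrightarrow>
     (\<forall>m\<in>Poly_Mapping.keys P. Poly_Mapping.keys m \<subseteq> {1..n} \<and>
        (\<Sum>j\<in>Poly_Mapping.keys m. Poly_Mapping.lookup m j) \<le> d)"

text \<open>
  In this section \<open>n\<close> stands for the Krull dimension of the Noetherian local ring \<open>R\<close>, and
  \<open>n\<close>-tuples of ideals are functions on \<open>nat\<close> of which only the values on \<open>{1..n}\<close> matter.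
  The degree of the polynomial is bounded by \<open>n\<close> rather than required to equal it:
  it equals \<open>n\<close> for proper ideals, and the bound also covers the unit ideal (for which
  the polynomial is 0), which occurs as \<open>I\<^sub>j + \<mm>\<^sup>0\<close> below.
\<close>

definition mixed_mult :: "('a, 'b) ring_scheme \<Rightarrow> nat \<Rightarrow> (nat \<Rightarrow> 'a set) \<Rightarrow> rat" where
  "mixed_mult R n I =
     (THE c. \<exists>P. mpoly_vars_degree_le n n P \<and>
        (\<exists>N. \<forall>r. (\<forall>j\<in>{1..n}. N \<le> r j) \<longrightarrow>
           (\<exists>l. ring_length (R Quot (finprod (ideals_set R) (\<lambda>j. ideal_power R (I j) (r j)) {1..n}))
                  = enat l \<and> mpoly_eval P r = of_nat l)) \<and>
        c = Poly_Mapping.lookup P (\<Sum>j\<in>{1..n}. Poly_Mapping.single j 1))"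

definition r_zero :: "('a, 'b) ring_scheme \<Rightarrow> nat \<Rightarrow> (nat \<Rightarrow> 'a set) \<Rightarrow> nat" where
  "r_zero R n I =
     (LEAST r. mixed_mult R n I =
               mixed_mult R n (\<lambda>j. I j <+>\<^bsub>R\<^esub> ideal_power R (max_ideal R) r))"

definition lojasiewicz :: "('a, 'b) ring_scheme \<Rightarrow> nat \<Rightarrow> (nat \<Rightarrow> 'a set) \<Rightarrow> real" where
  "lojasiewicz R n I =
     (INF s\<in>{1..}. real (r_zero R n (\<lambda>j. ideal_power R (I j) s)) / real s)"

definition rel_lojasiewicz :: "('a, 'b) ring_scheme \<Rightarrow> nat \<Rightarrow> nat \<Rightarrow> 'a set \<Rightarrow> real" where
  "rel_lojasiewicz R n i I = lojasiewicz R n (\<lambda>j. if j \<le> i then I else max_ideal R)"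


section \<open>Germs of analytic functions\<close>

text \<open>Germs at 0 of arbitrary functions; analyticity is imposed below.\<close>

quotient_type (overloaded) 'n germ = "complex ^ ('n::finite) \<Rightarrow> complex"
  / "\<lambda>f g. \<forall>\<^sub>F x in nhds 0. f x = g x"
proof (rule equivpI)
  show "reflp (\<lambda>f g :: complex ^ 'n \<Rightarrow> complex. \<forall>\<^sub>F x in nhds 0. f x = g x)"
    by (simp add: reflp_def)
  show "symp (\<lambda>f g :: complex ^ 'n \<Rightarrow> complex. \<forall>\<^sub>F x in nhds 0. f x = g x)"
    by (simp add: symp_def eq_commute)
  show "transp (\<lambda>f g :: complex ^ 'n \<Rightarrow> complex. \<forall>\<^sub>F x in nhds 0. f x = g x)"
    unfolding transp_def by (auto elim: eventually_elim2)
qed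

lift_definition germ_const :: "complex \<Rightarrow> 'n::finite germ" is "\<lambda>c x. c" .

lift_definition germ_add :: "'n::finite germ \<Rightarrow> 'n germ \<Rightarrow> 'n germ" is "\<lambda>f g x. f x + g x"
  by (auto elim: eventually_elim2)

lift_definition germ_mult :: "'n::finite germ \<Rightarrow> 'n germ \<Rightarrow> 'n germ" is "\<lambda>f g x. f x * g x"
  by (auto elim: eventually_elim2)

definition monom_fun :: "('n::finite \<Rightarrow> nat) \<Rightarrow> complex ^ 'n \<Rightarrow> complex" where
  "monom_fun k x = (\<Prod>j\<in>UNIV. (x $ j) ^ k j)"

lift_definition germ_expansion :: "'n::finite germ \<Rightarrow> (('n \<Rightarrow> nat) \<Rightarrow> complex) \<Rightarrow> bool"
  is "\<lambda>f a. \<forall>\<^sub>F x in nhds 0. ((\<lambda>k. a k * monom_fun k x) has_sum f x) UNIV"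
proof -
  fix f g :: "complex ^ 'n \<Rightarrow> complex"
  assume fg: "\<forall>\<^sub>F x in nhds 0. f x = g x"
  show "(\<lambda>a. \<forall>\<^sub>F x in nhds 0. ((\<lambda>k. a k * monom_fun k x) has_sum f x) UNIV) =
        (\<lambda>a. \<forall>\<^sub>F x in nhds 0. ((\<lambda>k. a k * monom_fun k x) has_sum g x) UNIV)"
  proof (rule ext, rule eventually_cong[OF fg])
    fix a :: "('n \<Rightarrow> nat) \<Rightarrow> complex" and x
    assume "f x = g x"
    then show "((\<lambda>k. a k * monom_fun k x) has_sum f x) UNIV \<longleftrightarrow>
               ((\<lambda>k. a k * monom_fun k x) has_sum g x) UNIV" by simp
  qed
qed

text \<open>The ring \<open>\<O>\<^sub>n\<close>, with \<open>n = CARD('n)\<close>.\<close>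

definition germ_ring :: "'n::finite germ ring" where
  "germ_ring = \<lparr>carrier = {h. \<exists>a. germ_expansion h a}, mult = germ_mult, one = germ_const 1,
                zero = germ_const 0, add = germ_add\<rparr>"

definition germ_coeff :: "'n::finite germ \<Rightarrow> ('n \<Rightarrow> nat) \<Rightarrow> complex" where
  "germ_coeff h = (THE a. germ_expansion h a)"

definition monomial_ideal :: "'n::finite germ set \<Rightarrow> bool" where
  "monomial_ideal I \<longleftrightarrow> (\<exists>A. I = Idl\<^bsub>germ_ring\<^esub> ((\<lambda>k. abs_germ (monom_fun k)) ` A))"

text \<open>
  These are \<open>h\<^sub>L\<close>, \<open>\<O>\<^bsub>n,L\<^esub>\<close> and \<open>I\<^sup>L\<close>.  A germ depends only on the
  variables in \<open>L\<close> if it has such a representative; away from 0 representatives are arbitrary.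
\<close>

definition germ_part :: "'n::finite set \<Rightarrow> 'n germ \<Rightarrow> 'n germ" where
  "germ_part L h =
     abs_germ (\<lambda>x. \<Sum>\<^sub>\<infinity>k\<in>{k. \<forall>j. j \<notin> L \<longrightarrow> k j = 0}. germ_coeff h k * monom_fun k x)"

definition germ_subring :: "'n::finite set \<Rightarrow> 'n germ ring" where
  "germ_subring L = germ_ring \<lparr>carrier :=
     {h \<in> carrier germ_ring. \<exists>f. h = abs_germ f \<and> (\<forall>x y. (\<forall>j\<in>L. x $ j = y $ j) \<longrightarrow> f x = f y)}\<rparr>"

definition restricted_ideal :: "'n::finite set \<Rightarrow> 'n germ set \<Rightarrow> 'n germ set" where
  "restricted_ideal L I = Idl\<^bsub>germ_subring L\<^esub> (germ_part L ` I)"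

end

theory Submission
  imports Defs "HOL-Library.Function_Algebras" "HOL-Library.Fun_Lexorder"
begin

text \<open>
  All ideals involved are monomial, that is, given by up-closed sets of exponents \<open>A \<subseteq> \<nat>\<^sup>n\<close>, and the
  length of \<open>\<O>\<^sub>n / I\<close> is the number of exponents outside \<open>A\<close>; hence a mixed multiplicity is an iterated
  difference of a lattice point count.  Let \<open>q = n - i\<close> and let \<open>\<rho>\<close> be the maximum of the orders.  The mixed
  multiplicities of \<open>(J, \<dots>, J, \<mm>, \<dots>, \<mm>)\<close> and of the same tuple with \<open>J\<close> replaced by \<open>J' = J + \<mm>\<^sup>r\<close> are
  compared through the number of exponents in \<open>J'\<^sup>u \<mm>\<^sup>w\<close> but not in \<open>J\<^sup>u \<mm>\<^sup>w\<close>.  For \<open>J = I\<^sup>s\<close> this number is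
  \<open>o(w\<^sup>q)\<close> if \<open>r \<ge> s \<rho>\<close>, because an exponent with \<open>q + 1\<close> large coordinates is reached by an element of \<open>J\<close>
  supported on these coordinates, and it is at least a constant times \<open>u\<^sup>i w\<^sup>q\<close> if \<open>r < s \<rho>\<close> and \<open>J\<close> is first
  enlarged without changing \<open>J'\<close>.  So \<open>r\<^sub>0(I\<^sup>s, \<dots>, I\<^sup>s, \<mm>\<^sup>s, \<dots>, \<mm>\<^sup>s) = s \<rho>\<close> for every \<open>s \<ge> 1\<close>.
\<close>


section \<open>Up-closed sets of exponents\<close>

text \<open>Nonnegativity carries the argument. Counting functions are written as sums of products
  of binomial coefficients with natural coefficients, so terms cannot cancel: a growth bound for the
  function bounds the degree of every term, and iterated differences keep their sign. The latter
  gives monotonicity of mixed multiplicities, which eventual polynomiality alone would not. Such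
  sums arise from cutting down-sets of exponents into slices, and Dickson's lemma makes the cutting
  finite.

  Polynomiality holds only for large arguments, while two tuples can be compared only through one
  polynomial that serves both. Hence it is shown that a fixed factor of finite colength in all
  products does not affect the mixed multiplicity.

  The two-parameter counts are examined with w tending to infinity while u is fixed; this isolates
  the coefficient of w^q, a polynomial in u, whose own leading coefficient is then found by letting
  u grow. For this the constant in the lower bound must not depend on u.\<close>

lemma mono_subsequence_nat:
  fixes f :: "nat \<Rightarrow> nat"
  shows "\<exists>s :: nat \<Rightarrow> nat. strict_mono s \<and> mono (\<lambda>i. f (s i))"
proof -
  obtain s where s: "strict_mono s" "monoseq (\<lambda>i. f (s i))"
    using seq_monosub by blast
  show ?thesis
  proof (cases "mono (\<lambda>i. f (s i))")
    case True
    with s show ?thesis by blast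
  next
    case False
    then have anti: "\<And>i j. i \<le> j \<Longrightarrow> f (s j) \<le> f (s i)"
      using s(2) by (auto simp: monoseq_def mono_def)
    \<comment> \<open>A nonincreasing sequence of naturals is constant from the place where its
      least value is attained.\<close>
    obtain k where k: "\<And>i. f (s k) \<le> f (s i)"
      using ex_has_least_nat[of "\<lambda>_. True" 0 "\<lambda>i. f (s i)"] by blast
    have eq: "f (s (k + i)) = f (s k)" for i
      using anti[of k "k + i"] k[of "k + i"] by simp
    have "strict_mono (\<lambda>i. s (k + i))"
      using s(1) by (simp add: strict_mono_def)
    moreover have "mono (\<lambda>i. f (s (k + i)))"
      by (simp add: eq mono_def)
    ultimately show ?thesis by blast
  qed
qed

text \<open>Dickson's lemma: the subsequence is refined once for each coordinate, and refining
  preserves the monotonicity already reached. A finite set S of coordinates, instead of a finite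
  type, allows initial segments of the naturals as index sets.\<close>

lemma dickson_subsequence:
  fixes f :: "nat \<Rightarrow> 'a \<Rightarrow> nat"
  assumes "finite S"
  shows "\<exists>s :: nat \<Rightarrow> nat. strict_mono s \<and> (\<forall>c\<in>S. mono (\<lambda>i. f (s i) c))"
  using assms
proof (induction S rule: finite_induct)
  case empty
  show ?case by (auto intro: exI[of _ id] simp: strict_mono_def)
next
  case (insert c S)
  then obtain s :: "nat \<Rightarrow> nat" where s: "strict_mono s" "\<forall>c\<in>S. mono (\<lambda>i. f (s i) c)" by blast
  obtain t :: "nat \<Rightarrow> nat" where t: "strict_mono t" "mono (\<lambda>i. f (s (t i)) c)"
    using mono_subsequence_nat[of "\<lambda>i. f (s i) c"] by blast
  have "mono t" using t(1) by (rule strict_mono_mono)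
  then have "\<forall>c\<in>S. mono (\<lambda>i. f (s (t i)) c)"
    using s(2) by (auto simp: mono_def)
  moreover have "strict_mono (\<lambda>i. s (t i))"
    using s(1) t(1) by (simp add: strict_mono_def)
  ultimately show ?case using t(2) by (intro exI[of _ "\<lambda>i. s (t i)"]) auto
qed

lemma dickson_pair:
  fixes f :: "nat \<Rightarrow> 'a \<Rightarrow> nat"
  assumes "finite S"
  obtains i j where "i < j" "\<And>c. c \<in> S \<Longrightarrow> f i c \<le> f j c"
proof -
  obtain s :: "nat \<Rightarrow> nat" where s: "strict_mono s" "\<forall>c\<in>S. mono (\<lambda>i. f (s i) c)"
    using dickson_subsequence[OF assms] by blast
  have "s 0 < s 1" using s(1) by (simp add: strict_mono_def)
  moreover have "f (s 0) c \<le> f (s 1) c" if "c \<in> S" for c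
    using s(2) that by (auto simp: mono_def)
  ultimately show ?thesis by (rule that)
qed

text \<open>If the chain dropped infinitely often, one could choose at each drop an element that is
  lost there. By Dickson's lemma an earlier choice lies below a later one, so it still belongs to
  the later set although it was lost before.\<close>

lemma down_sets_stabilise:
  fixes D :: "nat \<Rightarrow> ('a \<Rightarrow> nat) set"
  assumes "finite S"
    and supp: "\<And>t \<alpha> c. \<alpha> \<in> D t \<Longrightarrow> c \<notin> S \<Longrightarrow> \<alpha> c = 0"
    and down: "\<And>t \<alpha> \<beta>. \<alpha> \<in> D t \<Longrightarrow> \<beta> \<le> \<alpha> \<Longrightarrow> \<beta> \<in> D t"
    and anti: "\<And>t t'. t \<le> t' \<Longrightarrow> D t' \<subseteq> D t"
  shows "\<exists>t0. \<forall>t\<ge>t0. D t = D t0"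
proof (rule ccontr)
  assume "\<not> ?thesis"
  then have *: "\<forall>t0. \<exists>t\<ge>t0. D t \<noteq> D t0" by blast
  have "\<forall>t0. \<exists>t. t > t0 \<and> (\<exists>\<alpha>. \<alpha> \<in> D t0 - D t)"
  proof
    fix t0
    obtain t where t: "t \<ge> t0" "D t \<noteq> D t0" using * by blast
    then have "t > t0" by (cases "t = t0") auto
    moreover have "\<exists>\<alpha>. \<alpha> \<in> D t0 - D t" using anti[OF t(1)] t(2) by blast
    ultimately show "\<exists>t. t > t0 \<and> (\<exists>\<alpha>. \<alpha> \<in> D t0 - D t)" by blast
  qed
  from choice[OF this] obtain nxt
    where nxt: "\<And>t. nxt t > t" "\<And>t. \<exists>\<alpha>. \<alpha> \<in> D t - D (nxt t)"
    by blast
  define T where "T i = (nxt ^^ i) 0" for i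
  have T: "T (Suc i) = nxt (T i)" for i by (simp add: T_def)
  have Tm: "strict_mono T" by (rule strict_monoI_Suc) (simp add: T nxt)
  have "\<forall>i. \<exists>\<alpha>. \<alpha> \<in> D (T i) - D (T (Suc i))" using nxt(2) by (simp add: T)
  from choice[OF this] obtain a where a: "\<And>i. a i \<in> D (T i)" "\<And>i. a i \<notin> D (T (Suc i))"
    by blast
  obtain i j where ij: "i < j" "\<And>c. c \<in> S \<Longrightarrow> a i c \<le> a j c"
    using dickson_pair[OF \<open>finite S\<close>] by blast
  have "a i \<le> a j"
  proof (rule le_funI)
    fix c show "a i c \<le> a j c"
      by (cases "c \<in> S") (use ij(2) supp[OF a(1)] in auto)
  qed
  then have "a i \<in> D (T j)" using down a(1) by blast
  moreover have "T (Suc i) \<le> T j"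
    using Tm ij(1) by (simp add: strict_mono_less_eq)
  ultimately show False using anti a(2) by blast
qed

definition up_closed :: "('n \<Rightarrow> nat) set \<Rightarrow> bool" where
  "up_closed A \<longleftrightarrow> (\<forall>k\<in>A. \<forall>l. k \<le> l \<longrightarrow> l \<in> A)"

lemma up_closedD: "up_closed A \<Longrightarrow> k \<in> A \<Longrightarrow> k \<le> l \<Longrightarrow> l \<in> A"
  by (auto simp: up_closed_def)

text \<open>Otherwise elements of A could be chosen forever, each above none of its predecessors,
  against \<open>dickson_pair\<close>. In algebraic terms, monomial ideals are finitely
  generated.\<close>

lemma up_closed_finite_generators:
  fixes A :: "('n::finite \<Rightarrow> nat) set"
  assumes "up_closed A"
  shows "\<exists>G. finite G \<and> G \<subseteq> A \<and> (\<forall>k\<in>A. \<exists>g\<in>G. g \<le> k)"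
proof (rule ccontr)
  assume "\<not> ?thesis"
  then have *: "\<not> (\<forall>k\<in>A. \<exists>g\<in>G. g \<le> k)" if "finite G" "G \<subseteq> A" for G
    using that by simp
  define p where "p G = (SOME k. k \<in> A \<and> \<not> (\<exists>g\<in>G. g \<le> k))" for G
  have p: "p G \<in> A \<and> \<not> (\<exists>g\<in>G. g \<le> p G)" if "finite G" "G \<subseteq> A" for G
  proof -
    from *[OF that] have "\<exists>k. k \<in> A \<and> \<not> (\<exists>g\<in>G. g \<le> k)" by auto
    from someI_ex[OF this] show ?thesis unfolding p_def .
  qed
  define H where "H = rec_nat {} (\<lambda>_ G. insert (p G) G)"
  have H0: "H 0 = {}" and HS: "\<And>i. H (Suc i) = insert (p (H i)) (H i)"
    by (simp_all add: H_def)
  have fin: "finite (H i) \<and> H i \<subseteq> A" for i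
    by (induction i) (use p in \<open>auto simp: H0 HS\<close>)
  have mem: "p (H i) \<in> H j" if "i < j" for i j
    using that by (induction j) (auto simp: HS less_Suc_eq)
  obtain i j where ij: "i < j" "\<And>c. c \<in> UNIV \<Longrightarrow> p (H i) c \<le> p (H j) c"
    using dickson_pair[of UNIV "\<lambda>i. p (H i)"] by auto
  then show False using p[of "H j"] fin mem[OF ij(1)] by (auto simp: le_fun_def)
qed

lemma finite_below_fun: "finite {i :: 'n::finite \<Rightarrow> nat. i \<le> k}"
proof -
  have "{i. i \<le> k} \<subseteq> Pi\<^sub>E UNIV (\<lambda>j. {..k j})"
    by (auto simp: le_fun_def)
  then show ?thesis by (rule finite_subset) (auto intro: finite_PiE)
qed

section \<open>The semiring of monomial ideals\<close>

typedef 'n upset = "{A :: ('n \<Rightarrow> nat) set. up_closed A}"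
  morphisms exps Abs_upset
  by (auto simp: up_closed_def)

setup_lifting type_definition_upset

lemma up_closed_exps [simp]: "up_closed (exps A)"
  using exps by blast

lemma exps_up: "k \<in> exps A \<Longrightarrow> k \<le> l \<Longrightarrow> l \<in> exps A"
  using up_closed_exps up_closedD by blast

text \<open>Union and Minkowski sum of exponent sets correspond to sum and product of monomial
  ideals, the empty set to the zero ideal and \<open>UNIV\<close> to the unit ideal. The type class
  supplies powers and finite products.\<close>

instantiation upset :: (type) comm_semiring_1
begin

lift_definition zero_upset :: "'a upset" is "{}" by (simp add: up_closed_def)
lift_definition one_upset :: "'a upset" is "UNIV" by (simp add: up_closed_def)
lift_definition plus_upset :: "'a upset \<Rightarrow> 'a upset \<Rightarrow> 'a upset" is "(\<union>)"
  by (auto simp: up_closed_def)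
lift_definition times_upset :: "'a upset \<Rightarrow> 'a upset \<Rightarrow> 'a upset"
  is "\<lambda>A B. {a + b | a b. a \<in> A \<and> b \<in> B}"
proof -
  fix A B :: "('a \<Rightarrow> nat) set"
  assume AB: "up_closed A" "up_closed B"
  show "up_closed {a + b | a b. a \<in> A \<and> b \<in> B}"
    unfolding up_closed_def
  proof safe
    fix a b l assume h: "a \<in> A" "b \<in> B" "a + b \<le> l"
    have "l = a + (l - a)" "b \<le> l - a"
      using h(3) by (auto simp: le_fun_def fun_eq_iff intro!: le_add_diff_inverse[symmetric]) 
        (metis add_leD1 le_add_diff_inverse, metis add.commute le_diff_conv2 add_leD1)
    then show "\<exists>a b. l = a + b \<and> a \<in> A \<and> b \<in> B"
      using h(1,2) AB(2) up_closedD by blast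
  qed
qed

instance
proof
  fix A B C :: "'a upset"
  show "A * B * C = A * (B * C)"
    by transfer (auto; metis add.assoc)
  show "A * B = B * A" by transfer (auto; metis add.commute)
  show "1 * A = A"
  proof (transfer, safe)
    fix A :: "('a \<Rightarrow> nat) set" and a b
    assume "up_closed A" "b \<in> A"
    then show "a + b \<in> A" by (rule up_closedD) (simp add: le_fun_def)
  next
    fix A :: "('a \<Rightarrow> nat) set" and x
    assume "x \<in> A"
    then show "\<exists>a b. x = a + b \<and> a \<in> UNIV \<and> b \<in> A"
      by (intro exI[of _ 0] exI[of _ x]) auto
  qed
  show "A + B + C = A + (B + C)" by transfer auto
  show "A + B = B + A" by transfer auto
  show "0 + A = A" by transfer auto
  show "(A + B) * C = A * C + B * C" by transfer blast
  show "0 * A = 0" by transfer auto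
  show "A * 0 = 0" by transfer auto
  show "(0 :: 'a upset) \<noteq> 1" by transfer auto
qed

end

lemma exps_1 [simp]: "exps 1 = UNIV" by (rule one_upset.rep_eq)
lemma exps_plus [simp]: "exps (A + B) = exps A \<union> exps B" by (rule plus_upset.rep_eq)
lemma exps_times: "exps (A * B) = {a + b | a b. a \<in> exps A \<and> b \<in> exps B}"
  by (rule times_upset.rep_eq)

lemma exps_timesI: "a \<in> exps A \<Longrightarrow> b \<in> exps B \<Longrightarrow> a + b \<in> exps (A * B)"
  by (auto simp: exps_times)

lemma exps_timesI_le:
  assumes "a \<in> exps A" "b \<in> exps B" "a + b \<le> k"
  shows "k \<in> exps (A * B)"
  using exps_up[OF exps_timesI[OF assms(1,2)] assms(3)] .

lemma exps_times_subset1: "exps (A * B) \<subseteq> exps A"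
  by (auto simp: exps_times le_fun_def intro: exps_up)

lemma exps_times_subset2: "exps (A * B) \<subseteq> exps B"
  using exps_times_subset1[of B A] by (simp add: mult.commute)

lemma exps_times_mono:
  "exps A \<subseteq> exps A' \<Longrightarrow> exps B \<subseteq> exps B' \<Longrightarrow> exps (A * B) \<subseteq> exps (A' * B')"
  by (auto simp: exps_times)

lemma exps_power_mono: "exps A \<subseteq> exps B \<Longrightarrow> exps (A ^ r) \<subseteq> exps (B ^ r)"
  by (induction r) (simp_all add: exps_times_mono)

lemma exps_power_antimono: "r \<le> r' \<Longrightarrow> exps (A ^ r') \<subseteq> exps (A ^ r)"
  using exps_times_subset1[of "A ^ r" "A ^ (r' - r)"] by (simp flip: power_add)

lemma upset_eqI: "exps A = exps B \<Longrightarrow> A = B"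
  by (simp add: exps_inject)

section \<open>Degree, powers of the maximal ideal, finite colength\<close>

definition deg :: "('n::finite \<Rightarrow> nat) \<Rightarrow> nat" where
  "deg k = (\<Sum>j\<in>UNIV. k j)"

lemma deg_add [simp]: "deg (k + l) = deg k + deg l"
  by (simp add: deg_def sum.distrib)

lemma deg_0 [simp]: "deg 0 = 0" by (simp add: deg_def)

lemma deg_eq_0_iff [simp]: "deg k = 0 \<longleftrightarrow> k = 0"
  by (auto simp: deg_def fun_eq_iff)

lemma deg_mono: "k \<le> l \<Longrightarrow> deg k \<le> deg l"
  unfolding deg_def by (rule sum_mono) (simp add: le_fun_def)

lemma le_deg: "k j \<le> deg k"
  unfolding deg_def by (rule member_le_sum) auto

lemma finite_deg_le: "finite {k :: 'n::finite \<Rightarrow> nat. deg k \<le> d}"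
proof -
  have "{k :: 'n \<Rightarrow> nat. deg k \<le> d} \<subseteq> {i. i \<le> (\<lambda>_. d)}"
    using le_deg by (auto simp: le_fun_def intro: order_trans)
  then show ?thesis using finite_below_fun by (rule finite_subset)
qed

text \<open>Units are taken away from nonzero coordinates until the degree is right. This is what
  splits an exponent of degree at least r + 1 into factors when the powers of the maximal ideal are
  computed.\<close>

lemma exists_below_deg:
  fixes k :: "'n::finite \<Rightarrow> nat"
  assumes "d \<le> deg k"
  shows "\<exists>l\<le>k. deg l = d"
  using assms
proof (induction "deg k - d" arbitrary: k)
  case 0
  then show ?case by auto
next
  case (Suc x)
  then have "deg k \<noteq> 0" by linarith
  then obtain j where j: "k j \<noteq> 0" by (auto simp: fun_eq_iff)
  define k' where "k' = k(j := k j - 1)"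
  have "deg k = deg (k' + (\<lambda>c. if c = j then 1 else 0))"
    using j by (intro arg_cong[where f = deg]) (auto simp: k'_def fun_eq_iff)
  then have d: "deg k = deg k' + 1" unfolding deg_add by (simp add: deg_def)
  have "k' \<le> k" by (auto simp: k'_def le_fun_def)
  moreover have "\<exists>l\<le>k'. deg l = d"
    by (rule Suc(1)) (use Suc d in auto)
  ultimately show ?case by (metis order_trans)
qed

lift_definition max_upset :: "'n::finite upset" is "{k. k \<noteq> 0}"
  unfolding up_closed_def le_fun_def fun_eq_iff
  by (auto, metis bot_nat_0.extremum_uniqueI not_gr_zero)

lemma exps_max_upset: "exps max_upset = {k. 1 \<le> deg k}"
  by (auto simp: max_upset.rep_eq Suc_le_eq simp flip: deg_eq_0_iff)

lemma add_diff_fun: "l \<le> k \<Longrightarrow> l + (k - l) = (k :: 'n \<Rightarrow> nat)"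
  by (auto simp: le_fun_def fun_eq_iff)

lemma exps_max_upset_power: "exps (max_upset ^ r :: 'n::finite upset) = {k. r \<le> deg k}"
proof (induction r)
  case (Suc r)
  show ?case
  proof safe
    fix k :: "'n \<Rightarrow> nat" assume "k \<in> exps (max_upset ^ Suc r)"
    then show "Suc r \<le> deg k" by (auto simp: exps_times Suc exps_max_upset)
  next
    fix k :: "'n \<Rightarrow> nat" assume k: "Suc r \<le> deg k"
    then obtain l where l: "l \<le> k" "deg l = 1" using exists_below_deg[of 1 k] by auto
    have "deg k = deg l + deg (k - l)" using add_diff_fun[OF l(1)] by (metis deg_add)
    then show "k \<in> exps (max_upset ^ Suc r)"
      using k l by (auto simp: Suc exps_max_upset intro!: exps_timesI_le[of l _ "k - l"] simp: add_diff_fun)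
  qed
qed auto

definition cofin :: "'n upset \<Rightarrow> bool" where
  "cofin A \<longleftrightarrow> finite (- exps A)"

definition colen :: "'n upset \<Rightarrow> nat" where
  "colen A = card (- exps A)"

text \<open>A finite set of exponents has bounded degree, and only finitely many exponents have
  bounded degree. The criterion on the right is visibly stable under products.\<close>

lemma cofin_iff: "cofin (A :: 'n::finite upset) \<longleftrightarrow> (\<exists>D. exps (max_upset ^ D) \<subseteq> exps A)"
proof
  assume "cofin A"
  then have "finite (deg ` (- exps A))" by (simp add: cofin_def)
  then obtain D where "\<forall>d\<in>deg ` (- exps A). d < D" by (meson finite_nat_set_iff_bounded)
  then show "\<exists>D. exps (max_upset ^ D) \<subseteq> exps A"
    by (intro exI[of _ D]) (force simp: exps_max_upset_power)
next
  assume "\<exists>D. exps (max_upset ^ D) \<subseteq> exps A"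
  then obtain D where "exps (max_upset ^ D) \<subseteq> exps A" by blast
  then have "- exps A \<subseteq> {k. deg k \<le> D}" by (force simp: exps_max_upset_power)
  then show "cofin A" unfolding cofin_def using finite_deg_le by (rule finite_subset)
qed

lemma cofin_1 [simp]: "cofin 1" by (simp add: cofin_def)

lemma cofin_max [simp]: "cofin (max_upset :: 'n::finite upset)"
  unfolding cofin_iff by (rule exI[of _ 1]) simp

lemma cofin_times [intro, simp]: "cofin A \<Longrightarrow> cofin B \<Longrightarrow> cofin (A * B :: 'n::finite upset)"
  unfolding cofin_iff by (metis exps_times_mono power_add)

lemma cofin_power [intro, simp]: "cofin A \<Longrightarrow> cofin (A ^ r :: 'n::finite upset)"
  by (induction r) auto

lemma cofin_plus [intro, simp]: "cofin A \<Longrightarrow> cofin (A + B)"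
  unfolding cofin_def by (rule finite_subset[of _ "- exps A"]) auto

lemma cofin_prod [intro, simp]: "(\<And>j. j \<in> V \<Longrightarrow> cofin (A j)) \<Longrightarrow> cofin (\<Prod>j\<in>V. A j :: 'n::finite upset)"
  by (induction V rule: infinite_finite_induct) auto

text \<open>An up-closed set is everything as soon as it contains the exponent 0.\<close>

lemma proper_iff: "A \<noteq> 1 \<longleftrightarrow> exps A \<subseteq> exps (max_upset :: 'n::finite upset)"
proof -
  have "A = 1 \<longleftrightarrow> 0 \<in> exps A"
    by (metis UNIV_I exps_1 exps_up upset_eqI UNIV_eq_I le_fun_def zero_fun_apply zero_le)
  then show ?thesis by (auto simp: max_upset.rep_eq)
qed


section \<open>Counting points of down-sets\<close>

text \<open>The coefficient of \<open>z\<^sup>x\<close> in the power series \<open>z\<^sup>s / (1 - z)\<^sup>p\<close>.\<close>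

primrec hcoef :: "nat \<Rightarrow> nat \<Rightarrow> nat \<Rightarrow> nat" where
  "hcoef 0 s x = of_bool (x = s)"
| "hcoef (Suc p) s x = (\<Sum>t\<le>x. hcoef p s t)"

lemma sum_if_shift:
  fixes g :: "nat \<Rightarrow> nat"
  shows "(\<Sum>u\<le>x. if t \<le> u then g (u - t) else 0) = (if t \<le> x then \<Sum>v\<le>x - t. g v else 0)"
proof (induction x)
  case (Suc x)
  consider "t \<le> x" | "t = Suc x" | "t > Suc x" by linarith
  then show ?case
  proof cases
    case 1
    then show ?thesis using Suc by (simp add: Suc_diff_le)
  next
    case 2
    then show ?thesis using Suc by simp
  next
    case 3
    then show ?thesis using Suc by simp
  qed
qed auto

lemma hcoef_shift: "hcoef p (s + t) x = (if t \<le> x then hcoef p s (x - t) else 0)"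
proof (induction p arbitrary: x)
  case 0
  show ?case by (auto simp: of_bool_def)
next
  case (Suc p)
  show ?case by (simp add: Suc sum_if_shift)
qed

text \<open>\<open>fst q\<close> holds the exponents of the numerator and \<open>snd q\<close> those
  of the denominator: this is the coefficient of z^r in the product over j of z_j^(fst q j) / (1 -
  z_j)^(snd q j).\<close>

definition hterm :: "nat set \<Rightarrow> (nat \<Rightarrow> nat) \<times> (nat \<Rightarrow> nat) \<Rightarrow> (nat \<Rightarrow> nat) \<Rightarrow> nat" where
  "hterm V q r = (\<Prod>j\<in>V. hcoef (snd q j) (fst q j) (r j))"

definition hsum :: "nat set \<Rightarrow> ((nat \<Rightarrow> nat) \<times> (nat \<Rightarrow> nat)) list \<Rightarrow> (nat \<Rightarrow> nat) \<Rightarrow> nat" where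
  "hsum V ps r = (\<Sum>q\<leftarrow>ps. hterm V q r)"

lemma hsum_append [simp]: "hsum V (ps @ qs) r = hsum V ps r + hsum V qs r"
  by (simp add: hsum_def)

lemma hsum_concat: "hsum V (concat (map f [0..<n])) r = (\<Sum>t<n. hsum V (f t) r)"
  by (induction n) (auto simp: hsum_def)

text \<open>On generating functions this is multiplication by z_j^t, and \<open>hcumul\<close> below
  is multiplication by z_j^t / (1 - z_j).\<close>

definition hshift :: "nat \<Rightarrow> nat \<Rightarrow> (nat \<Rightarrow> nat) \<times> (nat \<Rightarrow> nat) \<Rightarrow> (nat \<Rightarrow> nat) \<times> (nat \<Rightarrow> nat)" where
  "hshift j t q = ((fst q)(j := fst q j + t), snd q)"

definition hcumul :: "nat \<Rightarrow> nat \<Rightarrow> (nat \<Rightarrow> nat) \<times> (nat \<Rightarrow> nat) \<Rightarrow> (nat \<Rightarrow> nat) \<times> (nat \<Rightarrow> nat)" where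
  "hcumul j t q = ((fst q)(j := fst q j + t), (snd q)(j := Suc (snd q j)))"

lemma hterm_remove:
  assumes "finite V" "j \<in> V"
  shows "hterm V q r = hcoef (snd q j) (fst q j) (r j) * hterm (V - {j}) q r"
  using assms by (simp add: hterm_def prod.remove)

lemma hterm_cong:
  "(\<And>j. j \<in> V \<Longrightarrow> fst q j = fst q' j \<and> snd q j = snd q' j \<and> r j = r' j) \<Longrightarrow> hterm V q r = hterm V q' r'"
  unfolding hterm_def by (rule prod.cong) auto

lemma hterm_hshift:
  assumes "finite V" "j \<in> V"
  shows "hterm V (hshift j t q) r = (if t \<le> r j then hterm V q (r(j := r j - t)) else 0)"
proof -
  have "hterm (V - {j}) (hshift j t q) r = hterm (V - {j}) q r"
    "hterm (V - {j}) q (r(j := r j - t)) = hterm (V - {j}) q r"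
    by (rule hterm_cong, simp add: hshift_def)+
  then show ?thesis
    by (simp add: hterm_remove[OF assms] hcoef_shift[symmetric]) (simp add: hshift_def hcoef_shift)
qed

lemma hterm_hcumul:
  assumes "finite V" "j \<in> V"
  shows "hterm V (hcumul j t0 q) r =
    (\<Sum>t\<le>r j. if t0 \<le> t then hterm V q (r(j := r j - t)) else 0)"
proof -
  have e1: "hterm (V - {j}) (hcumul j t0 q) r = hterm (V - {j}) q r"
    by (rule hterm_cong) (simp add: hcumul_def)
  have e2: "hterm (V - {j}) q (r(j := x)) = hterm (V - {j}) q r" for x
    by (rule hterm_cong) simp
  let ?g = "hcoef (snd q j) (fst q j)"
  have "(\<Sum>t\<le>r j. if t0 \<le> t then ?g (r j - t) else 0) = (\<Sum>t\<in>{t0..r j}. ?g (r j - t))"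
    by (rule sum.mono_neutral_cong_right) auto
  also have "\<dots> = (if t0 \<le> r j then \<Sum>v\<le>r j - t0. ?g v else 0)"
    by (auto intro!: sum.reindex_bij_witness[of _ "\<lambda>v. r j - v" "\<lambda>t. r j - t"])
  also have "\<dots> = hcoef (Suc (snd q j)) (fst q j + t0) (r j)"
    unfolding hcoef_shift by simp
  finally have "hcoef (Suc (snd q j)) (fst q j + t0) (r j) =
      (\<Sum>t\<le>r j. if t0 \<le> t then ?g (r j - t) else 0)" by simp
  then have "hterm V (hcumul j t0 q) r =
      (\<Sum>t\<le>r j. if t0 \<le> t then ?g (r j - t) else 0) * hterm (V - {j}) q r"
    unfolding hterm_remove[OF assms] e1 by (simp add: hcumul_def)
  also have "\<dots> = (\<Sum>t\<le>r j. if t0 \<le> t then hterm V q (r(j := r j - t)) else 0)"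
    unfolding hterm_remove[OF assms] e2 by (auto simp: sum_distrib_right intro!: sum.cong)
  finally show ?thesis .
qed

lemma hsum_hshift:
  assumes "finite V" "j \<in> V"
  shows "hsum V (map (hshift j t) ps) r = (if t \<le> r j then hsum V ps (r(j := r j - t)) else 0)"
  by (cases "t \<le> r j") (simp_all add: hsum_def hterm_hshift[OF assms] comp_def)

lemma hsum_hcumul:
  assumes "finite V" "j \<in> V"
  shows "hsum V (map (hcumul j t0) ps) r =
    (\<Sum>t\<le>r j. if t0 \<le> t then hsum V ps (r(j := r j - t)) else 0)"
  by (induction ps) (auto simp: hsum_def hterm_hcumul[OF assms] simp flip: sum.distrib intro!: sum.cong)

text \<open>The multidegree of a monomial with exponent \<alpha> in m variables, the i-th of which
  has as its degree the unit vector of the block \<open>b i\<close>.\<close>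

definition bdeg :: "(nat \<Rightarrow> nat) \<Rightarrow> nat \<Rightarrow> (nat \<Rightarrow> nat) \<Rightarrow> nat \<Rightarrow> nat" where
  "bdeg b m \<alpha> j = (\<Sum>i<m. if b i = j then \<alpha> i else 0)"

lemma bdeg_add: "bdeg b m (\<alpha> + \<beta>) j = bdeg b m \<alpha> j + bdeg b m \<beta> j"
  unfolding bdeg_def by (simp flip: sum.distrib) (auto intro: sum.cong)

lemma bdeg_Suc: "bdeg b (Suc m) \<alpha> j = bdeg b m \<alpha> j + (if b m = j then \<alpha> m else 0)"
  by (simp add: bdeg_def)

lemma bdeg_upd: "bdeg b m (\<alpha>(m := t)) j = bdeg b m \<alpha> j"
  unfolding bdeg_def by (rule sum.cong) auto

text \<open>The set is cut into slices by the value t of its last coordinate. The slices shrink with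
  t and are constant from some t0 on: each of the first t0 contributes a shifted series, and all
  others together contribute one series with an additional factor 1 / (1 - z_j). Nothing is ever
  subtracted.\<close>

lemma down_set_count:
  assumes "finite V"
  shows "(\<And>i. i < m \<Longrightarrow> b i \<in> V) \<Longrightarrow> (\<And>\<alpha> i. \<alpha> \<in> D \<Longrightarrow> i \<ge> m \<Longrightarrow> \<alpha> i = 0) \<Longrightarrow>
    (\<And>\<alpha> \<beta>. \<alpha> \<in> D \<Longrightarrow> \<beta> \<le> \<alpha> \<Longrightarrow> \<beta> \<in> D) \<Longrightarrow>
    \<exists>ps. \<forall>r. finite {\<alpha>\<in>D. \<forall>j\<in>V. bdeg b m \<alpha> j = r j} \<and>
      card {\<alpha>\<in>D. \<forall>j\<in>V. bdeg b m \<alpha> j = r j} = hsum V ps r"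
proof (induction m arbitrary: D)
  case 0
  have D0: "D \<subseteq> {0}" using 0(2) by (auto simp: fun_eq_iff)
  show ?case
  proof (cases "D = {}")
    case True
    then show ?thesis by (intro exI[of _ "[]"]) (auto simp: hsum_def)
  next
    case False
    with D0 have D: "D = {0}" by auto
    have "{\<alpha>\<in>D. \<forall>j\<in>V. bdeg b 0 \<alpha> j = r j} = (if \<forall>j\<in>V. r j = 0 then {0} else {})" for r
      by (auto simp: D bdeg_def)
    moreover have "hsum V [(\<lambda>_. 0, \<lambda>_. 0)] r = (if \<forall>j\<in>V. r j = 0 then 1 else 0)" for r
      using \<open>finite V\<close> by (auto simp: hsum_def hterm_def prod_zero_iff)
    ultimately show ?thesis by (intro exI[of _ "[(\<lambda>_. 0, \<lambda>_. 0)]"]) auto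
  qed
next
  case (Suc m)
  let ?j = "b m"
  have jV: "?j \<in> V" using Suc.prems(1) by simp
  \<comment> \<open>The slice at t, moved to height 0 so that it depends on the first m coordinates
    only and the induction hypothesis applies.\<close>
  define E where "E t = {\<alpha>. \<alpha> m = 0 \<and> \<alpha>(m := t) \<in> D}" for t
  have E0: "\<alpha> i = 0" if a: "\<alpha> \<in> E t" "i \<ge> m" for \<alpha> t i
  proof (cases "i = m")
    case True
    then show ?thesis using a by (simp add: E_def)
  next
    case False
    have "\<alpha>(m := t) \<in> D" using a by (simp add: E_def)
    from Suc.prems(2)[OF this, of i] False a show ?thesis by simp
  qed
  have Edown: "\<beta> \<in> E t" if a: "\<alpha> \<in> E t" "\<beta> \<le> \<alpha>" for \<alpha> \<beta> t
  proof -
    have "\<alpha>(m := t) \<in> D" using a by (simp add: E_def)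
    moreover have "\<beta>(m := t) \<le> \<alpha>(m := t)" using a by (simp add: le_fun_def)
    ultimately have "\<beta>(m := t) \<in> D" by (rule Suc.prems(3))
    moreover have "\<beta> m = 0" using a le_funD[OF a(2), of m] by (simp add: E_def)
    ultimately show ?thesis by (simp add: E_def)
  qed
  have Eanti: "E t' \<subseteq> E t" if "t \<le> t'" for t t'
  proof
    fix \<alpha> assume a: "\<alpha> \<in> E t'"
    then have "\<alpha>(m := t') \<in> D" by (simp add: E_def)
    moreover have "\<alpha>(m := t) \<le> \<alpha>(m := t')" using that by (simp add: le_fun_def)
    ultimately have "\<alpha>(m := t) \<in> D" by (rule Suc.prems(3))
    then show "\<alpha> \<in> E t" using a by (simp add: E_def)
  qed
  obtain t0 where t0: "\<And>t. t \<ge> t0 \<Longrightarrow> E t = E t0"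
    using down_sets_stabilise[of "{..<m}" E] E0 Edown Eanti by (auto simp: not_less)
  have "\<forall>t. \<exists>ps. \<forall>r. finite {\<alpha>\<in>E t. \<forall>j\<in>V. bdeg b m \<alpha> j = r j} \<and>
      card {\<alpha>\<in>E t. \<forall>j\<in>V. bdeg b m \<alpha> j = r j} = hsum V ps r"
  proof
    fix t
    show "\<exists>ps. \<forall>r. finite {\<alpha>\<in>E t. \<forall>j\<in>V. bdeg b m \<alpha> j = r j} \<and>
      card {\<alpha>\<in>E t. \<forall>j\<in>V. bdeg b m \<alpha> j = r j} = hsum V ps r"
      by (rule Suc.IH) (use Suc.prems(1) E0 Edown in auto)
  qed
  from choice[OF this] obtain P0 where P0:
    "\<forall>t r. finite {\<alpha>\<in>E t. \<forall>j\<in>V. bdeg b m \<alpha> j = r j} \<and>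
      card {\<alpha>\<in>E t. \<forall>j\<in>V. bdeg b m \<alpha> j = r j} = hsum V (P0 t) r" ..
  \<comment> \<open>Equal slices must be given the same list; only then can the slices from t0 on be
    summed up as one series.\<close>
  define P where "P t = P0 (min t t0)" for t
  have E_min: "E t = E (min t t0)" for t using t0[of t] by (cases "t \<le> t0") auto
  have P: "finite {\<alpha>\<in>E t. \<forall>j\<in>V. bdeg b m \<alpha> j = r j}"
    "card {\<alpha>\<in>E t. \<forall>j\<in>V. bdeg b m \<alpha> j = r j} = hsum V (P t) r" for t r
    unfolding P_def using P0 E_min[of t] by auto
  have P_ge: "P t = P t0" if "t \<ge> t0" for t using that by (simp add: P_def)
  let ?F = "\<lambda>r t. {\<alpha>\<in>E t. \<forall>j\<in>V. bdeg b m \<alpha> j = (r(?j := r ?j - t)) j}"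
  have eq: "{\<alpha>\<in>D. \<forall>j\<in>V. bdeg b (Suc m) \<alpha> j = r j} =
      (\<Union>t\<in>{..r ?j}. (\<lambda>\<alpha>. \<alpha>(m := t)) ` ?F r t)" (is "?L = ?R") for r
  proof
    show "?L \<subseteq> ?R"
    proof
      fix \<alpha> assume a: "\<alpha> \<in> ?L"
      have le: "\<alpha> m \<le> r ?j" using a jV by (auto simp: bdeg_Suc)
      have "\<alpha>(m := 0) \<in> ?F r (\<alpha> m)"
        using a by (auto simp: E_def bdeg_upd bdeg_Suc)
      then show "\<alpha> \<in> ?R"
        using le by (intro UN_I[of "\<alpha> m"] image_eqI[of _ _ "\<alpha>(m := 0)"]) auto
    qed
    show "?R \<subseteq> ?L"
      using jV by (auto simp: E_def bdeg_Suc bdeg_upd split: if_splits)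
  qed
  have fin: "finite (?F r t)" for r t by (rule P(1))
  have inj: "inj_on (\<lambda>\<alpha>. \<alpha>(m := t)) (?F r t)" for r t
  proof (rule inj_onI)
    fix \<alpha> \<beta> assume h: "\<alpha> \<in> ?F r t" "\<beta> \<in> ?F r t" "\<alpha>(m := t) = \<beta>(m := t)"
    show "\<alpha> = \<beta>"
    proof
      fix x show "\<alpha> x = \<beta> x"
        using fun_cong[OF h(3), of x] h(1,2) by (cases "x = m") (auto simp: E_def)
    qed
  qed
  have card_eq: "card {\<alpha>\<in>D. \<forall>j\<in>V. bdeg b (Suc m) \<alpha> j = r j} =
      (\<Sum>t\<le>r ?j. hsum V (P t) (r(?j := r ?j - t)))" for r
  proof -
    have "card {\<alpha>\<in>D. \<forall>j\<in>V. bdeg b (Suc m) \<alpha> j = r j} =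
        (\<Sum>t\<in>{..r ?j}. card ((\<lambda>\<alpha>. \<alpha>(m := t)) ` ?F r t))"
      unfolding eq
    proof (rule card_UN_disjoint)
      show "\<forall>i\<in>{..r ?j}. \<forall>j\<in>{..r ?j}. i \<noteq> j \<longrightarrow>
          (\<lambda>\<alpha>. \<alpha>(m := i)) ` ?F r i \<inter> (\<lambda>\<alpha>. \<alpha>(m := j)) ` ?F r j = {}"
        by (auto dest: fun_cong[where x = m])
    qed (use fin in auto)
    also have "\<dots> = (\<Sum>t\<le>r ?j. hsum V (P t) (r(?j := r ?j - t)))"
      by (rule sum.cong[OF refl]) (simp only: card_image[OF inj] P(2))
    finally show ?thesis .
  qed
  define ps where "ps = concat (map (\<lambda>t. map (hshift ?j t) (P t)) [0..<t0]) @ map (hcumul ?j t0) (P t0)"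
  have "hsum V ps r = (\<Sum>t\<le>r ?j. hsum V (P t) (r(?j := r ?j - t)))" for r
  proof -
    let ?g = "\<lambda>t. hsum V (P t) (r(?j := r ?j - t))"
    have "(\<Sum>t\<le>r ?j. ?g t) = (\<Sum>t\<le>r ?j. (if t < t0 then ?g t else 0) + (if t0 \<le> t then ?g t else 0))"
      by (rule sum.cong) auto
    also have "\<dots> = (\<Sum>t\<le>r ?j. if t < t0 then ?g t else 0) + (\<Sum>t\<le>r ?j. if t0 \<le> t then ?g t else 0)"
      by (rule sum.distrib)
    also have "(\<Sum>t\<le>r ?j. if t < t0 then ?g t else 0) = (\<Sum>t<t0. if t \<le> r ?j then ?g t else 0)"
    proof -
      have "(\<Sum>t\<le>r ?j. if t < t0 then ?g t else 0) = (\<Sum>t\<in>{..r ?j} \<inter> {..<t0}. ?g t)"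
        by (simp add: sum.If_cases lessThan_def)
      also have "\<dots> = (\<Sum>t<t0. if t \<le> r ?j then ?g t else 0)"
        by (simp add: sum.If_cases atMost_def Int_commute)
      finally show ?thesis .
    qed
    also have "(\<Sum>t\<le>r ?j. if t0 \<le> t then ?g t else 0) =
        (\<Sum>t\<le>r ?j. if t0 \<le> t then hsum V (P t0) (r(?j := r ?j - t)) else 0)"
    proof (rule sum.cong[OF refl])
      fix t show "(if t0 \<le> t then ?g t else 0) = (if t0 \<le> t then hsum V (P t0) (r(?j := r ?j - t)) else 0)"
        using P_ge[of t] by (cases "t0 \<le> t") simp_all
    qed
    finally show ?thesis
      unfolding ps_def hsum_append hsum_concat hsum_hshift[OF \<open>finite V\<close> jV] hsum_hcumul[OF \<open>finite V\<close> jV]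
      by (rule sym)
  qed
  then have "finite {\<alpha>\<in>D. \<forall>j\<in>V. bdeg b (Suc m) \<alpha> j = r j} \<and>
      card {\<alpha>\<in>D. \<forall>j\<in>V. bdeg b (Suc m) \<alpha> j = r j} = hsum V ps r" for r
    unfolding card_eq unfolding eq using fin by (intro conjI finite_UN_I finite_imageI) auto
  then show ?case by blast
qed

section \<open>Products of powers presented by a graded polynomial ring\<close>

lemma scaled_in_power: "g \<in> exps A \<Longrightarrow> (\<lambda>c. a * g c) \<in> exps (A ^ a)"
proof (induction a)
  case (Suc a)
  have "(\<lambda>c. Suc a * g c) = g + (\<lambda>c. a * g c)" by (auto simp: fun_eq_iff)
  then show ?case using exps_timesI[OF Suc.prems Suc.IH[OF Suc.prems]] by simp
qed simp

lemma prod_power_add_exps: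
  "(\<Prod>j\<in>V. A j ^ (r j + s j)) = (\<Prod>j\<in>V. A j ^ r j) * (\<Prod>j\<in>V. A j ^ s j :: 'n upset)"
  by (simp add: power_add prod.distrib)

lemma prod_power_upd:
  assumes "finite V" "j \<in> V"
  shows "(\<Prod>i\<in>V. A i ^ (r(j := Suc (r j))) i) = A j * (\<Prod>i\<in>V. A i ^ r i :: 'n upset)"
proof -
  have "(\<Prod>i\<in>V - {j}. A i ^ (r(j := Suc (r j))) i) = (\<Prod>i\<in>V - {j}. A i ^ r i)"
    by (rule prod.cong) auto
  then show ?thesis by (simp add: prod.remove[OF assms] mult.assoc)
qed

lemma less_fun_add:
  fixes f g h :: "nat \<Rightarrow> nat"
  shows "less_fun f g \<Longrightarrow> less_fun (f + h) (g + h)"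
  by (auto simp: less_fun_def)

text \<open>Each listed generator gets a variable of its own, whose degree is the unit vector of its
  block. Then \<open>phi\<close> is the exponent of the image of a monomial in these variables, and
  the products \<open>Z r\<close> are the homogeneous pieces of a multigraded Rees algebra.\<close>

locale gens =
  fixes A :: "nat \<Rightarrow> 'n::finite upset" and V :: "nat set" and gs :: "(nat \<times> ('n \<Rightarrow> nat)) list"
  assumes finV: "finite V"
    and gs_mem: "\<And>j g. (j, g) \<in> set gs \<Longrightarrow> j \<in> V \<and> g \<in> exps (A j)"
    and gs_gen: "\<And>j k. j \<in> V \<Longrightarrow> k \<in> exps (A j) \<Longrightarrow> \<exists>g. (j, g) \<in> set gs \<and> g \<le> k"
begin

abbreviation "m \<equiv> length gs"

definition blk :: "nat \<Rightarrow> nat" where "blk i = fst (gs ! i)"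

definition vec :: "nat \<Rightarrow> 'n \<Rightarrow> nat" where "vec i = snd (gs ! i)"

definition phi :: "(nat \<Rightarrow> nat) \<Rightarrow> 'n \<Rightarrow> nat" where
  "phi \<alpha> = (\<lambda>c. \<Sum>i<m. \<alpha> i * vec i c)"

abbreviation "dg \<alpha> \<equiv> bdeg blk m \<alpha>"

abbreviation "Z r \<equiv> (\<Prod>j\<in>V. A j ^ r j)"

lemma blk_vec: "i < m \<Longrightarrow> blk i \<in> V \<and> vec i \<in> exps (A (blk i))"
  using gs_mem nth_mem by (metis blk_def vec_def prod.collapse)

lemma phi_add: "phi (\<alpha> + \<beta>) = phi \<alpha> + phi \<beta>"
  by (auto simp: phi_def fun_eq_iff sum.distrib algebra_simps)

lemma phi_in_Z: "phi \<alpha> \<in> exps (Z (dg \<alpha>))"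
proof -
  have "(\<lambda>c. \<Sum>i<m'. \<alpha> i * vec i c) \<in> exps (\<Prod>j\<in>V. A j ^ bdeg blk m' \<alpha> j)" if "m' \<le> m" for m'
    using that
  proof (induction m')
    case 0
    show ?case by (simp add: bdeg_def)
  next
    case (Suc m')
    let ?j = "blk m'"
    have j: "?j \<in> V" "vec m' \<in> exps (A ?j)" using blk_vec[of m'] Suc.prems by auto
    have "(\<Prod>j\<in>V. A j ^ bdeg blk (Suc m') \<alpha> j) =
        (\<Prod>j\<in>V. A j ^ bdeg blk m' \<alpha> j) * (\<Prod>j\<in>V. A j ^ (if ?j = j then \<alpha> m' else 0))"
      unfolding bdeg_Suc by (rule prod_power_add_exps)
    also have "(\<Prod>j\<in>V. A j ^ (if ?j = j then \<alpha> m' else 0)) = (\<Prod>j\<in>V. if j = ?j then A j ^ \<alpha> m' else 1)"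
      by (rule prod.cong) auto
    also have "\<dots> = A ?j ^ \<alpha> m'" using finV j by (simp add: prod.delta)
    finally have eq: "(\<Prod>j\<in>V. A j ^ bdeg blk (Suc m') \<alpha> j) = (\<Prod>j\<in>V. A j ^ bdeg blk m' \<alpha> j) * A ?j ^ \<alpha> m'" .
    have "(\<lambda>c. \<Sum>i<Suc m'. \<alpha> i * vec i c) = (\<lambda>c. \<Sum>i<m'. \<alpha> i * vec i c) + (\<lambda>c. \<alpha> m' * vec m' c)"
      by (auto simp: fun_eq_iff)
    then show ?case
      unfolding eq using Suc scaled_in_power[OF j(2)] by (auto intro!: exps_timesI)
  qed
  then show ?thesis by (simp add: phi_def)
qed

text \<open>One factor at a time is split off and replaced by a generator below it. The surplus over
  the generators carries no degree, so equality cannot be expected.\<close>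

lemma Z_rep:
  assumes "k \<in> exps (Z r)"
  shows "\<exists>\<alpha>. (\<forall>i\<ge>m. \<alpha> i = 0) \<and> (\<forall>j\<in>V. dg \<alpha> j = r j) \<and> phi \<alpha> \<le> k"
  using assms
proof (induction "\<Sum>j\<in>V. r j" arbitrary: r k)
  case 0
  then have "\<forall>j\<in>V. r j = 0" using finV by auto
  then show ?case by (intro exI[of _ 0]) (auto simp: bdeg_def phi_def le_fun_def)
next
  case (Suc x)
  then have "(\<Sum>j\<in>V. r j) \<noteq> 0" by simp
  then obtain j where j: "j \<in> V" "r j \<noteq> 0" by (meson sum.neutral)
  define r' where "r' = r(j := r j - 1)"
  have r: "r = r'(j := Suc (r' j))" using j by (auto simp: r'_def)
  have "(\<Sum>i\<in>V. r i) = Suc (\<Sum>i\<in>V. r' i)"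
  proof -
    have "(\<Sum>i\<in>V - {j}. r i) = (\<Sum>i\<in>V - {j}. r' i)" by (rule sum.cong) (auto simp: r'_def)
    then show ?thesis using j by (simp add: sum.remove[OF finV j(1)] r'_def)
  qed
  then have x: "x = (\<Sum>i\<in>V. r' i)" using Suc(2) by simp
  have "k \<in> exps (A j * Z r')"
    using Suc.prems unfolding r prod_power_upd[OF finV j(1)] by simp
  then obtain a k' where ak: "k = a + k'" "a \<in> exps (A j)" "k' \<in> exps (Z r')"
    by (auto simp: exps_times)
  obtain \<alpha> where \<alpha>: "\<forall>i\<ge>m. \<alpha> i = 0" "\<forall>j\<in>V. dg \<alpha> j = r' j" "phi \<alpha> \<le> k'"
    using Suc.hyps(1)[OF x ak(3)] by blast
  obtain g where g: "(j, g) \<in> set gs" "g \<le> a" using gs_gen[OF j(1) ak(2)] by blast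
  then obtain i where i: "i < m" "gs ! i = (j, g)" by (auto simp: in_set_conv_nth)
  define \<delta> :: "nat \<Rightarrow> nat" where "\<delta> = (\<lambda>c. if c = i then 1 else 0)"
  have "phi \<delta> = g"
  proof
    fix c
    have "phi \<delta> c = (\<Sum>l<m. if l = i then vec l c else 0)"
      unfolding phi_def \<delta>_def by (rule sum.cong) auto
    then show "phi \<delta> c = g c" using i by (simp add: vec_def)
  qed
  moreover have "dg \<delta> l = (if l = j then 1 else 0)" for l
  proof -
    have "dg \<delta> l = (\<Sum>c<m. if c = i then (if l = j then 1 else 0) else 0)"
      unfolding bdeg_def \<delta>_def by (rule sum.cong) (use i in \<open>auto simp: blk_def\<close>)
    then show ?thesis using i by simp
  qed
  ultimately show ?case
    using \<alpha> g i ak unfolding r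
    by (intro exI[of _ "\<alpha> + \<delta>"]) (auto simp: bdeg_add phi_add \<delta>_def add.commute[of a] intro: add_mono)
qed

lemma Z_cong: "(\<And>j. j \<in> V \<Longrightarrow> r j = s j) \<Longrightarrow> Z r = Z s"
  by (rule prod.cong) auto

end

text \<open>Each exponent is counted at its lexicographically least representation \<open>e + phi \<alpha>\<close>.  Being least, and not
  lying in \<open>J Z\<close>, are inherited by smaller \<open>\<alpha>\<close>, so that the representations to be counted form down-sets.\<close>

lemma card_difference_hsum:
  fixes A :: "nat \<Rightarrow> 'n::finite upset"
  assumes finV: "finite V" and finKJ: "finite (exps K - exps J)"
  shows "\<exists>ps. \<forall>r. card (exps (K * (\<Prod>j\<in>V. A j ^ r j)) - exps (J * (\<Prod>j\<in>V. A j ^ r j))) = hsum V ps r"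
proof -
  have "\<forall>j. \<exists>G. finite G \<and> G \<subseteq> exps (A j) \<and> (\<forall>k\<in>exps (A j). \<exists>g\<in>G. g \<le> k)"
    using up_closed_finite_generators[OF up_closed_exps] by blast
  from choice[OF this] obtain G where G:
    "\<forall>j. finite (G j) \<and> G j \<subseteq> exps (A j) \<and> (\<forall>k\<in>exps (A j). \<exists>g\<in>G j. g \<le> k)" ..
  have "finite (SIGMA j:V. G j)" using finV G by auto
  from finite_list[OF this] obtain gs where gs: "set gs = (SIGMA j:V. G j)" ..
  interpret gens A V gs
    by unfold_locales (use finV G gs in \<open>force+\<close>)
  \<comment> \<open>These finitely many exponents act as generators of the quotient of K by J; the
    monomials in the new variables act on them through \<open>phi\<close>.\<close>
  obtain es where es: "set es = exps K - exps J"
    using finite_list[OF finKJ] by blast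
  define n where "n = length es"
  define psi where "psi e \<alpha> = es ! e + phi \<alpha>" for e \<alpha>
  \<comment> \<open>An admissible \<alpha> vanishes at m, so this slot can carry the index e, and
    one lexicographic comparison orders the pairs of \<alpha> and e. Only representations of the
    same exponent in the same multidegree compete.\<close>
  define Good where "Good e = {\<alpha>. (\<forall>i\<ge>m. \<alpha> i = 0) \<and> psi e \<alpha> \<notin> exps (J * Z (dg \<alpha>)) \<and>
    \<not> (\<exists>e'<n. \<exists>\<alpha>'. (\<forall>i\<ge>m. \<alpha>' i = 0) \<and> (\<forall>j\<in>V. dg \<alpha>' j = dg \<alpha> j) \<and> psi e' \<alpha>' = psi e \<alpha> \<and>
         less_fun (\<alpha>'(m := e')) (\<alpha>(m := e)))}" for e
  have down: "\<beta> \<in> Good e" if a: "\<alpha> \<in> Good e" "\<beta> \<le> \<alpha>" for \<alpha> \<beta> e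
  proof -
    define \<delta> where "\<delta> = \<alpha> - \<beta>"
    have \<alpha>: "\<alpha> = \<beta> + \<delta>" using add_diff_fun[OF a(2)] by (simp add: \<delta>_def)
    have zero: "\<forall>i\<ge>m. \<alpha> i = 0" using a(1) by (simp add: Good_def)
    then have zb: "\<forall>i\<ge>m. \<beta> i = 0" and zd: "\<forall>i\<ge>m. \<delta> i = 0" by (auto simp: \<alpha>)
    have Zadd: "Z (dg \<alpha>) = Z (dg \<beta>) * Z (dg \<delta>)"
      unfolding \<alpha> bdeg_add by (rule prod_power_add_exps)
    have psi_add: "psi e (\<beta>' + \<delta>) = psi e \<beta>' + phi \<delta>" for e \<beta>'
      by (simp add: psi_def phi_add add.assoc)
    have "psi e \<beta> \<notin> exps (J * Z (dg \<beta>))"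
    proof
      assume "psi e \<beta> \<in> exps (J * Z (dg \<beta>))"
      from exps_timesI[OF this phi_in_Z[of \<delta>]]
      have "psi e \<alpha> \<in> exps (J * Z (dg \<alpha>))" by (simp add: \<alpha> psi_add Zadd[unfolded \<alpha>] mult.assoc)
      then show False using a(1) by (simp add: Good_def)
    qed
    moreover have "\<not> (\<exists>e'<n. \<exists>\<alpha>'. (\<forall>i\<ge>m. \<alpha>' i = 0) \<and> (\<forall>j\<in>V. dg \<alpha>' j = dg \<beta> j) \<and>
        psi e' \<alpha>' = psi e \<beta> \<and> less_fun (\<alpha>'(m := e')) (\<beta>(m := e)))"
    proof
      assume "\<exists>e'<n. \<exists>\<alpha>'. (\<forall>i\<ge>m. \<alpha>' i = 0) \<and> (\<forall>j\<in>V. dg \<alpha>' j = dg \<beta> j) \<and>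
        psi e' \<alpha>' = psi e \<beta> \<and> less_fun (\<alpha>'(m := e')) (\<beta>(m := e))"
      then obtain e' \<alpha>' where h: "e' < n" "\<forall>i\<ge>m. \<alpha>' i = 0" "\<forall>j\<in>V. dg \<alpha>' j = dg \<beta> j"
        "psi e' \<alpha>' = psi e \<beta>" "less_fun (\<alpha>'(m := e')) (\<beta>(m := e))" by blast
      \<comment> \<open>Adding \<delta> to a smaller representation for \<beta> would produce a
        smaller one for \<alpha>, since the lexicographic order is invariant under
        translation.\<close>
      have upd: "(\<gamma> + \<delta>)(m := x) = \<gamma>(m := x) + \<delta>" for \<gamma> x
        using zd by (auto simp: fun_eq_iff)
      have "less_fun ((\<alpha>' + \<delta>)(m := e')) (\<alpha>(m := e))"
        unfolding \<alpha> upd using h(5) by (rule less_fun_add)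
      moreover have "\<forall>i\<ge>m. (\<alpha>' + \<delta>) i = 0" using h(2) zd by simp
      moreover have "\<forall>j\<in>V. dg (\<alpha>' + \<delta>) j = dg \<alpha> j" using h(3) by (simp add: \<alpha> bdeg_add)
      moreover have "psi e' (\<alpha>' + \<delta>) = psi e \<alpha>" by (simp add: \<alpha> psi_add h(4))
      ultimately show False using a(1) h(1) unfolding Good_def by blast
    qed
    ultimately show ?thesis using zb by (simp add: Good_def)
  qed
  have "\<exists>ps. \<forall>r. finite {\<alpha>\<in>Good e. \<forall>j\<in>V. dg \<alpha> j = r j} \<and>
      card {\<alpha>\<in>Good e. \<forall>j\<in>V. dg \<alpha> j = r j} = hsum V ps r" for e
  proof (rule down_set_count[OF finV])
    show "blk i \<in> V" if "i < m" for i using blk_vec[OF that] by simp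
    show "\<alpha> i = 0" if "\<alpha> \<in> Good e" "i \<ge> m" for \<alpha> i using that by (simp add: Good_def)
    show "\<beta> \<in> Good e" if "\<alpha> \<in> Good e" "\<beta> \<le> \<alpha>" for \<alpha> \<beta> by (rule down[OF that])
  qed
  then have "\<forall>e. \<exists>ps. \<forall>r. finite {\<alpha>\<in>Good e. \<forall>j\<in>V. dg \<alpha> j = r j} \<and>
      card {\<alpha>\<in>Good e. \<forall>j\<in>V. dg \<alpha> j = r j} = hsum V ps r" by blast
  from choice[OF this] obtain P where P: "\<forall>e r. finite {\<alpha>\<in>Good e. \<forall>j\<in>V. dg \<alpha> j = r j} \<and>
      card {\<alpha>\<in>Good e. \<forall>j\<in>V. dg \<alpha> j = r j} = hsum V (P e) r" ..
  have "card (exps (K * Z r) - exps (J * Z r)) = hsum V (concat (map P [0..<n])) r" for r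
  proof -
    let ?S = "SIGMA e:{..<n}. {\<alpha>\<in>Good e. \<forall>j\<in>V. dg \<alpha> j = r j}"
    let ?T = "exps (K * Z r) - exps (J * Z r)"
    have "bij_betw (\<lambda>(e, \<alpha>). psi e \<alpha>) ?S ?T"
      unfolding bij_betw_def
    proof
      show "inj_on (\<lambda>(e, \<alpha>). psi e \<alpha>) ?S"
      proof (rule inj_onI, clarify)
        fix e \<alpha> e' \<alpha>'
        assume h: "e < n" "e' < n" "\<alpha> \<in> Good e" "\<alpha>' \<in> Good e'" "\<forall>j\<in>V. dg \<alpha> j = r j"
          "\<forall>j\<in>V. dg \<alpha>' j = r j" "psi e \<alpha> = psi e' \<alpha>'"
        have z: "\<forall>i\<ge>m. \<alpha> i = 0" "\<forall>i\<ge>m. \<alpha>' i = 0" using h(3,4) by (auto simp: Good_def)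
        have "{k. (\<alpha>(m := e)) k \<noteq> (\<alpha>'(m := e')) k} \<subseteq> {..m}"
        proof
          fix k assume "k \<in> {k. (\<alpha>(m := e)) k \<noteq> (\<alpha>'(m := e')) k}"
          then show "k \<in> {..m}" using z by (cases "k \<le> m") auto
        qed
        then have "finite {k. (\<alpha>(m := e)) k \<noteq> (\<alpha>'(m := e')) k}"
          by (rule finite_subset) simp
        then have "less_fun (\<alpha>(m := e)) (\<alpha>'(m := e')) \<or> \<alpha>(m := e) = \<alpha>'(m := e') \<or>
            less_fun (\<alpha>'(m := e')) (\<alpha>(m := e))" by (rule less_fun_trichotomy)
        moreover have "\<not> less_fun (\<alpha>(m := e)) (\<alpha>'(m := e'))"
        proof
          assume "less_fun (\<alpha>(m := e)) (\<alpha>'(m := e'))"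
          moreover have "\<forall>j\<in>V. dg \<alpha> j = dg \<alpha>' j" using h(5,6) by simp
          ultimately show False using h(4,1,7) z(1) unfolding Good_def by blast
        qed
        moreover have "\<not> less_fun (\<alpha>'(m := e')) (\<alpha>(m := e))"
        proof
          assume "less_fun (\<alpha>'(m := e')) (\<alpha>(m := e))"
          moreover have "\<forall>j\<in>V. dg \<alpha>' j = dg \<alpha> j" using h(5,6) by simp
          ultimately show False using h(3,2) h(7)[symmetric] z(2) unfolding Good_def by blast
        qed
        ultimately have eq: "\<alpha>(m := e) = \<alpha>'(m := e')" by blast
        have "e = e'" using fun_cong[OF eq, of m] by simp
        moreover have "\<alpha> = \<alpha>'"
        proof
          fix i show "\<alpha> i = \<alpha>' i" using fun_cong[OF eq, of i] z by (cases "i = m") auto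
        qed
        ultimately show "e = e' \<and> \<alpha> = \<alpha>'" by simp
      qed
      show "(\<lambda>(e, \<alpha>). psi e \<alpha>) ` ?S = ?T"
      proof (rule subset_antisym; rule subsetI)
        fix k assume "k \<in> (\<lambda>(e, \<alpha>). psi e \<alpha>) ` ?S"
        then obtain e \<alpha> where h: "e < n" "\<alpha> \<in> Good e" "\<forall>j\<in>V. dg \<alpha> j = r j" "k = psi e \<alpha>" by auto
        have Zr: "Z (dg \<alpha>) = Z r" by (rule Z_cong) (use h(3) in auto)
        have "es ! e \<in> exps K" using h(1) es nth_mem[of e es] by (auto simp: n_def)
        then have "k \<in> exps (K * Z r)"
          unfolding h(4) psi_def using phi_in_Z[of \<alpha>] by (auto simp: Zr intro!: exps_timesI)
        moreover have "k \<notin> exps (J * Z r)" using h(2) unfolding h(4) by (simp add: Good_def Zr)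
        ultimately show "k \<in> ?T" by blast
      next
        fix k assume k: "k \<in> ?T"
        then obtain a z where az: "k = a + z" "a \<in> exps K" "z \<in> exps (Z r)" by (auto simp: exps_times)
        define R where "R = {\<alpha>(m := e) | e \<alpha>. e < n \<and> (\<forall>i\<ge>m. \<alpha> i = 0) \<and> (\<forall>j\<in>V. dg \<alpha> j = r j) \<and> psi e \<alpha> = k}"
        have "R \<noteq> {}"
        proof -
          obtain \<alpha> where \<alpha>: "\<forall>i\<ge>m. \<alpha> i = 0" "\<forall>j\<in>V. dg \<alpha> j = r j" "phi \<alpha> \<le> z"
            using Z_rep[OF az(3)] by blast
          have Zr: "Z (dg \<alpha>) = Z r" by (rule Z_cong) (use \<alpha>(2) in auto)
          \<comment> \<open>The surplus of z over \<open>phi \<alpha>\<close> is given to the factor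
            from K. It cannot enter J, since k would then lie in \<open>J * Z r\<close>, so the
            result is one of the listed exponents.\<close>
          define a' where "a' = a + (z - phi \<alpha>)"
          have k': "k = a' + phi \<alpha>"
            using add_diff_fun[OF \<alpha>(3)] unfolding a'_def az(1) by (metis add.assoc add.commute)
          have "a' \<in> exps K" by (rule exps_up[OF az(2)]) (simp add: a'_def le_fun_def)
          moreover have "a' \<notin> exps J"
            using k phi_in_Z[of \<alpha>] exps_timesI[of a' J "phi \<alpha>" "Z r"] unfolding k' Zr by blast
          ultimately obtain e where "e < n" "es ! e = a'"
            using es by (metis DiffI in_set_conv_nth n_def)
          then have "\<alpha>(m := e) \<in> R" unfolding R_def using \<alpha>(1,2) k' by (auto simp: psi_def)
          then show ?thesis by blast
        qed
        moreover have "finite R"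
        proof (rule finite_subset)
          \<comment> \<open>A coordinate of \<alpha> is at most the multidegree of its block, and
            the summand n covers the index stored in slot m. So only finitely many representations
            compete and a least one exists.\<close>
          define B where "B = n + (\<Sum>j\<in>V. r j)"
          show "finite {f. \<forall>x. (x \<in> {..m} \<longrightarrow> f x \<in> {..B}) \<and> (x \<notin> {..m} \<longrightarrow> f x = (0::nat))}"
            by (rule finite_set_of_finite_funs) auto
          show "R \<subseteq> {f. \<forall>x. (x \<in> {..m} \<longrightarrow> f x \<in> {..B}) \<and> (x \<notin> {..m} \<longrightarrow> f x = (0::nat))}"
          proof
            fix f assume "f \<in> R"
            then obtain e \<alpha> where h: "f = \<alpha>(m := e)" "e < n" "\<forall>i\<ge>m. \<alpha> i = 0" "\<forall>j\<in>V. dg \<alpha> j = r j"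
              by (auto simp: R_def)
            have "\<alpha> i \<le> B" if "i < m" for i
            proof -
              have "\<alpha> i \<le> dg \<alpha> (blk i)"
                unfolding bdeg_def using member_le_sum[of i "{..<m}" "\<lambda>i'. if blk i' = blk i then \<alpha> i' else 0"] that
                by auto
              also have "\<dots> = r (blk i)" using h(4) blk_vec[OF that] by simp
              also have "\<dots> \<le> (\<Sum>j\<in>V. r j)" using blk_vec[OF that] finV by (intro member_le_sum) auto
              finally show ?thesis by (simp add: B_def)
            qed
            then show "f \<in> {f. \<forall>x. (x \<in> {..m} \<longrightarrow> f x \<in> {..B}) \<and> (x \<notin> {..m} \<longrightarrow> f x = (0::nat))}"
              using h(2,3) by (auto simp: h(1) B_def)
          qed
        qed
        moreover have "asymp_on R less_fun" by (intro asymp_onI less_fun_asym)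
        moreover have "transp_on R less_fun" by (intro transp_onI) (rule less_fun_trans)
        ultimately have "\<exists>f\<in>R. \<forall>x\<in>R. x \<noteq> f \<longrightarrow> \<not> less_fun x f"
          by (intro Finite_Set.bex_min_element)
        then obtain f where f: "f \<in> R" "\<forall>x\<in>R. x \<noteq> f \<longrightarrow> \<not> less_fun x f" by blast
        then obtain e \<alpha> where h: "f = \<alpha>(m := e)" "e < n" "\<forall>i\<ge>m. \<alpha> i = 0" "\<forall>j\<in>V. dg \<alpha> j = r j" "psi e \<alpha> = k"
          by (auto simp: R_def)
        have Zr: "Z (dg \<alpha>) = Z r" by (rule Z_cong) (use h(4) in auto)
        have "\<alpha> \<in> Good e"
          unfolding Good_def
        proof (intro CollectI conjI notI)
          show "\<forall>i\<ge>m. \<alpha> i = 0" by (rule h(3))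
          show False if "psi e \<alpha> \<in> exps (J * Z (dg \<alpha>))" using that k by (simp add: h(5) Zr)
          assume "\<exists>e'<n. \<exists>\<alpha>'. (\<forall>i\<ge>m. \<alpha>' i = 0) \<and> (\<forall>j\<in>V. dg \<alpha>' j = dg \<alpha> j) \<and> psi e' \<alpha>' = psi e \<alpha> \<and>
              less_fun (\<alpha>'(m := e')) (\<alpha>(m := e))"
          then obtain e' \<alpha>' where g: "e' < n" "\<forall>i\<ge>m. \<alpha>' i = 0" "\<forall>j\<in>V. dg \<alpha>' j = dg \<alpha> j"
            "psi e' \<alpha>' = psi e \<alpha>" "less_fun (\<alpha>'(m := e')) f" unfolding h(1) by blast
          define f' where "f' = \<alpha>'(m := e')"
          have "f' \<in> R" using g(1-4) h(4,5) unfolding R_def f'_def by auto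
          moreover have "less_fun f' f" using g(5) by (simp add: f'_def)
          moreover from this have "f' \<noteq> f" using less_fun_irrefl[of f] by auto
          ultimately show False using f(2) by simp
        qed
        then show "k \<in> (\<lambda>(e, \<alpha>). psi e \<alpha>) ` ?S"
          using h by (intro image_eqI[of _ _ "(e, \<alpha>)"]) auto
      qed
    qed
    then have "card ?T = card ?S" by (simp add: bij_betw_same_card)
    also have "\<dots> = (\<Sum>e<n. card {\<alpha>\<in>Good e. \<forall>j\<in>V. dg \<alpha> j = r j})"
      using P by (intro card_SigmaI) auto
    also have "\<dots> = (\<Sum>e<n. hsum V (P e) r)" using P by simp
    finally show ?thesis by (simp add: hsum_concat)
  qed
  then show ?thesis by blast
qed


section \<open>Newton polynomials and iterated differences\<close>

text \<open>Polynomial functions in the basis of products of binomial coefficients.  The coefficients are the multiplicities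
  in \<open>ps\<close>, hence nonnegative.\<close>

definition newt :: "nat set \<Rightarrow> (nat \<Rightarrow> nat) list \<Rightarrow> (nat \<Rightarrow> nat) \<Rightarrow> nat" where
  "newt V ps x = (\<Sum>p\<leftarrow>ps. \<Prod>j\<in>V. x j choose p j)"

lemma newt_Nil [simp]: "newt V [] x = 0"
  by (simp add: newt_def)

lemma newt_Cons [simp]: "newt V (p # ps) x = (\<Prod>j\<in>V. x j choose p j) + newt V ps x"
  by (simp add: newt_def)

lemma newt_append [simp]: "newt V (ps @ qs) x = newt V ps x + newt V qs x"
  by (simp add: newt_def)

lemma newt_cong: "(\<And>j. j \<in> V \<Longrightarrow> x j = y j) \<Longrightarrow> newt V ps x = newt V ps y"
  by (simp add: newt_def cong: prod.cong)

text \<open>Raising the argument by 1 adds a value of \<open>hcoef\<close> for the preceding p, and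
  by Pascal's rule summation raises lower indices of binomials by 1. Starting beyond s makes the
  case p = 0 vanish, and the value at N becomes the constant term; hence all coefficients are
  nonnegative.\<close>

lemma hcoef_newt:
  "s < N \<Longrightarrow> \<exists>ls. \<forall>y. hcoef p s (N + y) = (\<Sum>l\<leftarrow>ls. y choose l)"
proof (induction p arbitrary: N)
  case 0
  then show ?case by (intro exI[of _ "[]"]) auto
next
  case (Suc p)
  then have "s < Suc N" by simp
  from Suc.IH[OF this] obtain ls where ls: "\<And>y. hcoef p s (Suc N + y) = (\<Sum>l\<leftarrow>ls. y choose l)" by blast
  define c where "c = hcoef (Suc p) s N"
  have "hcoef (Suc p) s (N + y) = c + (\<Sum>l\<leftarrow>ls. y choose Suc l)" for y
  proof (induction y)
    case 0
    show ?case by (simp add: c_def del: hcoef.simps)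
  next
    case (Suc y)
    have "hcoef (Suc p) s (N + Suc y) = hcoef (Suc p) s (N + y) + hcoef p s (Suc N + y)" by simp
    also have "\<dots> = c + ((\<Sum>l\<leftarrow>ls. y choose Suc l) + (\<Sum>l\<leftarrow>ls. y choose l))"
      by (simp only: Suc ls add.assoc)
    also have "(\<Sum>l\<leftarrow>ls. y choose Suc l) + (\<Sum>l\<leftarrow>ls. y choose l) = (\<Sum>l\<leftarrow>ls. Suc y choose Suc l)"
      by (simp add: sum_list_addf[symmetric] add.commute)
    finally show ?case .
  qed
  then show ?case
    by (intro exI[of _ "replicate c 0 @ map Suc ls"]) (simp add: comp_def map_replicate_const sum_list_replicate)
qed

lemma prod_newt:
  assumes "finite V"
  shows "\<exists>ps. \<forall>x. (\<Prod>j\<in>V. \<Sum>l\<leftarrow>ls j. x j choose l) = newt V ps x"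
  using assms
proof (induction V rule: finite_induct)
  case empty
  show ?case by (intro exI[of _ "[0]"]) simp
next
  case (insert j V)
  then obtain ps where ps: "\<And>x. (\<Prod>j\<in>V. \<Sum>l\<leftarrow>ls j. x j choose l) = newt V ps x" by blast
  have 1: "newt (insert j V) (map (\<lambda>p. p(j := l)) ps) x = (x j choose l) * newt V ps x" for l x
  proof (induction ps)
    case (Cons p ps)
    have "(\<Prod>i\<in>V. x i choose (p(j := l)) i) = (\<Prod>i\<in>V. x i choose p i)"
      by (rule prod.cong) (use insert.hyps in auto)
    then show ?case using Cons insert.hyps by (simp add: distrib_left)
  qed simp
  have "newt (insert j V) (concat (map (\<lambda>l. map (\<lambda>p. p(j := l)) ps) L)) x =
      (\<Sum>l\<leftarrow>L. x j choose l) * newt V ps x" for L x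
    by (induction L) (simp_all add: 1 distrib_right del: fun_upd_apply)
  then show ?case
    using insert.hyps ps by (intro exI[of _ "concat (map (\<lambda>l. map (\<lambda>p. p(j := l)) ps) (ls j))"]) simp
qed

lemma hsum_newt:
  assumes "finite V"
  shows "\<exists>N0. \<forall>N\<ge>N0. \<exists>qs. \<forall>x. hsum V ps (\<lambda>j. N + x j) = newt V qs x"
proof (induction ps)
  case Nil
  show ?case by (auto simp: hsum_def intro!: exI[of _ "[]"])
next
  case (Cons q ps)
  then obtain N0 where N0: "\<And>N. N \<ge> N0 \<Longrightarrow> \<exists>qs. \<forall>x. hsum V ps (\<lambda>j. N + x j) = newt V qs x" by blast
  \<comment> \<open>Beyond the threshold of the remaining terms and beyond every shift in q.\<close>
  define N1 where "N1 = N0 + (\<Sum>j\<in>V. Suc (fst q j))"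
  have "\<exists>qs. \<forall>x. hsum V (q # ps) (\<lambda>j. N + x j) = newt V qs x" if N: "N \<ge> N1" for N
  proof -
    have "N \<ge> N0" using N by (simp add: N1_def)
    then obtain qs where qs: "\<forall>x. hsum V ps (\<lambda>j. N + x j) = newt V qs x" using N0 by blast
    have "\<forall>j. \<exists>ls. j \<in> V \<longrightarrow> (\<forall>y. hcoef (snd q j) (fst q j) (N + y) = (\<Sum>l\<leftarrow>ls. y choose l))"
    proof
      fix j
      show "\<exists>ls. j \<in> V \<longrightarrow> (\<forall>y. hcoef (snd q j) (fst q j) (N + y) = (\<Sum>l\<leftarrow>ls. y choose l))"
      proof (cases "j \<in> V")
        case True
        have "Suc (fst q j) \<le> (\<Sum>j\<in>V. Suc (fst q j))"
          using assms True by (intro member_le_sum) auto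
        then have "fst q j < N" using N by (simp add: N1_def)
        from hcoef_newt[OF this] show ?thesis by blast
      qed simp
    qed
    from choice[OF this] obtain ls where ls:
      "\<And>j y. j \<in> V \<Longrightarrow> hcoef (snd q j) (fst q j) (N + y) = (\<Sum>l\<leftarrow>ls j. y choose l)" by blast
    obtain rs where rs: "\<And>x. (\<Prod>j\<in>V. \<Sum>l\<leftarrow>ls j. x j choose l) = newt V rs x"
      using prod_newt[OF assms] by blast
    have "hterm V q (\<lambda>j. N + x j) = newt V rs x" for x
      unfolding hterm_def rs[symmetric] by (rule prod.cong) (simp_all add: ls)
    then show ?thesis
      using qs by (intro exI[of _ "rs @ qs"]) (simp add: hsum_def)
  qed
  then show ?case by blast
qed

lemma card_difference_newt:
  fixes A :: "nat \<Rightarrow> 'n::finite upset"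
  assumes "finite V" "finite (exps K - exps J)"
  shows "\<exists>N0. \<forall>N\<ge>N0. \<exists>ps. \<forall>x.
    card (exps (K * (\<Prod>j\<in>V. A j ^ (N + x j))) - exps (J * (\<Prod>j\<in>V. A j ^ (N + x j)))) = newt V ps x"
proof -
  obtain ps where ps: "\<And>r. card (exps (K * (\<Prod>j\<in>V. A j ^ r j)) - exps (J * (\<Prod>j\<in>V. A j ^ r j))) = hsum V ps r"
    using card_difference_hsum[OF assms] by blast
  show ?thesis using hsum_newt[OF assms(1), of ps] unfolding ps .
qed

section \<open>Growth and degree of Newton polynomials\<close>

lemma power_le_binomial: "p \<le> P \<Longrightarrow> u ^ p \<le> (P * u) choose p"
proof (cases "p = 0 \<or> u = 0")
  case True
  then show ?thesis by (cases "p = 0") (auto simp: power_0_left)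
next
  case False
  assume p: "p \<le> P"
  have "p \<le> P * u" using p False by (metis le_trans mult_le_mono2 Suc_leI mult.right_neutral One_nat_def gr0I)
  then have "(real (P * u) / real p) ^ p \<le> real (P * u choose p)"
    using binomial_ge_n_over_k_pow_k[of p "P * u", where 'a = real] by simp
  moreover have "real u ^ p \<le> (real (P * u) / real p) ^ p"
    using False p by (intro power_mono) (auto simp: field_simps)
  ultimately have "real (u ^ p) \<le> real (P * u choose p)" unfolding of_nat_power by linarith
  then show ?thesis by (simp only: of_nat_le_iff)
qed

text \<open>As terms cannot cancel, one term of total degree P > d is bounded by the whole sum. At
  the diagonal point P u it is already at least u^P, which outgrows the assumed bound.\<close>

lemma newt_degree_le:
  assumes fin: "finite V" and bound: "\<And>t. newt V ps (\<lambda>_. t) \<le> C * Suc t ^ d" and p: "p \<in> set ps"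
  shows "(\<Sum>j\<in>V. p j) \<le> d"
proof (rule ccontr)
  define P where "P = (\<Sum>j\<in>V. p j)"
  assume "\<not> ?thesis"
  then have d: "Suc d \<le> P" by (simp add: P_def)
  \<comment> \<open>Larger than the constant C (P + 1)^d that is left when u^(d + 1) is compared
    with C (P u + 1)^d.\<close>
  define u where "u = C * (P + 1) ^ d + 1"
  have u: "u \<ge> 1" by (simp add: u_def)
  have "u ^ Suc d \<le> u ^ P" using u d by (intro power_increasing) auto
  also have "\<dots> = (\<Prod>j\<in>V. u ^ p j)" by (simp add: P_def power_sum)
  also have "\<dots> \<le> (\<Prod>j\<in>V. (P * u) choose p j)"
  proof (rule prod_mono)
    fix j assume "j \<in> V"
    then have "p j \<le> P" unfolding P_def using fin by (intro member_le_sum) auto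
    then show "0 \<le> u ^ p j \<and> u ^ p j \<le> (P * u) choose p j" using power_le_binomial by simp
  qed
  also have "\<dots> \<le> newt V ps (\<lambda>_. P * u)"
    unfolding newt_def by (rule member_le_sum_list) (use p in auto)
  also have "\<dots> \<le> C * Suc (P * u) ^ d" by (rule bound)
  also have "\<dots> \<le> C * ((P + 1) * u) ^ d"
    using u by (intro mult_left_mono power_mono) auto
  also have "\<dots> = (C * (P + 1) ^ d) * u ^ d" by (simp only: power_mult_distrib mult.assoc)
  finally have "u * u ^ d \<le> (C * (P + 1) ^ d) * u ^ d" by (simp only: power_Suc)
  then have "u \<le> C * (P + 1) ^ d" using u by simp
  then show False by (simp add: u_def)
qed

lemma binomial_le_Suc_power: "t choose p \<le> Suc t ^ p"
proof (cases "p \<le> t")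
  case True
  then have "t choose p \<le> t ^ p" by (rule binomial_le_pow)
  also have "\<dots> \<le> Suc t ^ p" by (rule power_mono) auto
  finally show ?thesis .
qed (simp add: binomial_eq_0)

lemma newt_upper:
  assumes "finite V" "\<And>p. p \<in> set ps \<Longrightarrow> (\<Sum>j\<in>V. p j) \<le> d"
  shows "newt V ps (\<lambda>_. t) \<le> length ps * Suc t ^ d"
  using assms(2)
proof (induction ps)
  case (Cons p ps)
  have "(\<Prod>j\<in>V. t choose p j) \<le> (\<Prod>j\<in>V. Suc t ^ p j)"
    by (rule prod_mono) (auto intro: binomial_le_Suc_power)
  also have "\<dots> = Suc t ^ (\<Sum>j\<in>V. p j)" by (simp add: power_sum)
  also have "\<dots> \<le> Suc t ^ d" using Cons.prems by (intro power_increasing) auto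
  finally show ?case using Cons by simp
qed simp

lemma binomial_shift_le: "p > 0 \<Longrightarrow> (t + c) choose p \<le> (t choose p) + c * ((t + c) choose (p - 1))"
proof (induction c)
  case (Suc c)
  then obtain p' where p: "p = Suc p'" by (cases p) auto
  have "(t + Suc c) choose p = ((t + c) choose p) + ((t + c) choose p')" by (simp add: p)
  also have "\<dots> \<le> (t choose p) + c * ((t + c) choose p') + ((t + c) choose p')"
    using Suc by (simp add: p)
  also have "\<dots> = (t choose p) + Suc c * ((t + c) choose p')" by simp
  also have "\<dots> \<le> (t choose p) + Suc c * ((t + Suc c) choose p')"
    by (intro add_left_mono mult_le_mono2 binomial_right_mono) simp
  finally show ?case by (simp only: p diff_Suc_1)
qed simp

text \<open>A shift by c in one variable adds to each term at most c binomials whose lower index is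
  smaller by 1, which costs one degree. Later this makes multiplication by a fixed power of one of
  the ideals invisible in top degree.\<close>

lemma newt_shift_upper:
  assumes "finite V" "j \<in> V" "\<And>p. p \<in> set ps \<Longrightarrow> (\<Sum>j\<in>V. p j) \<le> d"
  shows "newt V ps ((\<lambda>_. t)(j := t + c)) \<le> newt V ps (\<lambda>_. t) + length ps * (c * Suc (t + c) ^ (d - 1))"
  using assms(3)
proof (induction ps)
  case (Cons p ps)
  let ?q = "\<Prod>i\<in>V - {j}. t choose p i"
  have 1: "(\<Prod>i\<in>V. ((\<lambda>_. t)(j := t + c)) i choose p i) = ((t + c) choose p j) * ?q"
    using assms(1,2) by (simp add: prod.remove)
  have 2: "(\<Prod>i\<in>V. t choose p i) = (t choose p j) * ?q"
    using assms(1,2) by (simp add: prod.remove)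
  have "((t + c) choose p j) * ?q \<le> (t choose p j) * ?q + c * Suc (t + c) ^ (d - 1)"
  proof (cases "p j = 0")
    case False
    have "(\<Sum>i\<in>V. p i) = p j + (\<Sum>i\<in>V - {j}. p i)" using assms(1,2) by (simp add: sum.remove)
    then have e: "p j - 1 + (\<Sum>i\<in>V - {j}. p i) \<le> d - 1" using Cons.prems[of p] False by simp
    have "((t + c) choose p j) * ?q \<le> ((t choose p j) + c * ((t + c) choose (p j - 1))) * ?q"
      using False by (intro mult_le_mono1 binomial_shift_le) simp
    also have "\<dots> = (t choose p j) * ?q + c * (((t + c) choose (p j - 1)) * ?q)"
      by (simp add: distrib_right mult.assoc)
    also have "((t + c) choose (p j - 1)) * ?q \<le> Suc (t + c) ^ (p j - 1) * (\<Prod>i\<in>V - {j}. Suc (t + c) ^ p i)"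
    proof (rule mult_le_mono[OF binomial_le_Suc_power prod_mono])
      fix i
      have "t choose p i \<le> (t + c) choose p i" by (rule binomial_right_mono) simp
      also have "\<dots> \<le> Suc (t + c) ^ p i" by (rule binomial_le_Suc_power)
      finally show "0 \<le> t choose p i \<and> t choose p i \<le> Suc (t + c) ^ p i" by simp
    qed
    also have "\<dots> = Suc (t + c) ^ (p j - 1 + (\<Sum>i\<in>V - {j}. p i))" by (simp add: power_sum power_add)
    also have "\<dots> \<le> Suc (t + c) ^ (d - 1)" using e by (intro power_increasing) auto
    finally show ?thesis by simp
  qed simp
  moreover have "newt V ps ((\<lambda>_. t)(j := t + c)) \<le> newt V ps (\<lambda>_. t) + length ps * (c * Suc (t + c) ^ (d - 1))"
    using Cons by (simp del: fun_upd_apply)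
  ultimately show ?case unfolding newt_Cons 1 2 by simp
qed simp

section \<open>Iterated differences of Newton polynomials\<close>

definition fdiff :: "nat \<Rightarrow> ((nat \<Rightarrow> nat) \<Rightarrow> 'a::ab_group_add) \<Rightarrow> (nat \<Rightarrow> nat) \<Rightarrow> 'a" where
  "fdiff j f x = f (x(j := Suc (x j))) - f x"

primrec iter_diff :: "nat list \<Rightarrow> ((nat \<Rightarrow> nat) \<Rightarrow> 'a::ab_group_add) \<Rightarrow> (nat \<Rightarrow> nat) \<Rightarrow> 'a" where
  "iter_diff [] f = f"
| "iter_diff (j # js) f = iter_diff js (fdiff j f)"

text \<open>The list belonging to the difference in direction j: by Pascal's rule the index at j
  drops by 1, and terms constant in that variable disappear.\<close>

definition nsub :: "nat \<Rightarrow> (nat \<Rightarrow> nat) list \<Rightarrow> (nat \<Rightarrow> nat) list" where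
  "nsub j ps = map (\<lambda>p. p(j := p j - 1)) (filter (\<lambda>p. 0 < p j) ps)"

lemma newt_Suc:
  assumes "finite V" "j \<in> V"
  shows "newt V ps (x(j := Suc (x j))) = newt V ps x + newt V (nsub j ps) x"
proof (induction ps)
  case (Cons p ps)
  let ?q = "\<Prod>i\<in>V - {j}. x i choose p i"
  have 1: "(\<Prod>i\<in>V. (x(j := Suc (x j))) i choose p i) = (Suc (x j) choose p j) * ?q"
    using assms by (simp add: prod.remove)
  have 2: "(\<Prod>i\<in>V. x i choose p i) = (x j choose p j) * ?q"
    using assms by (simp add: prod.remove)
  have 3: "(\<Prod>i\<in>V. x i choose (p(j := p j - 1)) i) = (x j choose (p j - 1)) * ?q"
    using assms by (simp add: prod.remove)
  show ?case
  proof (cases "p j")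
    case 0
    then have "nsub j (p # ps) = nsub j ps" by (simp add: nsub_def)
    then show ?thesis using Cons 0 by (simp only: newt_Cons 1 2) simp
  next
    case (Suc l)
    have e: "nsub j (p # ps) = p(j := p j - 1) # nsub j ps" using Suc by (simp add: nsub_def)
    show ?thesis
      unfolding e newt_Cons 1 2 3 Cons using Suc by (simp add: distrib_right)
  qed
qed (simp add: nsub_def)

lemma fdiff_newt:
  assumes "finite V" "j \<in> V"
  shows "fdiff j (\<lambda>x. int (newt V ps x)) = (\<lambda>x. int (newt V (nsub j ps) x))"
  by (rule ext) (simp add: fdiff_def newt_Suc[OF assms])

text \<open>The difference of a Newton sum is again one with natural coefficients, so no sign can
  appear.\<close>

lemma iter_diff_newt_nonneg:
  assumes "finite V" "set js \<subseteq> V"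
  shows "iter_diff js (\<lambda>x. int (newt V ps x)) x \<ge> 0"
  using assms(2) by (induction js arbitrary: ps) (simp_all add: fdiff_newt[OF assms(1)])

lemma filter_nsub:
  "length (filter (\<lambda>p. \<forall>i\<in>V. p i = count_list js i) (nsub j ps)) =
   length (filter (\<lambda>p. \<forall>i\<in>V. p i = count_list (j # js) i) ps)" if "j \<in> V"
proof (induction ps)
  case (Cons p ps)
  show ?case
  proof (cases "p j")
    case 0
    then have "\<not> (\<forall>i\<in>V. p i = count_list (j # js) i)" using that by (auto intro: bexI[of _ j])
    then show ?thesis using Cons 0 by (simp add: nsub_def)
  next
    case (Suc l)
    have "nsub j (p # ps) = p(j := p j - 1) # nsub j ps" using Suc by (simp add: nsub_def)
    moreover have "(\<forall>i\<in>V. (p(j := p j - 1)) i = count_list js i) = (\<forall>i\<in>V. p i = count_list (j # js) i)"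
      using that Suc by (intro ball_cong) auto
    ultimately show ?thesis using Cons by (simp del: fun_upd_apply)
  qed
qed (simp add: nsub_def)

text \<open>Every difference lowers one index, and at the origin exactly the terms survive whose
  indices have all come down to 0. Iterated differences at 0 thus read off single coefficients in
  this basis.\<close>

lemma iter_diff_newt_0:
  assumes "finite V" "set js \<subseteq> V"
  shows "iter_diff js (\<lambda>x. int (newt V ps x)) (\<lambda>_. 0) = int (length (filter (\<lambda>p. \<forall>j\<in>V. p j = count_list js j) ps))"
  using assms(2)
proof (induction js arbitrary: ps)
  case Nil
  show ?case
  proof (simp, induction ps)
    case (Cons p ps)
    have "(\<Prod>j\<in>V. 0 choose p j) = (if \<forall>j\<in>V. p j = 0 then 1 else 0)"
      using assms(1) by (auto simp: prod_zero_iff binomial_eq_0_iff intro!: prod.neutral)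
    then show ?case using Cons by simp
  qed simp
next
  case (Cons j js)
  then show ?case using filter_nsub[of j V js ps] by (simp add: fdiff_newt[OF assms(1)])
qed

text \<open>When the degree is at most the number of differences, only constants can be left, so the
  same coefficient is read off at any point.\<close>

lemma iter_diff_newt_const:
  assumes "finite V" "set js \<subseteq> V" "\<And>p. p \<in> set ps \<Longrightarrow> (\<Sum>j\<in>V. p j) \<le> length js"
  shows "iter_diff js (\<lambda>x. int (newt V ps x)) y = int (length (filter (\<lambda>p. \<forall>j\<in>V. p j = count_list js j) ps))"
  using assms(2,3)
proof (induction js arbitrary: ps)
  case Nil
  show ?case
    using Nil(2)
  proof (simp, induction ps)
    case (Cons p ps)
    have "(\<Prod>j\<in>V. y j choose p j) = 1" "\<forall>j\<in>V. p j = 0"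
      using Cons.prems[of p] assms(1) by (auto intro!: prod.neutral)
    then show ?case using Cons by simp
  qed simp
next
  case (Cons j js)
  have j: "j \<in> V" using Cons.prems by simp
  have "(\<Sum>i\<in>V. q i) \<le> length js" if "q \<in> set (nsub j ps)" for q
  proof -
    obtain p where p: "p \<in> set ps" "0 < p j" "q = p(j := p j - 1)" using \<open>q \<in> set (nsub j ps)\<close> by (auto simp: nsub_def)
    have "(\<Sum>i\<in>V. q i) = (p j - 1) + (\<Sum>i\<in>V - {j}. p i)" using assms(1) j by (simp add: p(3) sum.remove)
    moreover have "(\<Sum>i\<in>V. p i) = p j + (\<Sum>i\<in>V - {j}. p i)" using assms(1) j by (simp add: sum.remove)
    ultimately show ?thesis using Cons.prems(2)[OF p(1)] p(2) by simp
  qed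
  then show ?case
    using Cons.IH[of "nsub j ps"] Cons.prems filter_nsub[of j V js ps] by (simp add: fdiff_newt[OF assms(1)])
qed

lemma fdiff_diff: "fdiff j (\<lambda>x. f x - g x) = (\<lambda>x. fdiff j f x - fdiff j g x)"
  by (auto simp: fdiff_def)

lemma iter_diff_diff: "iter_diff js (\<lambda>x. f x - g x) y = iter_diff js f y - iter_diff js g y"
  by (induction js arbitrary: f g) (simp_all add: fdiff_diff)

lemma fdiff_0: "fdiff j (\<lambda>x. 0) = (\<lambda>x. 0)"
  by (auto simp: fdiff_def)

lemma iter_diff_0: "iter_diff js (\<lambda>x. 0) y = 0"
  by (induction js) (simp_all add: fdiff_0)

text \<open>Differences look only forward, so functions that agree for all large arguments have the
  same iterated differences there.\<close>

lemma iter_diff_cong: "(\<And>x. x \<ge> y \<Longrightarrow> f x = g x) \<Longrightarrow> iter_diff js f y = iter_diff js g y"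
proof (induction js arbitrary: f g)
  case (Cons j js)
  have "fdiff j f x = fdiff j g x" if "x \<ge> y" for x
  proof -
    have "x \<le> x(j := Suc (x j))" by (simp add: le_fun_def)
    then have "x(j := Suc (x j)) \<ge> y" using that by (rule order_trans[rotated])
    then show ?thesis using Cons.prems that by (simp add: fdiff_def)
  qed
  then show ?case unfolding iter_diff.simps by (rule Cons.IH)
qed simp

lemma iter_diff_shift: "iter_diff js f (\<lambda>j. a j + x j) = iter_diff js (\<lambda>x. f (\<lambda>j. a j + x j)) x"
proof (induction js arbitrary: f)
  case (Cons j js)
  have "(\<lambda>x. fdiff j f (\<lambda>j. a j + x j)) = fdiff j (\<lambda>x. f (\<lambda>j. a j + x j))"
  proof
    fix x
    have "(\<lambda>i. a i + x i)(j := Suc (a j + x j)) = (\<lambda>i. a i + (x(j := Suc (x j))) i)"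
      by (auto simp: fun_eq_iff)
    then show "fdiff j f (\<lambda>j. a j + x j) = fdiff j (\<lambda>x. f (\<lambda>j. a j + x j)) x"
      by (simp add: fdiff_def)
  qed
  then show ?case using Cons by simp
qed simp

text \<open>The exponent with which the ideal of block b occurs once equal entries of a tuple are
  collected; \<beta> assigns a block to each position.\<close>

definition blocksum :: "nat set \<Rightarrow> (nat \<Rightarrow> nat) \<Rightarrow> (nat \<Rightarrow> nat) \<Rightarrow> nat \<Rightarrow> nat" where
  "blocksum V \<beta> r b = (\<Sum>j\<in>V. if \<beta> j = b then r j else 0)"

lemma blocksum_upd:
  assumes "finite V" "j \<in> V"
  shows "blocksum V \<beta> (r(j := Suc (r j))) = (blocksum V \<beta> r)(\<beta> j := Suc (blocksum V \<beta> r (\<beta> j)))"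
proof
  fix b
  have "(\<Sum>i\<in>V - {j}. if \<beta> i = b then (r(j := Suc (r j))) i else 0) = (\<Sum>i\<in>V - {j}. if \<beta> i = b then r i else 0)"
    by (rule sum.cong) auto
  then show "blocksum V \<beta> (r(j := Suc (r j))) b = ((blocksum V \<beta> r)(\<beta> j := Suc (blocksum V \<beta> r (\<beta> j)))) b"
    using assms by (auto simp: blocksum_def sum.remove)
qed

lemma iter_diff_blocksum:
  assumes "finite V" "set js \<subseteq> V"
  shows "iter_diff js (\<lambda>r. g (blocksum V \<beta> r)) r = iter_diff (map \<beta> js) g (blocksum V \<beta> r)"
  using assms(2)
proof (induction js arbitrary: g)
  case (Cons j js)
  have "fdiff j (\<lambda>r. g (blocksum V \<beta> r)) = (\<lambda>r. fdiff (\<beta> j) g (blocksum V \<beta> r))"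
    using blocksum_upd[OF assms(1), of j] Cons.prems by (auto simp: fdiff_def)
  then show ?case using Cons by simp
qed simp

lemma prod_blocksum:
  fixes A :: "nat \<Rightarrow> 'n upset"
  assumes "finite V" "finite W" "\<beta> ` V \<subseteq> W"
  shows "(\<Prod>j\<in>V. A (\<beta> j) ^ r j) = (\<Prod>b\<in>W. A b ^ blocksum V \<beta> r b)"
proof -
  have "(\<Prod>b\<in>W. A b ^ blocksum V \<beta> r b) = (\<Prod>b\<in>W. \<Prod>j\<in>V. A b ^ (if \<beta> j = b then r j else 0))"
    by (simp add: blocksum_def power_sum)
  also have "\<dots> = (\<Prod>j\<in>V. \<Prod>b\<in>W. A b ^ (if \<beta> j = b then r j else 0))"
    by (rule prod.swap)
  also have "\<dots> = (\<Prod>j\<in>V. A (\<beta> j) ^ r j)"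
  proof (rule prod.cong[OF refl])
    fix j assume "j \<in> V"
    then have b: "\<beta> j \<in> W" using assms(3) by auto
    have "(\<Prod>b\<in>W. A b ^ (if \<beta> j = b then r j else 0)) = (\<Prod>b\<in>W. if \<beta> j = b then A b ^ r j else 1)"
      by (rule prod.cong) auto
    then show "(\<Prod>b\<in>W. A b ^ (if \<beta> j = b then r j else 0)) = A (\<beta> j) ^ r j"
      using b assms(2) by simp
  qed
  finally show ?thesis by simp
qed

text \<open>Variables are released one by one, and the function is recovered by summing its
  difference along the new variable, starting at 0. This is needed because the colength of a product
  is not a count of the form in \<open>card_difference_newt\<close>, whereas its differences
  are.\<close>

lemma newt_from_diffs:
  fixes f :: "(nat \<Rightarrow> nat) \<Rightarrow> nat"
  assumes fin: "finite V"
    and diff: "\<And>j. j \<in> V \<Longrightarrow> \<exists>ps. \<forall>x. f (x(j := Suc (x j))) = f x + newt V ps x"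
    and dep: "\<And>x y. (\<And>j. j \<in> V \<Longrightarrow> x j = y j) \<Longrightarrow> f x = f y"
  shows "\<exists>ps. \<forall>x. f x = newt V ps x"
proof -
  have "W \<subseteq> V \<Longrightarrow> \<exists>ps. \<forall>x. (\<forall>j. j \<notin> W \<longrightarrow> x j = 0) \<longrightarrow> f x = newt W ps x" if "finite W" for W
    using that
  proof (induction W rule: finite_induct)
    case empty
    show ?case
    proof (intro exI[of _ "replicate (f 0) 0"] allI impI)
      fix x :: "nat \<Rightarrow> nat" assume "\<forall>j. j \<notin> {} \<longrightarrow> x j = 0"
      then have "x = 0" by (simp add: fun_eq_iff)
      then show "f x = newt {} (replicate (f 0) 0) x"
        by (simp add: newt_def map_replicate_const sum_list_replicate)
    qed
  next
    case (insert j W)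
    have "W \<subseteq> V" using insert.prems by blast
    from insert.IH[OF this] obtain ps where ps: "\<And>x. (\<forall>j. j \<notin> W \<longrightarrow> x j = 0) \<Longrightarrow> f x = newt W ps x" by blast
    have jV: "j \<in> V" using insert.prems by simp
    obtain qs where qs: "\<And>x. f (x(j := Suc (x j))) = f x + newt V qs x" using diff[OF jV] by blast
    define P where "P = map (\<lambda>p. p(j := 0)) ps"
    \<comment> \<open>An antidifference in direction j: the index there is raised by 1. Terms with a
      positive index at a variable still held at 0 vanish and are dropped.\<close>
    define Q where "Q = map (\<lambda>p. p(j := Suc (p j))) (filter (\<lambda>p. \<forall>k\<in>V - insert j W. p k = 0) qs)"
    have nP: "newt (insert j W) P x = newt W ps x" for x
      unfolding P_def
    proof (induction ps)
      case (Cons p ps)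
      have "(\<Prod>i\<in>W. x i choose (p(j := 0)) i) = (\<Prod>i\<in>W. x i choose p i)"
        by (rule prod.cong) (use insert.hyps in auto)
      then show ?case using Cons insert.hyps by simp
    qed simp
    have nQ: "newt (insert j W) Q (x(j := Suc (x j))) = newt (insert j W) Q x + newt V qs x"
      if x: "\<forall>k. k \<notin> insert j W \<longrightarrow> x k = 0" for x
      unfolding Q_def
    proof (induction qs)
      case (Cons p qs)
      let ?w = "\<Prod>i\<in>W. x i choose p i"
      have V: "V = insert j W \<union> (V - insert j W)" using insert.prems by auto
      have "(\<Prod>i\<in>V. x i choose p i) = (\<Prod>i\<in>insert j W. x i choose p i) * (\<Prod>i\<in>V - insert j W. x i choose p i)"
        using insert.prems fin by (metis prod.subset_diff mult.commute)
      also have "(\<Prod>i\<in>V - insert j W. x i choose p i) = (\<Prod>i\<in>V - insert j W. if p i = 0 then 1 else 0)"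
        by (rule prod.cong) (use x in \<open>auto simp: binomial_eq_0_iff\<close>)
      also have "\<dots> = (if \<forall>k\<in>V - insert j W. p k = 0 then 1 else 0)"
        using fin by (auto simp: prod_zero_iff intro!: prod.neutral)
      finally have 1: "(\<Prod>i\<in>V. x i choose p i) = (if \<forall>k\<in>V - insert j W. p k = 0 then (x j choose p j) * ?w else 0)"
        using insert.hyps by simp
      have 2: "(\<Prod>i\<in>insert j W. y i choose (p(j := Suc (p j))) i) = (y j choose Suc (p j)) * ?w"
        if "\<And>i. i \<noteq> j \<Longrightarrow> y i = x i" for y
      proof -
        have "(\<Prod>i\<in>W. y i choose (p(j := Suc (p j))) i) = ?w"
          by (rule prod.cong) (use insert.hyps that in auto)
        then show ?thesis using insert.hyps by simp
      qed
      show ?case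
      proof (cases "\<forall>k\<in>V - insert j W. p k = 0")
        case True
        have e: "(\<Prod>i\<in>insert j W. (x(j := Suc (x j))) i choose (p(j := Suc (p j))) i) =
           (\<Prod>i\<in>insert j W. x i choose (p(j := Suc (p j))) i) + (\<Prod>i\<in>V. x i choose p i)"
          unfolding 1 using True 2[of "x(j := Suc (x j))"] 2[of x] by (simp add: distrib_right)
        have f: "filter (\<lambda>p. \<forall>k\<in>V - insert j W. p k = 0) (p # qs) = p # filter (\<lambda>p. \<forall>k\<in>V - insert j W. p k = 0) qs"
          using True by simp
        show ?thesis unfolding f list.map newt_Cons e Cons by (simp only: ac_simps)
      next
        case False
        have f: "filter (\<lambda>p. \<forall>k\<in>V - insert j W. p k = 0) (p # qs) = filter (\<lambda>p. \<forall>k\<in>V - insert j W. p k = 0) qs"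
          using False by simp
        have "(\<Prod>i\<in>V. x i choose p i) = 0" unfolding 1 by (rule if_not_P[OF False])
        then show ?thesis unfolding f newt_Cons Cons by (simp only: add_0)
      qed
    qed simp
    have nQ0: "newt (insert j W) Q x = 0" if "x j = 0" for x
      unfolding Q_def
    proof (induction qs)
      case (Cons p qs)
      have "(\<Prod>i\<in>insert j W. x i choose (p(j := Suc (p j))) i) = 0"
        using insert.hyps that by simp
      then show ?case using Cons by simp
    qed simp
    have "f x = newt (insert j W) (P @ Q) x" if x: "\<forall>k. k \<notin> insert j W \<longrightarrow> x k = 0" for x
    proof -
      have "f (x(j := s)) = newt (insert j W) (P @ Q) (x(j := s))" for s
      proof (induction s)
        case 0
        have "f (x(j := 0)) = newt W ps (x(j := 0))" by (rule ps) (use x in auto)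
        moreover have "newt (insert j W) Q (x(j := 0)) = 0" by (rule nQ0) simp
        ultimately show ?case unfolding newt_append nP by linarith
      next
        case (Suc s)
        let ?y = "x(j := s)"
        have y: "\<forall>k. k \<notin> insert j W \<longrightarrow> ?y k = 0" using x by auto
        have upd: "x(j := Suc s) = ?y(j := Suc (?y j))" by simp
        have e: "newt W ps (?y(j := Suc (?y j))) = newt W ps ?y"
          by (rule newt_cong) (use insert.hyps in auto)
        have "f (x(j := Suc s)) = f ?y + newt V qs ?y" unfolding upd by (rule qs)
        moreover have "newt (insert j W) (P @ Q) (x(j := Suc s)) =
            newt W ps ?y + (newt (insert j W) Q ?y + newt V qs ?y)"
          unfolding upd newt_append nP nQ[OF y] e ..
        moreover have "f ?y = newt W ps ?y + newt (insert j W) Q ?y"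
          using Suc unfolding newt_append nP .
        ultimately show ?case by linarith
      qed
      from this[of "x j"] show ?thesis unfolding fun_upd_triv .
    qed
    then show ?case by blast
  qed
  from this[OF fin order_refl] obtain ps where ps: "\<And>x. (\<forall>j. j \<notin> V \<longrightarrow> x j = 0) \<Longrightarrow> f x = newt V ps x" by blast
  have "f x = newt V ps x" for x
  proof -
    define y where "y = (\<lambda>j. if j \<in> V then x j else 0)"
    have "f x = f y" by (rule dep) (simp add: y_def)
    also have "\<dots> = newt V ps y" by (rule ps) (simp add: y_def)
    also have "\<dots> = newt V ps x" by (rule newt_cong) (simp add: y_def)
    finally show ?thesis .
  qed
  then show ?thesis by blast
qed


section \<open>Mixed multiplicities of up-sets\<close>

lemma colen_add:
  assumes "exps J \<subseteq> exps K" "cofin J"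
  shows "colen J = colen K + card (exps K - exps J)"
proof -
  have "- exps J = - exps K \<union> (exps K - exps J)" using assms(1) by auto
  moreover have "finite (- exps J)" using assms(2) by (simp add: cofin_def)
  ultimately show ?thesis
    unfolding colen_def by (metis card_Un_disjoint finite_Un Diff_disjoint Compl_disjoint2 Diff_eq Int_assoc Int_empty_left inf_commute)
qed

lemma finite_diff_cofin: "cofin J \<Longrightarrow> finite (exps K - exps J)"
  unfolding cofin_def by (rule finite_subset[rotated]) auto

lemma card_box_deg: "card {k :: 'n::finite \<Rightarrow> nat. deg k < x} \<le> x ^ CARD('n)"
proof -
  have "{k :: 'n \<Rightarrow> nat. deg k < x} \<subseteq> Pi\<^sub>E UNIV (\<lambda>_. {..<x})"
    using le_deg by (fastforce intro: le_less_trans)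
  then have "card {k :: 'n \<Rightarrow> nat. deg k < x} \<le> card (Pi\<^sub>E (UNIV :: 'n set) (\<lambda>_. {..<x}))"
    by (intro card_mono finite_PiE) auto
  then show ?thesis by (simp add: card_PiE)
qed

text \<open>A single exponent M serves for B and all the \<open>A j\<close>, so the product contains
  the power of the maximal ideal with exponent M times one plus the sum of r. The complement of that
  power lies in a cube.\<close>

lemma colen_bound:
  fixes A :: "nat \<Rightarrow> 'n::finite upset"
  assumes "finite V" "\<And>j. j \<in> V \<Longrightarrow> cofin (A j)" "cofin B"
  shows "\<exists>C. \<forall>r. colen (B * (\<Prod>j\<in>V. A j ^ r j)) \<le> C * Suc (\<Sum>j\<in>V. r j) ^ CARD('n)"
proof -
  have "\<forall>j. \<exists>D. j \<in> V \<longrightarrow> exps (max_upset ^ D) \<subseteq> exps (A j)" using assms(2) cofin_iff by blast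
  from choice[OF this] obtain D where D: "\<And>j. j \<in> V \<Longrightarrow> exps (max_upset ^ D j) \<subseteq> exps (A j)" by blast
  obtain D0 where D0: "exps (max_upset ^ D0) \<subseteq> exps B" using assms(3) cofin_iff by blast
  define M where "M = D0 + (\<Sum>j\<in>V. D j)"
  have "colen (B * (\<Prod>j\<in>V. A j ^ r j)) \<le> M ^ CARD('n) * Suc (\<Sum>j\<in>V. r j) ^ CARD('n)" for r
  proof -
    have 1: "exps (max_upset ^ (M * (\<Sum>j\<in>W. r j))) \<subseteq> exps (\<Prod>j\<in>W. A j ^ r j)" if "W \<subseteq> V" "finite W" for W
      using that(2,1)
    proof (induction W rule: finite_induct)
      case (insert j W)
      have "D j \<le> (\<Sum>j\<in>V. D j)" using insert.prems assms(1) by (intro member_le_sum) auto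
      then have "D j \<le> M" by (simp add: M_def)
      then have "exps (max_upset ^ M) \<subseteq> exps (A j)"
        using exps_power_antimono[of "D j" M max_upset] D[of j] insert.prems by blast
      then have "exps ((max_upset ^ M) ^ r j) \<subseteq> exps (A j ^ r j)" by (rule exps_power_mono)
      moreover have "exps (max_upset ^ (M * (\<Sum>j\<in>W. r j))) \<subseteq> exps (\<Prod>j\<in>W. A j ^ r j)"
        using insert by blast
      ultimately have "exps ((max_upset ^ M) ^ r j * max_upset ^ (M * (\<Sum>j\<in>W. r j))) \<subseteq>
          exps (A j ^ r j * (\<Prod>j\<in>W. A j ^ r j))" by (rule exps_times_mono)
      then show ?case
        using insert.hyps by (simp add: distrib_left power_add power_mult)
    qed simp
    have "exps (max_upset ^ M) \<subseteq> exps B"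
      unfolding M_def using exps_power_antimono[of D0 "D0 + (\<Sum>j\<in>V. D j)" max_upset] D0
      by (meson le_add1 subset_trans)
    then have "exps (max_upset ^ M * max_upset ^ (M * (\<Sum>j\<in>V. r j))) \<subseteq> exps (B * (\<Prod>j\<in>V. A j ^ r j))"
      using 1[of V] assms(1) by (intro exps_times_mono) auto
    then have "exps (max_upset ^ (M * Suc (\<Sum>j\<in>V. r j))) \<subseteq> exps (B * (\<Prod>j\<in>V. A j ^ r j))"
      by (simp add: power_add)
    then have "- exps (B * (\<Prod>j\<in>V. A j ^ r j)) \<subseteq> {k. deg k < M * Suc (\<Sum>j\<in>V. r j)}"
      by (auto simp: exps_max_upset_power not_less)
    moreover have "finite {k :: 'n \<Rightarrow> nat. deg k < M * Suc (\<Sum>j\<in>V. r j)}"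
      by (rule finite_subset[OF _ finite_deg_le[of "M * Suc (\<Sum>j\<in>V. r j)"]]) auto
    ultimately have "colen (B * (\<Prod>j\<in>V. A j ^ r j)) \<le> card {k :: 'n \<Rightarrow> nat. deg k < M * Suc (\<Sum>j\<in>V. r j)}"
      unfolding colen_def by (intro card_mono) auto
    also have "\<dots> \<le> (M * Suc (\<Sum>j\<in>V. r j)) ^ CARD('n)" by (rule card_box_deg)
    finally show ?thesis by (simp only: power_mult_distrib)
  qed
  then show ?thesis by blast
qed

text \<open>Raising one exponent multiplies the product by one ideal, and the resulting growth of
  the colength is a count covered by \<open>card_difference_newt\<close>. Summation recovers the
  colength, and the growth bound limits the degree because no term can cancel.\<close>

lemma colen_newt:
  fixes A :: "nat \<Rightarrow> 'n::finite upset"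
  assumes fin: "finite V" and A: "\<And>j. j \<in> V \<Longrightarrow> cofin (A j)" and B: "cofin B"
  shows "\<exists>N0. \<forall>N\<ge>N0. \<exists>ps. (\<forall>p\<in>set ps. (\<Sum>j\<in>V. p j) \<le> CARD('n)) \<and>
    (\<forall>x. colen (B * (\<Prod>j\<in>V. A j ^ (N + x j))) = newt V ps x)"
proof -
  have "\<forall>j. \<exists>N0. j \<in> V \<longrightarrow> (\<forall>N\<ge>N0. \<exists>ps. \<forall>x. card (exps (B * (\<Prod>j\<in>V. A j ^ (N + x j))) -
      exps (A j * B * (\<Prod>j\<in>V. A j ^ (N + x j)))) = newt V ps x)"
  proof
    fix j
    show "\<exists>N0. j \<in> V \<longrightarrow> (\<forall>N\<ge>N0. \<exists>ps. \<forall>x. card (exps (B * (\<Prod>j\<in>V. A j ^ (N + x j))) -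
      exps (A j * B * (\<Prod>j\<in>V. A j ^ (N + x j)))) = newt V ps x)"
    proof (cases "j \<in> V")
      case True
      have "finite (exps B - exps (A j * B))" using A[OF True] B by (intro finite_diff_cofin) auto
      from card_difference_newt[OF fin this, of A] show ?thesis by blast
    qed simp
  qed
  from choice[OF this] obtain M where M: "\<And>j N. j \<in> V \<Longrightarrow> N \<ge> M j \<Longrightarrow>
    \<exists>ps. \<forall>x. card (exps (B * (\<Prod>j\<in>V. A j ^ (N + x j))) -
      exps (A j * B * (\<Prod>j\<in>V. A j ^ (N + x j)))) = newt V ps x" by blast
  define N0 where "N0 = (\<Sum>j\<in>V. M j)"
  have "\<exists>ps. (\<forall>p\<in>set ps. (\<Sum>j\<in>V. p j) \<le> CARD('n)) \<and>
    (\<forall>x. colen (B * (\<Prod>j\<in>V. A j ^ (N + x j))) = newt V ps x)" if N: "N \<ge> N0" for N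
  proof -
    define Z where "Z x = (\<Prod>j\<in>V. A j ^ (N + x j))" for x
    have cZ: "cofin (Z x)" for x unfolding Z_def using A by auto
    have "\<exists>ps. \<forall>x. colen (B * Z x) = newt V ps x"
    proof (rule newt_from_diffs[OF fin])
      fix j assume j: "j \<in> V"
      have "M j \<le> N0" unfolding N0_def using j fin by (intro member_le_sum) auto
      then have "M j \<le> N" using N by simp
      from M[OF j this] obtain ps where ps: "\<And>x. card (exps (B * Z x) - exps (A j * B * Z x)) = newt V ps x"
        unfolding Z_def by blast
      have "colen (B * Z (x(j := Suc (x j)))) = colen (B * Z x) + newt V ps x" for x
      proof -
        have upd: "(\<lambda>i. N + (x(j := Suc (x j))) i) = (\<lambda>i. N + x i)(j := Suc (N + x j))"
          by (auto simp: fun_eq_iff)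
        have "Z (x(j := Suc (x j))) = A j * Z x"
          using prod_power_upd[OF fin j, of A "\<lambda>i. N + x i"] unfolding Z_def
          by (metis (no_types, lifting) prod.cong upd)
        then have "colen (B * Z (x(j := Suc (x j)))) = colen (A j * B * Z x)"
          by (simp only: ac_simps)
        also have "\<dots> = colen (B * Z x) + card (exps (B * Z x) - exps (A j * B * Z x))"
        proof (rule colen_add)
          show "exps (A j * B * Z x) \<subseteq> exps (B * Z x)"
            unfolding mult.assoc by (rule exps_times_subset2)
        qed (use A[OF j] B cZ in auto)
        finally show ?thesis by (simp only: ps)
      qed
      then show "\<exists>ps. \<forall>x. colen (B * Z (x(j := Suc (x j)))) = colen (B * Z x) + newt V ps x" by blast
    next
      fix x y :: "nat \<Rightarrow> nat" assume "\<And>j. j \<in> V \<Longrightarrow> x j = y j"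
      then have "Z x = Z y" unfolding Z_def by (intro prod.cong) auto
      then show "colen (B * Z x) = colen (B * Z y)" by simp
    qed
    then obtain ps where ps: "\<And>x. colen (B * Z x) = newt V ps x" by blast
    obtain C where C: "\<And>r. colen (B * (\<Prod>j\<in>V. A j ^ r j)) \<le> C * Suc (\<Sum>j\<in>V. r j) ^ CARD('n)"
      using colen_bound[of V A B] fin A B by blast
    have "newt V ps (\<lambda>_. t) \<le> (C * Suc (card V * (N + 1)) ^ CARD('n)) * Suc t ^ CARD('n)" for t
    proof -
      have "newt V ps (\<lambda>_. t) \<le> C * Suc (card V * (N + t)) ^ CARD('n)"
        using C[of "\<lambda>_. N + t"] unfolding ps[symmetric] Z_def by simp
      also have "\<dots> \<le> C * (Suc (card V * (N + 1)) * Suc t) ^ CARD('n)"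
        by (intro mult_left_mono power_mono) (auto simp: algebra_simps)
      finally show ?thesis by (simp only: power_mult_distrib mult.assoc)
    qed
    then have "(\<Sum>j\<in>V. p j) \<le> CARD('n)" if "p \<in> set ps" for p
      using newt_degree_le[OF fin _ that] by blast
    then show ?thesis using ps unfolding Z_def by blast
  qed
  then show ?thesis by blast
qed

text \<open>The difference operator \<open>\<Delta>\<^sub>1 \<dots> \<Delta>\<^sub>n\<close> maps a polynomial of degree at most \<open>n\<close> to the coefficient of
  \<open>x\<^sub>1 \<dots> x\<^sub>n\<close>.\<close>

definition mixed_count :: "(nat \<Rightarrow> 'n::finite upset) \<Rightarrow> int" where
  "mixed_count A = (THE c. \<exists>N. \<forall>r. (\<forall>j. N \<le> r j) \<longrightarrow>
     iter_diff [1..<Suc CARD('n)] (\<lambda>r. int (colen (\<Prod>j\<in>{1..CARD('n)}. A j ^ r j))) r = c)"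

lemma mixed_countI:
  fixes A :: "nat \<Rightarrow> 'n::finite upset"
  assumes "\<And>r. (\<And>j. N \<le> r j) \<Longrightarrow>
     iter_diff [1..<Suc CARD('n)] (\<lambda>r. int (colen (\<Prod>j\<in>{1..CARD('n)}. A j ^ r j))) r = c"
  shows "mixed_count A = c"
  unfolding mixed_count_def
proof (rule the_equality)
  show "\<exists>N. \<forall>r. (\<forall>j. N \<le> r j) \<longrightarrow>
     iter_diff [1..<Suc CARD('n)] (\<lambda>r. int (colen (\<Prod>j\<in>{1..CARD('n)}. A j ^ r j))) r = c"
    using assms by blast
next
  fix c' assume "\<exists>N. \<forall>r. (\<forall>j. N \<le> r j) \<longrightarrow>
     iter_diff [1..<Suc CARD('n)] (\<lambda>r. int (colen (\<Prod>j\<in>{1..CARD('n)}. A j ^ r j))) r = c'"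
  then obtain N' where N': "\<And>r. (\<And>j. N' \<le> r j) \<Longrightarrow>
     iter_diff [1..<Suc CARD('n)] (\<lambda>r. int (colen (\<Prod>j\<in>{1..CARD('n)}. A j ^ r j))) r = c'" by blast
  show "c' = c" using N'[of "\<lambda>_. max N N'"] assms[of "\<lambda>_. max N N'"] by simp
qed

lemma count_list_upt: "count_list [1..<Suc n] j = (if j \<in> {1..n} then 1 else 0)"
  by (induction n) auto

text \<open>Newton forms are available only when all exponents start at some N, which amounts to a
  fixed factor B; this removes it. With and without B the colengths differ, for large r, by a Newton
  polynomial of degree below n, and n differences annihilate it.\<close>

lemma iter_diff_multiplier:
  fixes A :: "nat \<Rightarrow> 'n::finite upset"
  assumes A: "\<And>j. j \<in> {1..CARD('n)} \<Longrightarrow> cofin (A j)" and B: "cofin B"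
    and j0: "j0 \<in> {1..CARD('n)}" "A j0 \<noteq> 1"
  shows "\<exists>N. \<forall>r. (\<forall>j. N \<le> r j) \<longrightarrow>
     iter_diff [1..<Suc CARD('n)] (\<lambda>r. int (colen (\<Prod>j\<in>{1..CARD('n)}. A j ^ r j))) r =
     iter_diff [1..<Suc CARD('n)] (\<lambda>r. int (colen (B * (\<Prod>j\<in>{1..CARD('n)}. A j ^ r j)))) r"
proof -
  let ?n = "CARD('n)"
  let ?V = "{1..?n}"
  define Z where "Z r = (\<Prod>j\<in>?V. A j ^ r j)" for r
  have cZ: "cofin (Z r)" for r unfolding Z_def using A by auto
  obtain N0 where N0: "\<And>N. N \<ge> N0 \<Longrightarrow> \<exists>ps. (\<forall>p\<in>set ps. (\<Sum>j\<in>?V. p j) \<le> ?n) \<and>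
      (\<forall>x. colen (1 * (\<Prod>j\<in>?V. A j ^ (N + x j))) = newt ?V ps x)"
    using colen_newt[of ?V A 1] A by auto
  obtain N1 where N1: "\<And>N. N \<ge> N1 \<Longrightarrow> \<exists>qs. \<forall>x. card (exps (1 * (\<Prod>j\<in>?V. A j ^ (N + x j))) -
      exps (B * (\<Prod>j\<in>?V. A j ^ (N + x j)))) = newt ?V qs x"
    using card_difference_newt[of ?V 1 B A] finite_diff_cofin[OF B, of 1] by auto
  define N where "N = max N0 N1"
  obtain ps where ps: "\<And>p. p \<in> set ps \<Longrightarrow> (\<Sum>j\<in>?V. p j) \<le> ?n"
    "\<And>x. colen (Z (\<lambda>j. N + x j)) = newt ?V ps x"
    using N0[of N] by (auto simp: N_def Z_def)
  obtain qs where qs: "\<And>x. card (exps (Z (\<lambda>j. N + x j)) - exps (B * Z (\<lambda>j. N + x j))) = newt ?V qs x"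
    using N1[of N] by (auto simp: N_def Z_def)
  \<comment> \<open>Since \<open>A j0\<close> is proper, its c-th power lies in B. So the count in
    question is at most the growth of the colength when the exponent at j0 is raised by c, which is
    of degree n - 1.\<close>
  obtain c where "exps (max_upset ^ c) \<subseteq> exps B" using B cofin_iff by blast
  moreover have "exps (A j0 ^ c) \<subseteq> exps (max_upset ^ c)"
    using j0(2) proper_iff by (intro exps_power_mono) auto
  ultimately have c: "exps (A j0 ^ c) \<subseteq> exps B" by blast
  have bound: "newt ?V qs (\<lambda>_. t) \<le> (length ps * (c * Suc c ^ (?n - 1))) * Suc t ^ (?n - 1)" for t
  proof -
    let ?Z = "Z (\<lambda>j. N + t)"
    have "newt ?V qs (\<lambda>_. t) = card (exps ?Z - exps (B * ?Z))" using qs[of "\<lambda>_. t"] by simp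
    also have "\<dots> \<le> card (exps ?Z - exps (A j0 ^ c * ?Z))"
    proof (rule card_mono)
      show "finite (exps ?Z - exps (A j0 ^ c * ?Z))"
        using A[OF j0(1)] cZ by (intro finite_diff_cofin) auto
      show "exps ?Z - exps (B * ?Z) \<subseteq> exps ?Z - exps (A j0 ^ c * ?Z)"
        using exps_times_mono[OF c order_refl] by blast
    qed
    finally have 1: "newt ?V qs (\<lambda>_. t) \<le> card (exps ?Z - exps (A j0 ^ c * ?Z))" .
    have "Z (\<lambda>j. N + ((\<lambda>_. t)(j0 := t + c)) j) = A j0 ^ c * ?Z"
    proof -
      have "(\<Prod>j\<in>?V - {j0}. A j ^ (N + ((\<lambda>_. t)(j0 := t + c)) j)) = (\<Prod>j\<in>?V - {j0}. A j ^ (N + t))"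
        by (rule prod.cong) auto
      then show ?thesis
        unfolding Z_def prod.remove[OF finite_atLeastAtMost j0(1)] by (simp add: power_add ac_simps)
    qed
    moreover have "colen (A j0 ^ c * ?Z) = colen ?Z + card (exps ?Z - exps (A j0 ^ c * ?Z))"
      using A[OF j0(1)] cZ by (intro colen_add exps_times_subset2) auto
    ultimately have "newt ?V ps ((\<lambda>_. t)(j0 := t + c)) = newt ?V ps (\<lambda>_. t) + card (exps ?Z - exps (A j0 ^ c * ?Z))"
      by (simp only: ps(2)[symmetric])
    moreover have "newt ?V ps ((\<lambda>_. t)(j0 := t + c)) \<le> newt ?V ps (\<lambda>_. t) + length ps * (c * Suc (t + c) ^ (?n - 1))"
      using ps(1) j0(1) by (intro newt_shift_upper) auto
    ultimately have "newt ?V qs (\<lambda>_. t) \<le> length ps * (c * Suc (t + c) ^ (?n - 1))" using 1 by linarith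
    also have "\<dots> \<le> length ps * (c * (Suc c * Suc t) ^ (?n - 1))"
      by (intro mult_left_mono power_mono) auto
    finally show ?thesis by (simp only: power_mult_distrib mult.assoc)
  qed
  have q: "(\<Sum>j\<in>?V. q j) \<le> ?n - 1" if "q \<in> set qs" for q
    using newt_degree_le[OF _ bound that] by simp
  have dl0: "iter_diff [1..<Suc ?n] (\<lambda>x. int (newt ?V qs x)) x = 0" for x
  proof -
    have "(\<Sum>j\<in>?V. q j) \<le> length [1..<Suc ?n]" if "q \<in> set qs" for q
      using q[OF that] by simp
    then have "iter_diff [1..<Suc ?n] (\<lambda>x. int (newt ?V qs x)) x =
        int (length (filter (\<lambda>q. \<forall>j\<in>?V. q j = count_list [1..<Suc ?n] j) qs))"
      by (intro iter_diff_newt_const) auto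
    moreover have "filter (\<lambda>q. \<forall>j\<in>?V. q j = count_list [1..<Suc ?n] j) qs = []"
    proof (rule ccontr)
      assume "\<not> ?thesis"
      then obtain q' where "q' \<in> set qs" "\<forall>j\<in>?V. q' j = count_list [1..<Suc ?n] j"
        by (auto simp: filter_empty_conv)
      then have "(\<Sum>j\<in>?V. q' j) = ?n" unfolding count_list_upt by simp
      then show False using q[OF \<open>q' \<in> set qs\<close>] zero_less_card_finite[where 'a = 'n] by linarith
    qed
    ultimately show ?thesis by simp
  qed
  have "iter_diff [1..<Suc ?n] (\<lambda>r. int (colen (Z r))) r = iter_diff [1..<Suc ?n] (\<lambda>r. int (colen (B * Z r))) r"
    if r: "\<forall>j. N \<le> r j" for r
  proof -
    define x where "x j = r j - N" for j
    have rx: "r = (\<lambda>j. N + x j)" using r by (auto simp: x_def)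
    have "iter_diff [1..<Suc ?n] (\<lambda>r. int (colen (B * Z r))) r - iter_diff [1..<Suc ?n] (\<lambda>r. int (colen (Z r))) r =
      iter_diff [1..<Suc ?n] (\<lambda>r. int (colen (B * Z r)) - int (colen (Z r))) r"
      by (simp add: iter_diff_diff)
    also have "\<dots> = iter_diff [1..<Suc ?n] (\<lambda>x. int (colen (B * Z (\<lambda>j. N + x j))) - int (colen (Z (\<lambda>j. N + x j)))) x"
      unfolding rx by (rule iter_diff_shift)
    also have "(\<lambda>x. int (colen (B * Z (\<lambda>j. N + x j))) - int (colen (Z (\<lambda>j. N + x j)))) = (\<lambda>x. int (newt ?V qs x))"
    proof
      fix x
      have "colen (B * Z (\<lambda>j. N + x j)) = colen (Z (\<lambda>j. N + x j)) + newt ?V qs x"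
        unfolding qs[symmetric] using B cZ by (intro colen_add exps_times_subset2) auto
      then show "int (colen (B * Z (\<lambda>j. N + x j))) - int (colen (Z (\<lambda>j. N + x j))) = int (newt ?V qs x)" by simp
    qed
    finally show ?thesis unfolding dl0 by linarith
  qed
  then show ?thesis unfolding Z_def by blast
qed

text \<open>Collecting equal ideals turns the n differences into as many differences in each block
  as the block has positions, and these read off one coefficient of ps. W may contain blocks that
  \<beta> does not use, so that one polynomial can serve several tuples.\<close>

lemma mixed_count_blocks:
  fixes A :: "nat \<Rightarrow> 'n::finite upset"
  assumes W: "finite W" "\<beta> ` {1..CARD('n)} \<subseteq> W" and A: "\<And>b. b \<in> W \<Longrightarrow> cofin (A b)" and B: "cofin B"
    and j0: "j0 \<in> {1..CARD('n)}" "A (\<beta> j0) \<noteq> 1"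
    and ps: "\<And>x. colen (B * (\<Prod>b\<in>W. A b ^ x b)) = newt W ps x"
      "\<And>p. p \<in> set ps \<Longrightarrow> (\<Sum>b\<in>W. p b) \<le> CARD('n)"
  shows "mixed_count (\<lambda>j. A (\<beta> j)) =
    int (length (filter (\<lambda>p. \<forall>b\<in>W. p b = count_list (map \<beta> [1..<Suc CARD('n)]) b) ps))"
proof -
  let ?n = "CARD('n)"
  let ?V = "{1..?n}"
  have "\<exists>N. \<forall>r. (\<forall>j. N \<le> r j) \<longrightarrow>
     iter_diff [1..<Suc ?n] (\<lambda>r. int (colen (\<Prod>j\<in>?V. A (\<beta> j) ^ r j))) r =
     iter_diff [1..<Suc ?n] (\<lambda>r. int (colen (B * (\<Prod>j\<in>?V. A (\<beta> j) ^ r j)))) r"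
  proof (rule iter_diff_multiplier)
    show "cofin (A (\<beta> j))" if "j \<in> ?V" for j using that W(2) by (intro A) blast
  qed (use B j0 in auto)
  then obtain N where N: "\<And>r. (\<And>j. N \<le> r j) \<Longrightarrow>
     iter_diff [1..<Suc ?n] (\<lambda>r. int (colen (\<Prod>j\<in>?V. A (\<beta> j) ^ r j))) r =
     iter_diff [1..<Suc ?n] (\<lambda>r. int (colen (B * (\<Prod>j\<in>?V. A (\<beta> j) ^ r j)))) r" by blast
  have eq: "(\<lambda>r. int (colen (B * (\<Prod>j\<in>?V. A (\<beta> j) ^ r j)))) = (\<lambda>r. int (newt W ps (blocksum ?V \<beta> r)))"
    using prod_blocksum[of ?V W \<beta> A] W by (simp add: ps(1)[symmetric])
  show ?thesis
  proof (rule mixed_countI)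
    fix r :: "nat \<Rightarrow> nat" assume "\<And>j. N \<le> r j"
    then have "iter_diff [1..<Suc ?n] (\<lambda>r. int (colen (\<Prod>j\<in>?V. A (\<beta> j) ^ r j))) r =
      iter_diff [1..<Suc ?n] (\<lambda>r. int (newt W ps (blocksum ?V \<beta> r))) r"
      using N[of r] unfolding eq by simp
    also have "\<dots> = iter_diff (map \<beta> [1..<Suc ?n]) (\<lambda>x. int (newt W ps x)) (blocksum ?V \<beta> r)"
      using iter_diff_blocksum[of ?V "[1..<Suc ?n]" "\<lambda>x. int (newt W ps x)" \<beta> r]
      by (simp add: atLeastLessThanSuc_atLeastAtMost del: upt_Suc)
    also have "\<dots> = int (length (filter (\<lambda>p. \<forall>b\<in>W. p b = count_list (map \<beta> [1..<Suc ?n]) b) ps))"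
      using W ps(2) by (intro iter_diff_newt_const) auto
    finally show "iter_diff [1..<Suc ?n] (\<lambda>r. int (colen (\<Prod>j\<in>?V. A (\<beta> j) ^ r j))) r =
      int (length (filter (\<lambda>p. \<forall>b\<in>W. p b = count_list (map \<beta> [1..<Suc ?n]) b) ps))" .
  qed
qed

section \<open>Monotonicity of mixed multiplicities\<close>

lemma count_list_map_indicator:
  "distinct xs \<Longrightarrow> count_list (map \<beta> xs) b = card {j \<in> set xs. \<beta> j = b}"
proof (induction xs)
  case (Cons x xs)
  have "{j \<in> set (x # xs). \<beta> j = b} = (if \<beta> x = b then insert x {j \<in> set xs. \<beta> j = b} else {j \<in> set xs. \<beta> j = b})"
    by auto
  then show ?case using Cons by simp
qed simp

text \<open>Products of powers of X, Y and T give one Newton polynomial for all tuples. Its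
  difference in the direction of X minus that in the direction of Y is the number of exponents in
  \<open>Y * Z x\<close> outside \<open>X * Z x\<close>, again a Newton sum with natural
  coefficients; so exchanging one entry Y for X cannot lower the coefficient. The entries are
  exchanged one by one.\<close>

lemma mixed_count_mono:
  fixes X Y T :: "'n::finite upset"
  assumes cof: "cofin X" "cofin Y" "cofin T" and proper: "X \<noteq> 1" "Y \<noteq> 1" "T \<noteq> 1"
    and XY: "exps X \<subseteq> exps Y" and S: "S \<subseteq> {1..CARD('n)}"
  shows "mixed_count (\<lambda>j. if j \<in> S then Y else T) \<le> mixed_count (\<lambda>j. if j \<in> S then X else T)"
proof -
  let ?n = "CARD('n)"
  define W :: "nat set" where "W = {0, 1, 2}"
  define A where "A b = (if b = 0 then X else if b = 1 then Y else T)" for b :: nat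
  have finW: "finite W" and cA: "cofin (A b)" and pA: "A b \<noteq> 1" for b
    using cof proper by (auto simp: W_def A_def)
  obtain N0 where N0: "\<And>N. N \<ge> N0 \<Longrightarrow> \<exists>ps. (\<forall>p\<in>set ps. (\<Sum>j\<in>W. p j) \<le> ?n) \<and>
      (\<forall>x. colen (1 * (\<Prod>j\<in>W. A j ^ (N + x j))) = newt W ps x)"
    using colen_newt[of W A 1] finW cA by auto
  obtain N1 where N1: "\<And>N. N \<ge> N1 \<Longrightarrow> \<exists>qs. \<forall>x. card (exps (Y * (\<Prod>j\<in>W. A j ^ (N + x j))) -
      exps (X * (\<Prod>j\<in>W. A j ^ (N + x j)))) = newt W qs x"
    using card_difference_newt[OF finW finite_diff_cofin[OF cof(1)], of Y A] by blast
  define N where "N = max N0 N1"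
  define Z where "Z x = (\<Prod>j\<in>W. A j ^ (N + x j))" for x
  have cZ: "cofin (Z x)" for x unfolding Z_def using cA by auto
  obtain ps where ps: "\<And>p. p \<in> set ps \<Longrightarrow> (\<Sum>j\<in>W. p j) \<le> ?n" "\<And>x. colen (Z x) = newt W ps x"
    using N0[of N] by (auto simp: N_def Z_def)
  obtain qs where qs: "\<And>x. card (exps (Y * Z x) - exps (X * Z x)) = newt W qs x"
    using N1[of N] by (auto simp: N_def Z_def)
  \<comment> \<open>For k + l + m = n this is the mixed multiplicity of k entries X, l entries Y and
    m entries T.\<close>
  define c where "c k l m = length (filter (\<lambda>p. p 0 = k \<and> p 1 = l \<and> p 2 = m) ps)" for k l m :: nat
  have Zupd: "Z (x(b := Suc (x b))) = A b * Z x" if "b \<in> W" for x b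
  proof -
    have "(\<lambda>i. N + (x(b := Suc (x b))) i) = (\<lambda>i. N + x i)(b := Suc (N + x b))"
      by (auto simp: fun_eq_iff)
    then show ?thesis
      using prod_power_upd[OF finW that, of A "\<lambda>i. N + x i"] unfolding Z_def
      by (metis (no_types, lifting) prod.cong)
  qed
  have step: "c k (Suc l) m \<le> c (Suc k) l m" for k l m
  proof -
    define js where "js = replicate k 0 @ replicate l 1 @ replicate m (2 :: nat)"
    have jsW: "set js \<subseteq> W" by (auto simp: js_def W_def)
    have "int (newt W qs x) = fdiff 0 (\<lambda>x. int (newt W ps x)) x - fdiff 1 (\<lambda>x. int (newt W ps x)) x" for x
    proof -
      have "colen (X * Z x) = colen (Y * Z x) + newt W qs x"
        unfolding qs[symmetric] using XY cof cZ by (intro colen_add exps_times_mono) auto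
      moreover have "X * Z x = Z (x(0 := Suc (x 0)))" "Y * Z x = Z (x(1 := Suc (x 1)))"
        using Zupd[of 0 x] Zupd[of 1 x] by (simp_all add: W_def A_def)
      ultimately have "newt W ps (x(0 := Suc (x 0))) = newt W ps (x(1 := Suc (x 1))) + newt W qs x"
        by (simp only: ps(2))
      then show ?thesis by (simp only: fdiff_def)
    qed
    then have "iter_diff js (\<lambda>x. int (newt W qs x)) (\<lambda>_. 0) =
        iter_diff (0 # js) (\<lambda>x. int (newt W ps x)) (\<lambda>_. 0) - iter_diff (1 # js) (\<lambda>x. int (newt W ps x)) (\<lambda>_. 0)"
      by (simp add: iter_diff_diff)
    moreover have "iter_diff js (\<lambda>x. int (newt W qs x)) (\<lambda>_. 0) \<ge> 0"
      by (rule iter_diff_newt_nonneg[OF finW jsW])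
    ultimately have "iter_diff (1 # js) (\<lambda>x. int (newt W ps x)) (\<lambda>_. 0) \<le> iter_diff (0 # js) (\<lambda>x. int (newt W ps x)) (\<lambda>_. 0)"
      by linarith
    moreover have cl: "count_list (replicate a b) d = (if b = d then a else 0)" for a b d :: nat
      by (induction a) auto
    have "iter_diff (0 # js) (\<lambda>x. int (newt W ps x)) (\<lambda>_. 0) = int (c (Suc k) l m)"
      using jsW by (subst iter_diff_newt_0[OF finW]) (auto simp: W_def c_def js_def cl)
    moreover have "iter_diff (1 # js) (\<lambda>x. int (newt W ps x)) (\<lambda>_. 0) = int (c k (Suc l) m)"
      using jsW by (subst iter_diff_newt_0[OF finW]) (auto simp: W_def c_def js_def cl)
    ultimately show ?thesis by linarith
  qed
  have chain: "c k (l + b) m \<le> c (k + b) l m" for k l m b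
  proof (induction b arbitrary: k)
    case (Suc b)
    have "c k (l + Suc b) m \<le> c (Suc k) (l + b) m" using step[of k "l + b" m] by simp
    also have "\<dots> \<le> c (Suc k + b) l m" by (rule Suc)
    finally show ?case by simp
  qed simp
  define a where "a = card S"
  have cS: "card {j \<in> {1..?n}. j \<in> S} = a" "card {j \<in> {1..?n}. j \<notin> S} = ?n - a"
  proof -
    have "{j \<in> {1..?n}. j \<in> S} = S" using S by auto
    then show "card {j \<in> {1..?n}. j \<in> S} = a" by (simp add: a_def)
    have "{j \<in> {1..?n}. j \<notin> S} = {1..?n} - S" by auto
    then show "card {j \<in> {1..?n}. j \<notin> S} = ?n - a"
      using S by (simp add: a_def card_Diff_subset finite_subset[OF S])
  qed
  \<comment> \<open>The shift by N in the exponents reappears as the fixed factor B of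
    \<open>mixed_count_blocks\<close>.\<close>
  have B: "colen ((\<Prod>b\<in>W. A b ^ N) * (\<Prod>b\<in>W. A b ^ x b)) = newt W ps x" for x
    unfolding ps(2)[symmetric] Z_def by (simp add: power_add prod.distrib)
  have n1: "1 \<in> {1..?n}" using zero_less_card_finite[where 'a = 'n] by auto
  have key: "mixed_count (\<lambda>j. A (if j \<in> S then b0 else 2)) =
      int (length (filter (\<lambda>p. \<forall>b\<in>W. p b = count_list (map (\<lambda>j. if j \<in> S then b0 else 2) [1..<Suc ?n]) b) ps))"
    if "b0 \<in> {0, 1}" for b0
    by (rule mixed_count_blocks[OF finW _ cA _ n1 pA B ps(1)]) (use that cA in \<open>auto simp: W_def\<close>)
  have cl: "count_list (map (\<lambda>j. if j \<in> S then b0 else 2) [1..<Suc ?n]) b =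
      (if b = b0 then a else if b = 2 then ?n - a else 0)" if "b0 \<in> {0, 1}" for b0 b :: nat
  proof -
    have "count_list (map (\<lambda>j. if j \<in> S then b0 else 2) [1..<Suc ?n]) b =
      card {j \<in> {1..?n}. (if j \<in> S then b0 else 2) = b}"
    proof -
      have "set [1..<Suc ?n] = {1..?n}" by (simp add: atLeastLessThanSuc_atLeastAtMost del: upt_Suc)
      then show ?thesis by (simp only: count_list_map_indicator distinct_upt)
    qed
    also have "{j \<in> {1..?n}. (if j \<in> S then b0 else 2) = b} =
       (if b = b0 then {j \<in> {1..?n}. j \<in> S} else if b = 2 then {j \<in> {1..?n}. j \<notin> S} else {})"
      using that by auto
    finally show ?thesis using cS by simp
  qed
  have AX: "(\<lambda>j. A (if j \<in> S then 0 else 2)) = (\<lambda>j. if j \<in> S then X else T)"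
    and AY: "(\<lambda>j. A (if j \<in> S then 1 else 2)) = (\<lambda>j. if j \<in> S then Y else T)"
    by (auto simp: A_def)
  have "mixed_count (\<lambda>j. if j \<in> S then X else T) = int (c a 0 (?n - a))"
    unfolding key[OF insertI1, unfolded AX] cl[OF insertI1] by (simp add: W_def c_def)
  moreover have "mixed_count (\<lambda>j. if j \<in> S then Y else T) = int (c 0 a (?n - a))"
    unfolding key[OF insertI2[OF singletonI], unfolded AY] cl[OF insertI2[OF singletonI]]
    by (simp add: W_def c_def)
  ultimately show ?thesis using chain[of 0 0 a "?n - a"] by simp
qed


section \<open>Comparison of mixed multiplicities\<close>

lemma tendsto_binomial_div_power: "(\<lambda>y. real (y choose b) / real y ^ b) \<longlonglongrightarrow> 1 / fact b"
proof (induction b)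
  case (Suc b)
  have eq: "real (y choose Suc b) / real y ^ Suc b =
      (real (y choose b) / real y ^ b) * ((1 - real b / real y) / real (Suc b))" if "y > b" for y
  proof -
    have "real (Suc b) * real (y choose Suc b) = (real y - real b) * real (y choose b)"
      using binomial_absorb_comp[of y b] that
      by (metis binomial_absorption mult.commute of_nat_diff of_nat_mult less_imp_le choose_mult_lemma Suc_times_binomial_add binomial_fact_lemma)
    then have "real (y choose Suc b) = (real y - real b) * real (y choose b) / real (Suc b)"
      by (metis nonzero_mult_div_cancel_left of_nat_eq_0_iff nat.distinct(1))
    moreover have "1 - real b / real y = (real y - real b) / real y"
      using that by (simp add: diff_divide_distrib)
    ultimately show ?thesis by (simp only: power_Suc times_divide_times_eq divide_divide_eq_left divide_divide_eq_right) (simp add: ac_simps)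
  qed
  have "(\<lambda>y. (real (y choose b) / real y ^ b) * ((1 - real b / real y) / real (Suc b)))
      \<longlonglongrightarrow> 1 / fact b * ((1 - 0) / real (Suc b))"
    by (intro tendsto_intros Suc tendsto_divide_0[OF tendsto_const] filterlim_at_top_imp_at_infinity filterlim_real_sequentially) auto
  then have "(\<lambda>y. (real (y choose b) / real y ^ b) * ((1 - real b / real y) / real (Suc b)))
      \<longlonglongrightarrow> 1 / fact (Suc b)" by (simp add: field_simps)
  moreover have "\<forall>\<^sub>F y in sequentially. (real (y choose b) / real y ^ b) * ((1 - real b / real y) / real (Suc b)) =
     real (y choose Suc b) / real y ^ Suc b"
    using eventually_gt_at_top[of b] by eventually_elim (rule eq[symmetric])
  ultimately show ?case by (rule Lim_transform_eventually)
qed simp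

lemma tendsto_binomial_div_power_less:
  assumes "b < m"
  shows "(\<lambda>y. real (y choose b) / real y ^ m) \<longlonglongrightarrow> 0"
proof -
  have "(\<lambda>y. real (y choose b) / real y ^ b * (1 / real y) ^ (m - b)) \<longlonglongrightarrow> 1 / fact b * 0 ^ (m - b)"
    by (intro tendsto_intros tendsto_binomial_div_power lim_1_over_n)
  moreover have "real (y choose b) / real y ^ b * (1 / real y) ^ (m - b) = real (y choose b) / real y ^ m" for y
    using assms by (simp add: power_one_over field_simps flip: power_add)
  ultimately show ?thesis using assms by (simp add: zero_power)
qed

lemma tendsto_binomial_sum:
  "(\<lambda>y. (\<Sum>b\<le>m. C b * real (y choose b)) / real y ^ m) \<longlonglongrightarrow> C m / fact m"
proof -
  have "(\<lambda>y. \<Sum>b\<le>m. C b * (real (y choose b) / real y ^ m)) \<longlonglongrightarrow> (\<Sum>b\<le>m. C b * (if b = m then 1 / fact m else 0))"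
    by (intro tendsto_sum tendsto_mult tendsto_const)
       (auto simp: tendsto_binomial_div_power tendsto_binomial_div_power_less)
  moreover have "(\<Sum>b\<le>m. C b * (if b = m then 1 / fact m else 0)) = (\<Sum>b\<le>m. if b = m then C b / fact m else 0)"
    by (rule sum.cong) auto
  ultimately show ?thesis by (simp add: sum_divide_distrib)
qed

text \<open>If d were the largest index from q on with a nonzero coefficient, the sum would grow
  like C d y^d / d!, against the assumed limit.\<close>

lemma binomial_sum_coeff_zero:
  assumes lim: "(\<lambda>y. (\<Sum>b\<le>m. C b * real (y choose b)) / real y ^ q) \<longlonglongrightarrow> 0"
    and b: "q \<le> b" "b \<le> m"
  shows "C b = 0"
proof (rule ccontr)
  assume "C b \<noteq> 0"
  define S where "S = {b. q \<le> b \<and> b \<le> m \<and> C b \<noteq> 0}"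
  have S: "finite S" "S \<noteq> {}" using b \<open>C b \<noteq> 0\<close> by (auto simp: S_def)
  define d where "d = Max S"
  have d: "d \<in> S" "\<And>e. e \<in> S \<Longrightarrow> e \<le> d" using S by (auto simp: d_def)
  have d': "q \<le> d" "d \<le> m" "C d \<noteq> 0" using d(1) by (auto simp: S_def)
  have eq: "(\<Sum>b\<le>m. C b * real (y choose b)) = (\<Sum>b\<le>d. C b * real (y choose b))" for y
  proof (rule sum.mono_neutral_right)
    show "\<forall>i\<in>{..m} - {..d}. C i * real (y choose i) = 0"
      using d(2) d'(1) by (fastforce simp: S_def)
  qed (use d' in auto)
  have "(\<lambda>y. (\<Sum>b\<le>m. C b * real (y choose b)) / real y ^ q * (1 / real y) ^ (d - q)) \<longlonglongrightarrow> 0"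
  proof (cases "d = q")
    case True
    then show ?thesis using lim by simp
  next
    case False
    then have "(\<lambda>y. (1 / real y) ^ (d - q)) \<longlonglongrightarrow> 0"
      using tendsto_power[OF lim_1_over_n[where 'a = real], of "d - q"] d'(1) by (simp add: zero_power)
    from tendsto_mult[OF lim this] show ?thesis by simp
  qed
  moreover have "(\<Sum>b\<le>m. C b * real (y choose b)) / real y ^ q * (1 / real y) ^ (d - q) =
      (\<Sum>b\<le>d. C b * real (y choose b)) / real y ^ d" for y
    unfolding eq using d'(1) by (simp add: power_one_over field_simps flip: power_add)
  ultimately have "(\<lambda>y. (\<Sum>b\<le>d. C b * real (y choose b)) / real y ^ d) \<longlonglongrightarrow> 0" by simp
  from LIMSEQ_unique[OF this tendsto_binomial_sum] d'(3) show False by simp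
qed

text \<open>Index 0 stands for the ideal that is enlarged and index 1 for the ideal that stays
  fixed. The values are real because they enter limits.\<close>

definition pcount :: "(nat \<Rightarrow> nat) list \<Rightarrow> nat \<Rightarrow> nat \<Rightarrow> real" where
  "pcount ps a b = real (length (filter (\<lambda>p. p 0 = a \<and> p 1 = b) ps))"

lemma newt_two_blocks:
  assumes "\<forall>p\<in>set ps. p 0 + p 1 \<le> n"
  shows "real (newt {0, 1} ps (\<lambda>j. if j = 0 then x else y)) =
    (\<Sum>b\<le>n. (\<Sum>a\<le>n. pcount ps a b * real (x choose a)) * real (y choose b))"
  using assms
proof (induction ps)
  case Nil
  show ?case by (simp add: pcount_def)
next
  case (Cons p ps)
  have p: "p 0 \<le> n" "p 1 \<le> n" using Cons.prems by auto
  have e: "pcount (p # ps) a b = pcount ps a b + (if a = p 0 then if b = p 1 then 1 else 0 else 0)" for a b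
    by (auto simp: pcount_def)
  have "(\<Sum>a\<le>n. (if a = p 0 then if b = p 1 then 1 else 0 else 0) * real (x choose a)) =
      (if b = p 1 then real (x choose p 0) else 0)" for b
  proof -
    have "(\<Sum>a\<le>n. (if a = p 0 then if b = p 1 then 1 else 0 else 0) * real (x choose a)) =
       (\<Sum>a\<le>n. if a = p 0 then (if b = p 1 then real (x choose p 0) else 0) else 0)"
      by (rule sum.cong) auto
    then show ?thesis using p by simp
  qed
  moreover have "(\<Sum>b\<le>n. (if b = p 1 then real (x choose p 0) else 0) * real (y choose b)) =
      real (x choose p 0) * real (y choose p 1)"
  proof -
    have "(\<Sum>b\<le>n. (if b = p 1 then real (x choose p 0) else 0) * real (y choose b)) =
       (\<Sum>b\<le>n. if b = p 1 then real (x choose p 0) * real (y choose p 1) else 0)"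
      by (rule sum.cong) auto
    then show ?thesis using p by simp
  qed
  ultimately have "(\<Sum>b\<le>n. (\<Sum>a\<le>n. pcount (p # ps) a b * real (x choose a)) * real (y choose b)) =
     (\<Sum>b\<le>n. (\<Sum>a\<le>n. pcount ps a b * real (x choose a)) * real (y choose b)) +
       real (x choose p 0) * real (y choose p 1)"
    by (simp add: e distrib_right sum.distrib)
  moreover have "(\<Prod>j\<in>{0, 1}. (if j = 0 then x else y) choose p j) = (x choose p 0) * (y choose p 1)"
    by simp
  moreover have "real (newt {0, 1} ps (\<lambda>j. if j = 0 then x else y)) =
    (\<Sum>b\<le>n. (\<Sum>a\<le>n. pcount ps a b * real (x choose a)) * real (y choose b))"
    using Cons by simp
  ultimately show ?case by (simp only: newt_Cons of_nat_add of_nat_mult)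
qed

text \<open>Letting y grow for fixed x isolates the coefficient \<open>C x q\<close> of
  \<open>y choose q\<close>. In the first case it is 0 for every x, so all its coefficients vanish.
  In the second it is at least a positive multiple of x^(n - q); as total degree n allows no higher
  power of x beside y^q, its leading coefficient is positive.\<close>

lemma pcount_comparison:
  assumes ps: "\<forall>p\<in>set ps. p 0 + p 1 \<le> n" and ps': "\<forall>p\<in>set ps'. p 0 + p 1 \<le> n"
    and d: "\<And>x y. d x y = real (newt {0, 1} ps (\<lambda>j. if j = 0 then x else y)) -
       real (newt {0, 1} ps' (\<lambda>j. if j = 0 then x else y))"
    and q: "q \<le> n"
  shows "(\<And>x. (\<lambda>y. d x y / real y ^ q) \<longlonglongrightarrow> 0) \<Longrightarrow> pcount ps (n - q) q = pcount ps' (n - q) q"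
    and "(\<And>x. (\<lambda>y. d x y / real y ^ Suc q) \<longlonglongrightarrow> 0) \<Longrightarrow> \<kappa> > 0 \<Longrightarrow>
      (\<And>x. \<forall>\<^sub>F y in sequentially. \<kappa> * real x ^ (n - q) * real y ^ q \<le> d x y) \<Longrightarrow>
      pcount ps' (n - q) q < pcount ps (n - q) q"
proof -
  define c where "c a b = pcount ps a b - pcount ps' a b" for a b
  define C where "C x b = (\<Sum>a\<le>n. c a b * real (x choose a))" for x b
  have d': "d x y = (\<Sum>b\<le>n. C x b * real (y choose b))" for x y
    unfolding d newt_two_blocks[OF ps] newt_two_blocks[OF ps'] C_def c_def
    by (simp add: left_diff_distrib sum_subtractf)
  have C0: "c a b = 0" if "\<And>x. C x b = 0" "a \<le> n" for a b
  proof -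
    have "(\<lambda>x. (\<Sum>a\<le>n. c a b * real (x choose a)) / real x ^ 0) \<longlonglongrightarrow> 0"
      using that(1) by (simp add: C_def)
    from binomial_sum_coeff_zero[where b = a, OF this] that(2) show ?thesis by simp
  qed
  {
    assume "\<And>x. (\<lambda>y. d x y / real y ^ q) \<longlonglongrightarrow> 0"
    then have "C x q = 0" for x
      using binomial_sum_coeff_zero[where m = n and C = "C x" and q = q and b = q] q unfolding d' by simp
    then show "pcount ps (n - q) q = pcount ps' (n - q) q" using C0[of q "n - q"] by (simp add: c_def)
  next
    assume lim: "\<And>x. (\<lambda>y. d x y / real y ^ Suc q) \<longlonglongrightarrow> 0" and \<kappa>: "\<kappa> > 0"
      and low: "\<And>x. \<forall>\<^sub>F y in sequentially. \<kappa> * real x ^ (n - q) * real y ^ q \<le> d x y"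
    have Cb: "C x b = 0" if "Suc q \<le> b" "b \<le> n" for x b
      using binomial_sum_coeff_zero[where m = n and C = "C x" and q = "Suc q" and b = b] lim[of x] that unfolding d' by simp
    have Cq: "\<kappa> * fact q * real x ^ (n - q) \<le> C x q" for x
    proof -
      have "d x y = (\<Sum>b\<le>q. C x b * real (y choose b))" for y
        unfolding d' by (rule sum.mono_neutral_right) (use Cb q in auto)
      then have l: "(\<lambda>y. d x y / real y ^ q) \<longlonglongrightarrow> C x q / fact q"
        using tendsto_binomial_sum[where C = "C x" and m = q] by simp
      have "\<kappa> * real x ^ (n - q) \<le> C x q / fact q"
      proof (rule tendsto_lowerbound[OF l])
        show "\<forall>\<^sub>F y in sequentially. \<kappa> * real x ^ (n - q) \<le> d x y / real y ^ q"
          using low[of x] eventually_gt_at_top[of 0] by eventually_elim (simp add: field_simps)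
      qed simp
      then show ?thesis by (simp add: field_simps)
    qed
    have c0: "c a q = 0" if "a \<le> n" "a > n - q" for a
    proof -
      have "filter (\<lambda>p. p 0 = a \<and> p 1 = q) rs = []" if rs: "\<forall>p\<in>set rs. p 0 + p 1 \<le> n" for rs :: "(nat \<Rightarrow> nat) list"
        unfolding filter_empty_conv
      proof (intro ballI notI)
        fix p assume "p \<in> set rs" "p 0 = a \<and> p 1 = q"
        then show False using rs \<open>a > n - q\<close> q by fastforce
      qed
      from this[OF ps] this[OF ps'] show ?thesis by (simp add: c_def pcount_def)
    qed
    have "C x q = (\<Sum>a\<le>n - q. c a q * real (x choose a))" for x
      unfolding C_def by (rule sum.mono_neutral_right) (use c0 in auto)
    then have l: "(\<lambda>x. C x q / real x ^ (n - q)) \<longlonglongrightarrow> c (n - q) q / fact (n - q)"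
      using tendsto_binomial_sum[where C = "\<lambda>a. c a q" and m = "n - q"] by simp
    have "\<kappa> * fact q \<le> c (n - q) q / fact (n - q)"
    proof (rule tendsto_lowerbound[OF l])
      show "\<forall>\<^sub>F x in sequentially. \<kappa> * fact q \<le> C x q / real x ^ (n - q)"
        using eventually_gt_at_top[of 0] by eventually_elim (use Cq in \<open>simp add: field_simps\<close>)
    qed simp
    then have "c (n - q) q / fact (n - q) > 0" using \<kappa> by (meson fact_gt_zero less_le_trans mult_pos_pos)
    then have "c (n - q) q > 0" by (simp add: zero_less_divide_iff)
    then show "pcount ps' (n - q) q < pcount ps (n - q) q" by (simp add: c_def)
  }
qed

lemma tendsto_shift_power:
  fixes f :: "nat \<Rightarrow> real"
  assumes "(\<lambda>w. f w / real w ^ q) \<longlonglongrightarrow> 0"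
  shows "(\<lambda>y. f (N + y) / real y ^ q) \<longlonglongrightarrow> 0"
proof -
  have 1: "(\<lambda>y. f (N + y) / real (N + y) ^ q) \<longlonglongrightarrow> 0"
    using LIMSEQ_ignore_initial_segment[OF assms, of N] by (simp add: add.commute)
  have "(\<lambda>y. real N * (1 / real y) + 1) \<longlonglongrightarrow> real N * 0 + 1"
    by (intro tendsto_intros lim_1_over_n)
  then have "(\<lambda>y. (real N * (1 / real y) + 1) ^ q) \<longlonglongrightarrow> 1 ^ q"
    by (intro tendsto_power) simp
  from tendsto_mult[OF 1 this]
  have "(\<lambda>y. f (N + y) / real (N + y) ^ q * (real N * (1 / real y) + 1) ^ q) \<longlonglongrightarrow> 0" by simp
  moreover have "\<forall>\<^sub>F y in sequentially. f (N + y) / real (N + y) ^ q * (real N * (1 / real y) + 1) ^ q = f (N + y) / real y ^ q"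
    using eventually_gt_at_top[of 0]
  proof eventually_elim
    case (elim y)
    have "real N * (1 / real y) + 1 = real (N + y) / real y" using elim by (simp add: field_simps)
    then show ?case using elim by (simp add: power_divide)
  qed
  ultimately show ?thesis by (rule Lim_transform_eventually)
qed

text \<open>The count f is the difference of the two colengths, and the mixed multiplicities are the
  coefficients at degrees n - q and q in their Newton forms. So the growth of f in w and then in u
  decides the comparison.\<close>

lemma mixed_count_comparison:
  fixes J J' T :: "'n::finite upset"
  assumes cof: "cofin J" "cofin J'" "cofin T" and proper: "J \<noteq> 1" "J' \<noteq> 1" "T \<noteq> 1"
    and sub: "exps J \<subseteq> exps J'"
    and S: "S \<subseteq> {1..CARD('n)}" "card S + q = CARD('n)"
    and f: "\<And>u w. f u w = real (card (exps (J' ^ u * T ^ w) - exps (J ^ u * T ^ w)))"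
  shows "(\<And>u. (\<lambda>w. f u w / real w ^ q) \<longlonglongrightarrow> 0) \<Longrightarrow>
      mixed_count (\<lambda>j. if j \<in> S then J else T) = mixed_count (\<lambda>j. if j \<in> S then J' else T)"
    and "(\<And>u. (\<lambda>w. f u w / real w ^ Suc q) \<longlonglongrightarrow> 0) \<Longrightarrow> \<kappa> > 0 \<Longrightarrow>
      (\<And>u. \<forall>\<^sub>F w in sequentially. \<kappa> * real u ^ card S * real w ^ q \<le> f u w) \<Longrightarrow>
      mixed_count (\<lambda>j. if j \<in> S then J' else T) < mixed_count (\<lambda>j. if j \<in> S then J else T)"
proof -
  let ?n = "CARD('n)"
  define W :: "nat set" where "W = {0, 1}"
  have finW: "finite W" by (simp add: W_def)
  define A where "A K b = (if b = 0 then K else T)" for K :: "'n upset" and b :: nat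
  have cA: "cofin (A K b)" if "cofin K" for K b using that cof by (simp add: A_def)
  obtain N0 where N0: "\<And>N. N \<ge> N0 \<Longrightarrow> \<exists>ps. (\<forall>p\<in>set ps. (\<Sum>j\<in>W. p j) \<le> ?n) \<and>
      (\<forall>x. colen (1 * (\<Prod>j\<in>W. A J j ^ (N + x j))) = newt W ps x)"
    using colen_newt[of W "A J" 1] finW cA[OF cof(1)] by auto
  obtain N1 where N1: "\<And>N. N \<ge> N1 \<Longrightarrow> \<exists>ps. (\<forall>p\<in>set ps. (\<Sum>j\<in>W. p j) \<le> ?n) \<and>
      (\<forall>x. colen (1 * (\<Prod>j\<in>W. A J' j ^ (N + x j))) = newt W ps x)"
    using colen_newt[of W "A J'" 1] finW cA[OF cof(2)] by auto
  define N where "N = max N0 N1"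
  obtain ps where ps: "\<And>p. p \<in> set ps \<Longrightarrow> (\<Sum>j\<in>W. p j) \<le> ?n"
    "\<And>x. colen (\<Prod>j\<in>W. A J j ^ (N + x j)) = newt W ps x"
    using N0[of N] by (auto simp: N_def)
  obtain ps' where ps': "\<And>p. p \<in> set ps' \<Longrightarrow> (\<Sum>j\<in>W. p j) \<le> ?n"
    "\<And>x. colen (\<Prod>j\<in>W. A J' j ^ (N + x j)) = newt W ps' x"
    using N1[of N] by (auto simp: N_def)
  have n1: "1 \<in> {1..?n}" using zero_less_card_finite[where 'a = 'n] by auto
  have cS: "card {j \<in> {1..?n}. j \<in> S} = card S" "card {j \<in> {1..?n}. j \<notin> S} = q"
  proof -
    have "{j \<in> {1..?n}. j \<in> S} = S" using S by auto
    then show "card {j \<in> {1..?n}. j \<in> S} = card S" by simp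
    have "{j \<in> {1..?n}. j \<notin> S} = {1..?n} - S" by auto
    then show "card {j \<in> {1..?n}. j \<notin> S} = q"
      using S by (simp add: card_Diff_subset finite_subset[OF S(1)])
  qed
  have cl: "count_list (map (\<lambda>j. if j \<in> S then 0 else 1) [1..<Suc ?n]) b =
      (if b = 0 then card S else if b = 1 then q else 0)" for b :: nat
  proof -
    have "set [1..<Suc ?n] = {1..?n}" by (simp add: atLeastLessThanSuc_atLeastAtMost del: upt_Suc)
    then have "count_list (map (\<lambda>j. if j \<in> S then 0 else 1) [1..<Suc ?n]) b =
      card {j \<in> {1..?n}. (if j \<in> S then 0 else 1) = b}"
      by (simp only: count_list_map_indicator distinct_upt)
    also have "{j \<in> {1..?n}. (if j \<in> S then 0 else 1) = b} =
       (if b = 0 then {j \<in> {1..?n}. j \<in> S} else if b = 1 then {j \<in> {1..?n}. j \<notin> S} else {})"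
      by auto
    finally show ?thesis using cS by simp
  qed
  have E: "real_of_int (mixed_count (\<lambda>j. if j \<in> S then K else T)) = pcount rs (?n - q) q"
    if K: "cofin K" "K \<noteq> 1" and rs: "\<forall>p\<in>set rs. (\<Sum>j\<in>W. p j) \<le> ?n"
      "\<And>x. colen (\<Prod>j\<in>W. A K j ^ (N + x j)) = newt W rs x" for K rs
  proof -
    have B: "colen ((\<Prod>b\<in>W. A K b ^ N) * (\<Prod>b\<in>W. A K b ^ x b)) = newt W rs x" for x
      unfolding rs(2)[symmetric] by (simp add: power_add prod.distrib)
    have pA: "A K b \<noteq> 1" for b using K proper by (simp add: A_def)
    have cB: "cofin (\<Prod>b\<in>W. A K b ^ N)" using cA[OF K(1)] by auto
    have "mixed_count (\<lambda>j. A K (if j \<in> S then 0 else 1)) =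
      int (length (filter (\<lambda>p. \<forall>b\<in>W. p b = count_list (map (\<lambda>j. if j \<in> S then 0 else 1) [1..<Suc ?n]) b) rs))"
      by (rule mixed_count_blocks[OF finW _ cA[OF K(1)] cB n1 pA B]) (use rs(1) in \<open>auto simp: W_def\<close>)
    moreover have "(\<lambda>j. A K (if j \<in> S then 0 else 1)) = (\<lambda>j. if j \<in> S then K else T)"
      by (auto simp: A_def)
    moreover have "card S = ?n - q" using S(2) by simp
    ultimately show ?thesis unfolding cl by (simp add: W_def pcount_def)
  qed
  have "\<forall>p\<in>set ps. (\<Sum>j\<in>W. p j) \<le> ?n" "\<forall>p\<in>set ps'. (\<Sum>j\<in>W. p j) \<le> ?n" using ps(1) ps'(1) by auto
  note EJ = E[OF cof(1) proper(1) this(1) ps(2)] and EJ' = E[OF cof(2) proper(2) this(2) ps'(2)]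
  define d where "d x y = real (newt {0, 1} ps (\<lambda>j. if j = 0 then x else y)) -
       real (newt {0, 1} ps' (\<lambda>j. if j = 0 then x else y))" for x y
  have df: "d x y = f (N + x) (N + y)" for x y
  proof -
    let ?u = "N + x" and ?w = "N + y"
    have "(\<Prod>j\<in>W. A K j ^ (N + (if j = 0 then x else y))) = K ^ ?u * T ^ ?w" for K
      by (simp add: W_def A_def)
    then have "newt W ps (\<lambda>j. if j = 0 then x else y) = colen (J ^ ?u * T ^ ?w)"
      "newt W ps' (\<lambda>j. if j = 0 then x else y) = colen (J' ^ ?u * T ^ ?w)"
      unfolding ps(2)[symmetric] ps'(2)[symmetric] by simp_all
    moreover have "colen (J ^ ?u * T ^ ?w) = colen (J' ^ ?u * T ^ ?w) +
        card (exps (J' ^ ?u * T ^ ?w) - exps (J ^ ?u * T ^ ?w))"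
      using cof sub by (intro colen_add exps_times_mono exps_power_mono) auto
    ultimately show ?thesis unfolding d_def f by (simp add: W_def)
  qed
  have p2: "\<forall>p\<in>set ps. p 0 + p 1 \<le> ?n" using ps(1) by (auto simp: W_def)
  have p2': "\<forall>p\<in>set ps'. p 0 + p 1 \<le> ?n" using ps'(1) by (auto simp: W_def)
  have qn: "q \<le> ?n" using S(2) by simp
  note cmp = pcount_comparison[OF p2 p2' d_def qn]
  {
    assume "\<And>u. (\<lambda>w. f u w / real w ^ q) \<longlonglongrightarrow> 0"
    then have "(\<lambda>y. d x y / real y ^ q) \<longlonglongrightarrow> 0" for x unfolding df by (intro tendsto_shift_power)
    then have "pcount ps (?n - q) q = pcount ps' (?n - q) q" by (rule cmp(1))
    then show "mixed_count (\<lambda>j. if j \<in> S then J else T) = mixed_count (\<lambda>j. if j \<in> S then J' else T)"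
      using EJ EJ' by simp
  next
    assume h: "\<And>u. (\<lambda>w. f u w / real w ^ Suc q) \<longlonglongrightarrow> 0" "\<kappa> > 0"
      "\<And>u. \<forall>\<^sub>F w in sequentially. \<kappa> * real u ^ card S * real w ^ q \<le> f u w"
    have l: "(\<lambda>y. d x y / real y ^ Suc q) \<longlonglongrightarrow> 0" for x
      unfolding df by (rule tendsto_shift_power[OF h(1)])
    have cS': "card S = ?n - q" using S(2) by simp
    have "\<forall>\<^sub>F y in sequentially. \<kappa> * real x ^ (?n - q) * real y ^ q \<le> d x y" for x
    proof -
      have "\<forall>\<^sub>F y in sequentially. \<kappa> * real (N + x) ^ card S * real (y + N) ^ q \<le> f (N + x) (y + N)"
        using h(3)[of "N + x"]
        by (rule iffD2[OF eventually_sequentially_seg[of "\<lambda>w. \<kappa> * real (N + x) ^ card S * real w ^ q \<le> f (N + x) w" N]])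
      then show ?thesis
      proof eventually_elim
        case (elim y)
        have "\<kappa> * real x ^ (?n - q) * real y ^ q \<le> \<kappa> * real (N + x) ^ card S * real (y + N) ^ q"
          unfolding cS' using h(2) by (intro mult_mono power_mono) auto
        then show ?case using elim by (simp add: df add.commute)
      qed
    qed
    from cmp(2)[OF l h(2) this]
    have "real_of_int (mixed_count (\<lambda>j. if j \<in> S then J' else T)) < real_of_int (mixed_count (\<lambda>j. if j \<in> S then J else T))"
      unfolding EJ EJ' .
    then show "mixed_count (\<lambda>j. if j \<in> S then J' else T) < mixed_count (\<lambda>j. if j \<in> S then J else T)" by simp
  }
qed

section \<open>Exponents with degree in a window\<close>

lemma card_box:
  fixes b :: "'n::finite \<Rightarrow> nat"
  shows "card {k. \<forall>j. k j < b j} = (\<Prod>j\<in>UNIV. b j)" "finite {k. \<forall>j. k j < b j}"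
proof -
  have "{k. \<forall>j. k j < b j} = Pi\<^sub>E UNIV (\<lambda>j. {..<b j})" by auto
  then show "card {k. \<forall>j. k j < b j} = (\<Prod>j\<in>UNIV. b j)" "finite {k. \<forall>j. k j < b j}"
    by (simp_all add: card_PiE finite_PiE)
qed

lemma deg_remove: "deg k = k j + (\<Sum>i\<in>UNIV - {j}. k i)"
  unfolding deg_def by (simp add: sum.remove)

text \<open>The coordinate at j can be recovered from the degree and the other coordinates. Within a
  window of degrees this trades a coordinate of unbounded size for one of bounded size.\<close>

lemma deg_window_inj:
  fixes w :: nat
  shows "inj_on (\<lambda>k :: 'n::finite \<Rightarrow> nat. k(j := deg k - w)) {k. w \<le> deg k}"
proof (rule inj_onI)
  fix k l :: "'n \<Rightarrow> nat"
  assume h: "k \<in> {k. w \<le> deg k}" "l \<in> {k. w \<le> deg k}" "k(j := deg k - w) = l(j := deg l - w)"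
  have other: "k i = l i" if "i \<noteq> j" for i using fun_cong[OF h(3), of i] that by simp
  have "deg k - w = deg l - w" using fun_cong[OF h(3), of j] by simp
  then have "deg k = deg l" using h(1,2) by simp
  moreover have "(\<Sum>i\<in>UNIV - {j}. k i) = (\<Sum>i\<in>UNIV - {j}. l i)" using other by (intro sum.cong) auto
  ultimately have "k j = l j" unfolding deg_remove[of _ j] by simp
  show "k = l"
  proof
    fix i show "k i = l i" using other \<open>k j = l j\<close> by (cases "i = j") auto
  qed
qed

text \<open>Let M be the set of large coordinates. One of them is fixed by the degree up to C
  choices, so one coordinate fewer than the size of M ranges over values of order w. The factor w on
  the left replaces the exponent q - 1 on the right and so covers q = 0, where no such exponent
  exists: coordinates all below B would give a degree below w.\<close>

lemma card_window_le:
  assumes C: "C \<le> w" and w: "CARD('n) * B \<le> w" "0 < w"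
  shows "card {k :: 'n::finite \<Rightarrow> nat. card {j. B \<le> k j} \<le> q \<and> w \<le> deg k \<and> deg k < w + C} * w
    \<le> (2 ^ CARD('n) * CARD('n) * (C * (2 ^ q * Suc B ^ CARD('n)))) * w ^ q"
proof -
  define \<Omega> where "\<Omega> M = {k :: 'n \<Rightarrow> nat. (\<forall>j. j \<notin> M \<longrightarrow> k j < B) \<and> (\<forall>j. k j < w + C) \<and> w \<le> deg k \<and> deg k < w + C}" for M
  define I where "I = (SIGMA M:{M :: 'n set. card M \<le> q}. M)"
  have finI: "finite I" unfolding I_def by (rule finite_SigmaI) auto
  have cardI: "card I \<le> 2 ^ CARD('n) * CARD('n)"
  proof -
    have "I \<subseteq> UNIV" by simp
    then have "card I \<le> card (UNIV :: ('n set \<times> 'n) set)" by (intro card_mono) auto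
    also have "\<dots> = 2 ^ CARD('n) * CARD('n)" by (simp add: card_cartesian_product flip: UNIV_Times_UNIV Pow_UNIV add: card_Pow)
    finally show ?thesis .
  qed
  have sub: "{k :: 'n \<Rightarrow> nat. card {j. B \<le> k j} \<le> q \<and> w \<le> deg k \<and> deg k < w + C} \<subseteq> (\<Union>(M, j)\<in>I. \<Omega> M)"
  proof
    fix k :: "'n \<Rightarrow> nat" assume k: "k \<in> {k. card {j. B \<le> k j} \<le> q \<and> w \<le> deg k \<and> deg k < w + C}"
    have "{j. B \<le> k j} \<noteq> {}"
    proof
      assume "{j. B \<le> k j} = {}"
      then have lt: "k j < B" for j by (auto simp: not_le[symmetric])
      have "deg k < (\<Sum>j\<in>(UNIV :: 'n set). B)" unfolding deg_def by (rule sum_strict_mono) (use lt in auto)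
      then show False using k w by simp
    qed
    then obtain j where "B \<le> k j" by auto
    moreover have "k \<in> \<Omega> {j. B \<le> k j}"
      using k le_deg[of k] by (auto simp: \<Omega>_def not_le intro: le_less_trans)
    ultimately show "k \<in> (\<Union>(M, j)\<in>I. \<Omega> M)" using k by (auto simp: I_def intro!: bexI[of _ "({j. B \<le> k j}, j)"])
  qed
  have bnd: "finite (\<Omega> M) \<and> card (\<Omega> M) * w \<le> C * (2 ^ q * Suc B ^ CARD('n)) * w ^ q" if "(M, j) \<in> I" for M j
  proof -
    have M: "card M \<le> q" "j \<in> M" using that by (auto simp: I_def)
    define b where "b i = (if i = j then C else if i \<in> M then w + C else B)" for i
    have inj: "inj_on (\<lambda>k. k(j := deg k - w)) (\<Omega> M)"
      by (rule inj_on_subset[OF deg_window_inj]) (auto simp: \<Omega>_def)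
    have im: "(\<lambda>k. k(j := deg k - w)) ` \<Omega> M \<subseteq> {k. \<forall>j. k j < b j}"
      using M(2) by (auto simp: \<Omega>_def b_def)
    have fin: "finite (\<Omega> M)" using inj im card_box(2)[of b] by (meson finite_imageD finite_subset)
    have "card (\<Omega> M) = card ((\<lambda>k. k(j := deg k - w)) ` \<Omega> M)" by (simp add: card_image[OF inj])
    also have "\<dots> \<le> (\<Prod>i\<in>UNIV. b i)" using im card_box[of b] by (metis card_mono)
    also have "(\<Prod>i\<in>UNIV. b i) = (\<Prod>i\<in>M. b i) * (\<Prod>i\<in>-M. b i)"
      by (metis Compl_eq_Diff_UNIV finite_class.finite_UNIV mult.commute prod.subset_diff subset_UNIV)
    also have "(\<Prod>i\<in>M. b i) = C * (\<Prod>i\<in>M - {j}. b i)" using M(2) by (simp add: prod.remove[of M j] b_def)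
    also have "(\<Prod>i\<in>M - {j}. b i) = (w + C) ^ (card M - 1)"
    proof -
      have "(\<Prod>i\<in>M - {j}. b i) = (\<Prod>i\<in>M - {j}. w + C)" by (rule prod.cong) (auto simp: b_def)
      then show ?thesis using M(2) by simp
    qed
    also have "(\<Prod>i\<in>-M. b i) = B ^ card (-M)"
    proof -
      have "(\<Prod>i\<in>-M. b i) = (\<Prod>i\<in>-M. B)" by (rule prod.cong) (use M(2) in \<open>auto simp: b_def\<close>)
      then show ?thesis by simp
    qed
    also have "C * (w + C) ^ (card M - 1) * B ^ card (-M) \<le> C * (2 * w) ^ (card M - 1) * Suc B ^ CARD('n)"
    proof (intro mult_le_mono power_mono order_refl)
      have "B ^ card (-M) \<le> Suc B ^ card (-M)" by (rule power_mono) auto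
      also have "\<dots> \<le> Suc B ^ CARD('n)" by (rule power_increasing) (auto intro: card_mono)
      finally show "B ^ card (-M) \<le> Suc B ^ CARD('n)" .
    qed (use C in auto)
    finally have "card (\<Omega> M) * w \<le> C * (2 * w) ^ (card M - 1) * Suc B ^ CARD('n) * w" by simp
    also have "\<dots> = C * 2 ^ (card M - 1) * Suc B ^ CARD('n) * (w ^ (card M - 1) * w)"
      by (simp add: power_mult_distrib)
    also have "w ^ (card M - 1) * w = w ^ card M"
      using M(2) by (metis card_gt_0_iff empty_iff finite power_minus_mult)
    also have "C * 2 ^ (card M - 1) * Suc B ^ CARD('n) * w ^ card M \<le> C * 2 ^ q * Suc B ^ CARD('n) * w ^ q"
      using M(1) w(2) by (intro mult_le_mono order_refl power_increasing) auto
    finally show ?thesis using fin by (simp add: mult.assoc)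
  qed
  have fin: "finite (\<Union>(M, j)\<in>I. \<Omega> M)" using finI bnd by (intro finite_UN_I) auto
  have "card {k :: 'n \<Rightarrow> nat. card {j. B \<le> k j} \<le> q \<and> w \<le> deg k \<and> deg k < w + C} * w \<le> card (\<Union>(M, j)\<in>I. \<Omega> M) * w"
    by (intro mult_le_mono card_mono fin sub order_refl)
  also have "\<dots> \<le> (\<Sum>(M, j)\<in>I. card (\<Omega> M)) * w"
    using card_UN_le[OF finI, of "\<lambda>(M, j). \<Omega> M"] by (intro mult_le_mono order_refl) (simp add: case_prod_unfold)
  also have "\<dots> = (\<Sum>(M, j)\<in>I. card (\<Omega> M) * w)" by (simp add: sum_distrib_right case_prod_unfold)
  also have "\<dots> \<le> (\<Sum>(M, j)\<in>I. C * (2 ^ q * Suc B ^ CARD('n)) * w ^ q)"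
    using bnd by (intro sum_mono) auto
  also have "\<dots> = card I * (C * (2 ^ q * Suc B ^ CARD('n)) * w ^ q)" by simp
  also have "\<dots> \<le> (2 ^ CARD('n) * CARD('n)) * (C * (2 ^ q * Suc B ^ CARD('n)) * w ^ q)"
    using cardI by (rule mult_le_mono1)
  finally show ?thesis by (simp only: mult.assoc)
qed

text \<open>The coordinates of every factor are capped at D. Either the cap changes nothing, or some
  coordinate becomes D and the capped factor lies in the D-th power of the maximal ideal, hence in
  J.\<close>

lemma bounded_representative:
  fixes J :: "'n::finite upset"
  assumes D: "exps (max_upset ^ D) \<subseteq> exps J"
  shows "c \<in> exps (J ^ v) \<Longrightarrow> \<exists>c'\<in>exps (J ^ v). c' \<le> c \<and> (\<forall>j. c' j \<le> D * v)"
proof (induction v arbitrary: c)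
  case 0
  show ?case by (rule bexI[of _ 0]) (auto simp: le_fun_def)
next
  case (Suc v)
  then obtain a b where ab: "c = a + b" "a \<in> exps J" "b \<in> exps (J ^ v)" by (auto simp: exps_times)
  obtain b' where b': "b' \<in> exps (J ^ v)" "b' \<le> b" "\<forall>j. b' j \<le> D * v" using Suc.IH[OF ab(3)] by blast
  define a' where "a' = (\<lambda>j. min (a j) D)"
  have "a' \<in> exps J"
  proof (cases "\<forall>j. a j \<le> D")
    case True
    then have "a' = a" by (auto simp: a'_def)
    then show ?thesis using ab by simp
  next
    case False
    then obtain j where "D < a j" by (auto simp: not_le)
    then have "a' j = D" by (simp add: a'_def)
    then have "D \<le> deg a'" using le_deg[of a' j] by simp
    then show ?thesis using D by (auto simp: exps_max_upset_power)
  qed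
  then have "a' + b' \<in> exps (J ^ Suc v)" using b'(1) by (simp add: exps_timesI)
  moreover have "a' + b' \<le> c" using b'(2) by (auto simp: ab(1) a'_def le_fun_def intro!: add_mono)
  moreover have "(a' + b') j \<le> D * Suc v" for j
    using b'(3)[rule_format, of j] by (simp add: a'_def)
  ultimately show ?case by blast
qed

text \<open>Expanding the product, v of the factors come from J and the other u - v from the r-th
  power of the maximal ideal; of the latter only the degree is recorded.\<close>

lemma power_plus_max_representative:
  fixes J :: "'n::finite upset"
  shows "k \<in> exps ((J + max_upset ^ r) ^ u) \<Longrightarrow>
    \<exists>v\<le>u. \<exists>c\<in>exps (J ^ v). c \<le> k \<and> deg c + r * (u - v) \<le> deg k"
proof (induction u arbitrary: k)
  case 0
  show ?case by (intro exI[of _ 0] conjI bexI[of _ 0]) (auto simp: le_fun_def deg_def)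
next
  case (Suc u)
  then obtain a b where ab: "k = a + b" "a \<in> exps J \<union> exps (max_upset ^ r)"
    "b \<in> exps ((J + max_upset ^ r) ^ u)" by (auto simp: exps_times)
  obtain v c where vc: "v \<le> u" "c \<in> exps (J ^ v)" "c \<le> b" "deg c + r * (u - v) \<le> deg b"
    using Suc.IH[OF ab(3)] by blast
  from ab(2) show ?case
  proof
    assume "a \<in> exps J"
    then have "a + c \<in> exps (J ^ Suc v)" using vc(2) by (simp add: exps_timesI)
    moreover have "a + c \<le> k" using vc(3) by (auto simp: ab(1) le_fun_def)
    moreover have "deg (a + c) + r * (Suc u - Suc v) \<le> deg k" using vc(4) by (simp add: ab(1))
    ultimately show ?thesis using vc(1) by (intro exI[of _ "Suc v"]) auto
  next
    assume "a \<in> exps (max_upset ^ r)"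
    then have "r \<le> deg a" by (simp add: exps_max_upset_power)
    moreover have "Suc u - v = Suc (u - v)" using vc(1) by simp
    ultimately have "deg c + r * (Suc u - v) \<le> deg k" using vc(4) by (simp add: ab(1))
    moreover have "c \<le> k" using vc(3) by (auto simp: ab(1) le_fun_def intro: trans_le_add2)
    ultimately show ?thesis using vc(1,2) by (intro exI[of _ v]) auto
  qed
qed

text \<open>With q + 1 large coordinates, forming a set L, the u - v factors known only by their
  degree can be replaced by copies of an element a of J that is supported on L and has degree at
  most r. The threshold u (D + r) leaves room for these copies and for the factors from J, whose
  coordinates are capped at D each.\<close>

lemma small_difference:
  fixes J :: "'n::finite upset"
  assumes D: "exps (max_upset ^ D) \<subseteq> exps J"
    and L: "\<And>L. card L = Suc q \<Longrightarrow> \<exists>a\<in>exps J. (\<forall>j. j \<notin> L \<longrightarrow> a j = 0) \<and> deg a \<le> r"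
  shows "exps ((J + max_upset ^ r) ^ u * max_upset ^ w) - exps (J ^ u * max_upset ^ w) \<subseteq>
    {k. card {j. u * (D + r) \<le> k j} \<le> q \<and> w \<le> deg k \<and> deg k < w + D * u}"
proof
  fix k assume k: "k \<in> exps ((J + max_upset ^ r) ^ u * max_upset ^ w) - exps (J ^ u * max_upset ^ w)"
  have "w \<le> deg k"
  proof -
    have "k \<in> exps (max_upset ^ w)" using k exps_times_subset2 by blast
    then show ?thesis by (simp add: exps_max_upset_power)
  qed
  moreover have "deg k < w + D * u"
  proof (rule ccontr)
    assume "\<not> ?thesis"
    then have "k \<in> exps ((max_upset ^ D) ^ u * max_upset ^ w)"
      by (simp add: exps_max_upset_power add.commute flip: power_mult power_add)
    then show False using k exps_times_mono[OF exps_power_mono[OF D, of u] order_refl] by blast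
  qed
  moreover have "card {j. u * (D + r) \<le> k j} \<le> q"
  proof (rule ccontr)
    assume "\<not> ?thesis"
    then have "Suc q \<le> card {j. u * (D + r) \<le> k j}" by simp
    then obtain L where LM: "L \<subseteq> {j. u * (D + r) \<le> k j}" "card L = Suc q"
      by (metis obtain_subset_with_card_n)
    obtain a where a: "a \<in> exps J" "\<forall>j. j \<notin> L \<longrightarrow> a j = 0" "deg a \<le> r" using L[OF LM(2)] by blast
    obtain x y where xy: "k = x + y" "x \<in> exps ((J + max_upset ^ r) ^ u)" "w \<le> deg y"
      using k by (auto simp: exps_times exps_max_upset_power)
    obtain v c where vc: "v \<le> u" "c \<in> exps (J ^ v)" "c \<le> x" "deg c + r * (u - v) \<le> deg x"
      using power_plus_max_representative[OF xy(2)] by blast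
    obtain c' where c': "c' \<in> exps (J ^ v)" "c' \<le> c" "\<forall>j. c' j \<le> D * v"
      using bounded_representative[OF D vc(2)] by blast
    define z where "z = c' + (\<lambda>j. (u - v) * a j)"
    have "z \<in> exps (J ^ v * J ^ (u - v))"
      unfolding z_def using c'(1) scaled_in_power[OF a(1)] by (rule exps_timesI)
    then have zJ: "z \<in> exps (J ^ u)" using vc(1) by (simp flip: power_add)
    have zk: "z \<le> k"
    proof (rule le_funI)
      fix j
      have c'k: "c' j \<le> k j" using c'(2) vc(3) by (auto simp: xy(1) le_fun_def intro: trans_le_add1 order_trans)
      show "z j \<le> k j"
      proof (cases "j \<in> L")
        case True
        have "z j \<le> D * v + (u - v) * r"
          unfolding z_def using c'(3) le_deg[of a j] a(3) by (auto intro!: add_mono mult_le_mono2 intro: order_trans)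
        also have "\<dots> \<le> D * u + u * r" using vc(1) by (intro add_mono mult_le_mono) auto
        also have "\<dots> \<le> k j" using LM(1) True by (auto simp: algebra_simps)
        finally show ?thesis .
      next
        case False
        then show ?thesis using a(2) c'k by (simp add: z_def)
      qed
    qed
    \<comment> \<open>The replacement does not raise the degree, so degree w is still available for
      the power of the maximal ideal.\<close>
    have "deg z = deg c' + (u - v) * deg a"
      unfolding z_def deg_add by (simp add: deg_def sum_distrib_left)
    also have "\<dots> \<le> deg c + r * (u - v)"
      using deg_mono[OF c'(2)] a(3) by (auto intro!: add_mono simp: mult.commute)
    also have "\<dots> \<le> deg x" by (rule vc(4))
    finally have "deg z + w \<le> deg k" using xy(3) by (simp add: xy(1))
    moreover have "deg k = deg z + deg (k - z)" using add_diff_fun[OF zk] by (metis deg_add)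
    ultimately have "k - z \<in> exps (max_upset ^ w)" by (simp add: exps_max_upset_power)
    then have "k \<in> exps (J ^ u * max_upset ^ w)" using exps_timesI[OF zJ] add_diff_fun[OF zk] by fastforce
    then show False using k by blast
  qed
  ultimately show "k \<in> {k. card {j. u * (D + r) \<le> k j} \<le> q \<and> w \<le> deg k \<and> deg k < w + D * u}" by simp
qed

text \<open>For fixed u neither the width of the window nor the threshold for large coordinates
  depends on w, and \<open>card_window_le\<close> gains a factor w over w^q. The exponent s only
  rescales w.\<close>

lemma small_difference_limit:
  fixes J :: "'n::finite upset"
  assumes J: "cofin J"
    and L: "\<And>L. card L = Suc q \<Longrightarrow> \<exists>a\<in>exps J. (\<forall>j. j \<notin> L \<longrightarrow> a j = 0) \<and> deg a \<le> r"
    and s: "0 < s"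
  shows "(\<lambda>w. real (card (exps ((J + max_upset ^ r) ^ u * (max_upset ^ s) ^ w) -
    exps (J ^ u * (max_upset ^ s) ^ w))) / real w ^ q) \<longlonglongrightarrow> 0"
proof -
  obtain D where D: "exps (max_upset ^ D) \<subseteq> exps J" using J cofin_iff by blast
  define g where "g w = card (exps ((J + max_upset ^ r) ^ u * max_upset ^ w) - exps (J ^ u * max_upset ^ w))" for w
  define B where "B = u * (D + r)"
  define K where "K = 2 ^ CARD('n) * CARD('n) * (D * u * (2 ^ q * Suc B ^ CARD('n)))"
  have g: "g w * w \<le> K * w ^ q" if w: "w \<ge> Suc (D * u + CARD('n) * B)" for w
  proof -
    have fin: "finite {k :: 'n \<Rightarrow> nat. card {j. B \<le> k j} \<le> q \<and> w \<le> deg k \<and> deg k < w + D * u}"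
      by (rule finite_subset[OF _ finite_deg_le[of "w + D * u"]]) auto
    have "g w \<le> card {k :: 'n \<Rightarrow> nat. card {j. B \<le> k j} \<le> q \<and> w \<le> deg k \<and> deg k < w + D * u}"
      unfolding g_def
    proof (rule card_mono[OF fin])
      show "exps ((J + max_upset ^ r) ^ u * max_upset ^ w) - exps (J ^ u * max_upset ^ w)
        \<subseteq> {k. card {j. B \<le> k j} \<le> q \<and> w \<le> deg k \<and> deg k < w + D * u}"
        unfolding B_def by (rule small_difference[OF D]) (rule L)
    qed
    then have "g w * w \<le> card {k :: 'n \<Rightarrow> nat. card {j. B \<le> k j} \<le> q \<and> w \<le> deg k \<and> deg k < w + D * u} * w"
      by (rule mult_le_mono1)
    also have "\<dots> \<le> K * w ^ q" unfolding K_def by (rule card_window_le) (use w in auto)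
    finally show ?thesis .
  qed
  have lim: "(\<lambda>w. real (g (s * w)) / real w ^ q) \<longlonglongrightarrow> 0"
  proof (rule tendsto_sandwich[OF _ _ tendsto_const])
    show "\<forall>\<^sub>F w in sequentially. 0 \<le> real (g (s * w)) / real w ^ q" by simp
    show "\<forall>\<^sub>F w in sequentially. real (g (s * w)) / real w ^ q \<le> real (K * s ^ q) * (1 / real w)"
      using eventually_ge_at_top[of "Suc (D * u + CARD('n) * B)"]
    proof eventually_elim
      case (elim w)
      have "w \<le> s * w" using s by simp
      then have "s * w \<ge> Suc (D * u + CARD('n) * B)" using elim by linarith
      note gs = g[OF this]
      have "g (s * w) * w \<le> g (s * w) * (s * w)" by (rule mult_le_mono2[OF \<open>w \<le> s * w\<close>])
      also have "\<dots> \<le> K * (s * w) ^ q" by (rule gs)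
      also have "\<dots> = K * s ^ q * w ^ q" by (simp add: power_mult_distrib)
      finally have "g (s * w) * w \<le> K * s ^ q * w ^ q" .
      then have "real (g (s * w)) * real w \<le> real (K * s ^ q) * real w ^ q"
        by (metis of_nat_le_iff of_nat_mult of_nat_power)
      then show ?case using elim by (simp add: field_simps)
    qed
    have "(\<lambda>w. real (K * s ^ q) * (1 / real w)) \<longlonglongrightarrow> real (K * s ^ q) * 0"
      by (intro tendsto_intros lim_1_over_n)
    then show "(\<lambda>w. real (K * s ^ q) * (1 / real w)) \<longlonglongrightarrow> 0" by simp
  qed
  then show ?thesis by (simp add: g_def power_mult)
qed

text \<open>Give the coordinates in L weight 1 and all others weight r + 2. Every element of K has
  weight at least r + 1, because it is supported on L or has a nonzero coordinate outside L; and
  weights add up over the u factors.\<close>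

lemma weighted_degree_bound:
  fixes K :: "'n::finite upset"
  assumes "\<And>a. a \<in> exps K \<Longrightarrow> (\<forall>j. j \<notin> L \<longrightarrow> a j = 0) \<Longrightarrow> Suc r \<le> deg a"
  shows "a \<in> exps (K ^ u) \<Longrightarrow> Suc r * u \<le> deg a + Suc r * (\<Sum>j\<in>-L. a j)"
proof (induction u arbitrary: a)
  case (Suc u)
  then obtain x y where xy: "a = x + y" "x \<in> exps K" "y \<in> exps (K ^ u)" by (auto simp: exps_times)
  have "Suc r \<le> deg x + Suc r * (\<Sum>j\<in>-L. x j)"
  proof (cases "\<forall>j. j \<notin> L \<longrightarrow> x j = 0")
    case True
    then show ?thesis using assms[OF xy(2)] by simp
  next
    case False
    then have "(\<Sum>j\<in>-L. x j) \<noteq> 0" by auto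
    then have "1 \<le> (\<Sum>j\<in>-L. x j)" by linarith
    then have "Suc r * 1 \<le> Suc r * (\<Sum>j\<in>-L. x j)" by (rule mult_le_mono2)
    then show ?thesis by (simp only: mult_1_right trans_le_add2)
  qed
  moreover have "deg a = deg x + deg y" unfolding xy(1) by (rule deg_add)
  moreover have "(\<Sum>j\<in>-L. a j) = (\<Sum>j\<in>-L. x j) + (\<Sum>j\<in>-L. y j)"
    by (simp add: xy(1) sum.distrib)
  ultimately show ?case using Suc.IH[OF xy(3)] by (simp only: distrib_left mult_Suc_right)
qed simp

text \<open>Exponents in the difference are made from a box by adjusting one coordinate j0 in L
  until the degree is w + r u + y j0. That is enough for the larger product, but too little for a
  factor from K^u as long as the coordinates outside L are small. The q other coordinates in L run
  up to w / n and give w^q; j0 and the coordinates outside L range over multiples of u and supply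
  the powers of u.\<close>

lemma large_difference:
  fixes K :: "'n::finite upset"
  assumes K: "cofin K" and L: "card L = Suc q"
    and low: "\<And>a. a \<in> exps K \<Longrightarrow> (\<forall>j. j \<notin> L \<longrightarrow> a j = 0) \<Longrightarrow> Suc r \<le> deg a"
    and E: "E = u div (2 * CARD('n) * Suc r)" and w: "w \<ge> CARD('n) * (CARD('n) * E)"
  shows "((u + 1) div 2) * Suc (w div CARD('n)) ^ q * Suc E ^ (CARD('n) - Suc q) \<le>
    card (exps ((K + max_upset ^ r) ^ u * max_upset ^ w) - exps (K ^ u * max_upset ^ w))"
proof -
  let ?n = "CARD('n)"
  let ?D = "exps ((K + max_upset ^ r) ^ u * max_upset ^ w) - exps (K ^ u * max_upset ^ w)"
  have "L \<noteq> {}" using L by auto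
  then obtain j0 where j0: "j0 \<in> L" by blast
  define b where "b j = (if j = j0 then (u + 1) div 2 else if j \<in> L then Suc (w div ?n) else Suc E)" for j
  define rest where "rest y = (\<Sum>j\<in>UNIV - {j0}. y j)" for y :: "'n \<Rightarrow> nat"
  \<comment> \<open>The subtraction is exact, since \<open>rest y\<close> is at most w on the
    box.\<close>
  define sh where "sh y = y(j0 := w + r * u + y j0 - rest y)" for y
  have UN: "UNIV - {j0} = (L - {j0}) \<union> (-L)" using j0 by auto
  have cL: "card (L - {j0}) = q" using L j0 by simp
  have cLc: "card (-L) = ?n - Suc q" using L by (simp add: Compl_eq_Diff_UNIV card_Diff_subset)
  have n: "0 < ?n" by simp
  have rest_le: "rest y \<le> w" if y: "\<forall>j. y j < b j" for y
  proof -
    have "rest y = (\<Sum>j\<in>L - {j0}. y j) + (\<Sum>j\<in>-L. y j)"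
      unfolding rest_def UN by (rule sum.union_disjoint) auto
    also have "(\<Sum>j\<in>L - {j0}. y j) \<le> (\<Sum>j\<in>L - {j0}. w div ?n)"
    proof (rule sum_mono)
      fix j assume "j \<in> L - {j0}"
      then show "y j \<le> w div ?n" using y[rule_format, of j] by (simp add: b_def)
    qed
    also have "(\<Sum>j\<in>-L. y j) \<le> (\<Sum>j\<in>-L. w div ?n)"
    proof (rule sum_mono)
      fix j assume "j \<in> -L"
      then have "j \<notin> L" "j \<noteq> j0" using j0 by auto
      then have "y j \<le> E" using y[rule_format, of j] by (simp add: b_def)
      moreover have "E \<le> w div ?n"
      proof -
        have "E \<le> ?n * E" using n by simp
        also have "\<dots> = (?n * (?n * E)) div ?n" by simp
        also have "\<dots> \<le> w div ?n" using w by (rule div_le_mono)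
        finally show ?thesis .
      qed
      ultimately show "y j \<le> w div ?n" by simp
    qed
    finally have "rest y \<le> (q + (?n - Suc q)) * (w div ?n)" using cL cLc by (simp add: algebra_simps)
    also have "\<dots> \<le> ?n * (w div ?n)"
    proof (rule mult_le_mono1)
      have "card L \<le> ?n" by (rule card_mono) auto
      then show "q + (?n - Suc q) \<le> ?n" using L by simp
    qed
    also have "\<dots> \<le> w" by simp
    finally show ?thesis .
  qed
  have deg_sh: "deg (sh y) = w + r * u + y j0" if "\<forall>j. y j < b j" for y
  proof -
    have "(\<Sum>j\<in>UNIV - {j0}. sh y j) = rest y" unfolding rest_def by (rule sum.cong) (auto simp: sh_def)
    then show ?thesis using rest_le[OF that] unfolding deg_remove[of _ j0] by (simp add: sh_def)
  qed
  have inj: "inj_on sh {y. \<forall>j. y j < b j}"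
  proof (rule inj_onI)
    fix y z assume h: "y \<in> {y. \<forall>j. y j < b j}" "z \<in> {y. \<forall>j. y j < b j}" "sh y = sh z"
    have "y j0 = z j0" using deg_sh[of y] deg_sh[of z] h by simp
    moreover have "y j = z j" if "j \<noteq> j0" for j using fun_cong[OF h(3), of j] that by (simp add: sh_def)
    ultimately show "y = z" by (metis ext)
  qed
  have "sh ` {y. \<forall>j. y j < b j} \<subseteq> ?D"
  proof
    fix k assume "k \<in> sh ` {y. \<forall>j. y j < b j}"
    then obtain y where y: "\<forall>j. y j < b j" "k = sh y" by blast
    note dk = deg_sh[OF y(1), folded y(2)]
    have "exps ((max_upset ^ r) ^ u * max_upset ^ w) \<subseteq> exps ((K + max_upset ^ r) ^ u * max_upset ^ w)"
      by (intro exps_times_mono exps_power_mono) auto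
    moreover have "k \<in> exps ((max_upset ^ r) ^ u * max_upset ^ w)"
      unfolding power_mult[symmetric] power_add[symmetric] by (simp add: exps_max_upset_power dk)
    moreover have "k \<notin> exps (K ^ u * max_upset ^ w)"
    proof
      assume "k \<in> exps (K ^ u * max_upset ^ w)"
      then obtain a z where az: "k = a + z" "a \<in> exps (K ^ u)" "w \<le> deg z"
        by (auto simp: exps_times exps_max_upset_power)
      have "deg a \<le> r * u + y j0" using dk az(3) by (simp add: az(1))
      moreover have "(\<Sum>j\<in>-L. a j) \<le> ?n * E"
      proof -
        have "(\<Sum>j\<in>-L. a j) \<le> (\<Sum>j\<in>-L. E)"
        proof (rule sum_mono)
          fix j assume j: "j \<in> -L"
          then have "j \<noteq> j0" using j0 by auto
          then have "k j = y j" by (simp add: y(2) sh_def)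
          moreover have "y j \<le> E" using y(1)[rule_format, of j] j \<open>j \<noteq> j0\<close> by (simp add: b_def)
          moreover have "a j \<le> k j" by (simp add: az(1))
          ultimately show "a j \<le> E" by simp
        qed
        also have "\<dots> \<le> ?n * E" by (simp add: card_mono)
        finally show ?thesis .
      qed
      then have "Suc r * (\<Sum>j\<in>-L. a j) \<le> Suc r * (?n * E)" by (rule mult_le_mono2)
      \<comment> \<open>By the choice of E the coordinates outside L contribute at most u / 2 to the
        weight, and y j0 is less than u / 2; together they fall short of the u by which (r + 1) u
        exceeds r u.\<close>
      moreover have "2 * (Suc r * (?n * E)) \<le> u"
      proof -
        have "2 * (Suc r * (?n * E)) = 2 * ?n * Suc r * E" by (simp add: ac_simps)
        also have "\<dots> \<le> u" unfolding E by (rule times_div_less_eq_dividend)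
        finally show ?thesis .
      qed
      moreover have "Suc r * u \<le> deg a + Suc r * (\<Sum>j\<in>-L. a j)"
        by (rule weighted_degree_bound[OF low az(2)])
      moreover have "2 * y j0 < u" using y(1)[rule_format, of j0] by (simp add: b_def)
      ultimately show False by simp
    qed
    ultimately show "k \<in> ?D" by blast
  qed
  moreover have "finite ?D" using K by (intro finite_diff_cofin) auto
  ultimately have "card (sh ` {y. \<forall>j. y j < b j}) \<le> card ?D" by (rule card_mono[rotated])
  then have "(\<Prod>j\<in>UNIV. b j) \<le> card ?D" using card_image[OF inj] card_box(1)[of b] by simp
  moreover have "(\<Prod>j\<in>UNIV. b j) = ((u + 1) div 2) * Suc (w div ?n) ^ q * Suc E ^ (?n - Suc q)"
  proof -
    have "(\<Prod>j\<in>UNIV. b j) = b j0 * (\<Prod>j\<in>UNIV - {j0}. b j)" by (simp add: prod.remove)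
    also have "(\<Prod>j\<in>UNIV - {j0}. b j) = (\<Prod>j\<in>L - {j0}. b j) * (\<Prod>j\<in>-L. b j)"
      unfolding UN by (rule prod.union_disjoint) auto
    also have "(\<Prod>j\<in>L - {j0}. b j) = (\<Prod>j\<in>L - {j0}. Suc (w div ?n))" by (rule prod.cong) (auto simp: b_def)
    also have "(\<Prod>j\<in>-L. b j) = (\<Prod>j\<in>-L. Suc E)" by (rule prod.cong) (use j0 in \<open>auto simp: b_def\<close>)
    finally show ?thesis using cL cLc by (simp add: b_def mult.assoc)
  qed
  ultimately show ?thesis by simp
qed

lemma real_div_le_Suc_div:
  assumes "0 < c"
  shows "real u / real c \<le> real (Suc (u div c))"
proof -
  have "u \<le> Suc (u div c) * c"
    using dividend_less_div_times[OF assms, of u] by simp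
  then have "real u \<le> real (Suc (u div c)) * real c" by (metis of_nat_le_iff of_nat_mult)
  then show ?thesis using assms by (simp only: pos_divide_le_eq of_nat_0_less_iff)
qed

lemma large_difference_eventually:
  fixes K :: "'n::finite upset"
  assumes K: "cofin K" and L: "card L = Suc q" and s: "0 < s"
    and low: "\<And>a. a \<in> exps K \<Longrightarrow> (\<forall>j. j \<notin> L \<longrightarrow> a j = 0) \<Longrightarrow> Suc r \<le> deg a"
  shows "\<exists>\<kappa>>0. \<forall>u. \<forall>\<^sub>F w in sequentially. \<kappa> * real u ^ (CARD('n) - q) * real w ^ q \<le>
    real (card (exps ((K + max_upset ^ r) ^ u * (max_upset ^ s) ^ w) - exps (K ^ u * (max_upset ^ s) ^ w)))"
proof -
  let ?n = "CARD('n)"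
  define c where "c = 2 * ?n * Suc r"
  \<comment> \<open>The three factors come from halving u, from spreading w over n coordinates, and
    from the quotient u / c that bounds the coordinates outside L. None of them depends on
    u.\<close>
  define \<kappa> where "\<kappa> = (1/2) * (1 / real ?n) ^ q * (1 / real c) ^ (?n - Suc q)"
  have n: "0 < ?n" and c: "0 < c" by (simp_all add: c_def)
  have "card L \<le> ?n" by (rule card_mono) auto
  then have nq: "?n - q = Suc (?n - Suc q)" using L by simp
  have "\<kappa> * real u ^ (?n - q) * real w ^ q \<le>
    real (card (exps ((K + max_upset ^ r) ^ u * (max_upset ^ s) ^ w) - exps (K ^ u * (max_upset ^ s) ^ w)))"
    if w: "w \<ge> ?n * (?n * (u div c))" for u w
  proof -
    have ws: "w \<le> s * w" using s by simp
    have a: "real u / 2 \<le> real ((u + 1) div 2)" by linarith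
    have b: "real w / real ?n \<le> real (Suc (s * w div ?n))"
    proof -
      have "real w / real ?n \<le> real (s * w) / real ?n"
        using ws by (intro divide_right_mono) (auto simp only: of_nat_le_iff of_nat_0_le_iff)
      also have "\<dots> \<le> real (Suc (s * w div ?n))" by (rule real_div_le_Suc_div[OF n])
      finally show ?thesis .
    qed
    have e: "real u / real c \<le> real (Suc (u div c))" by (rule real_div_le_Suc_div[OF c])
    have "\<kappa> * real u ^ (?n - q) * real w ^ q =
        (real u / 2) * (real w / real ?n) ^ q * (real u / real c) ^ (?n - Suc q)"
      unfolding nq \<kappa>_def by (simp add: power_divide)
    also have "\<dots> \<le> real ((u + 1) div 2) * real (Suc (s * w div ?n)) ^ q * real (Suc (u div c)) ^ (?n - Suc q)"
      by (intro mult_mono power_mono a b e) auto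
    also have "\<dots> = real (((u + 1) div 2) * Suc (s * w div ?n) ^ q * Suc (u div c) ^ (?n - Suc q))"
      by (simp only: of_nat_mult of_nat_power)
    also have "\<dots> \<le> real (card (exps ((K + max_upset ^ r) ^ u * max_upset ^ (s * w)) - exps (K ^ u * max_upset ^ (s * w))))"
      unfolding of_nat_le_iff
    proof (rule large_difference[OF K L low])
      show "u div c = u div (2 * ?n * Suc r)" by (simp only: c_def)
      show "?n * (?n * (u div c)) \<le> s * w" using w ws by (rule order_trans)
    qed
    finally show ?thesis by (simp add: power_mult)
  qed
  then have "\<forall>\<^sub>F w in sequentially. \<kappa> * real u ^ (?n - q) * real w ^ q \<le>
    real (card (exps ((K + max_upset ^ r) ^ u * (max_upset ^ s) ^ w) - exps (K ^ u * (max_upset ^ s) ^ w)))" for u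
    using eventually_ge_at_top by (rule eventually_mono[rotated])
  moreover have "\<kappa> > 0" using n c by (simp add: \<kappa>_def)
  ultimately show ?thesis by blast
qed

text \<open>Adding this set to \<open>J\<close> does not change \<open>J + \<mm>\<^sup>r\<close>, but brings the number of new exponents down to
  the exact order \<open>w\<^sup>q\<close>, so that leading coefficients can be compared.\<close>

lift_definition off_upset :: "'n::finite set \<Rightarrow> nat \<Rightarrow> 'n upset"
  is "\<lambda>L r. {k. r \<le> deg k \<and> (\<exists>j. j \<notin> L \<and> k j \<noteq> 0)}"
  unfolding up_closed_def
proof (intro ballI allI impI)
  fix L :: "'n set" and r and k l :: "'n \<Rightarrow> nat"
  assume k: "k \<in> {k. r \<le> deg k \<and> (\<exists>j. j \<notin> L \<and> k j \<noteq> 0)}" and "k \<le> l"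
  then have "deg k \<le> deg l" "\<And>j. k j \<le> l j" by (auto simp: deg_mono le_fun_def)
  with k show "l \<in> {k. r \<le> deg k \<and> (\<exists>j. j \<notin> L \<and> k j \<noteq> 0)}"
    by (auto, metis le_zero_eq not_gr_zero)
qed

section \<open>Strict inequality below the order, equality from it on\<close>

lemma power_max_proper: "1 \<le> r \<Longrightarrow> exps (max_upset ^ r) \<subseteq> exps (max_upset :: 'n::finite upset)"
  using exps_power_antimono[of 1 r max_upset] by simp

lemma power_proper:
  assumes "(A :: 'n::finite upset) \<noteq> 1" "1 \<le> s"
  shows "A ^ s \<noteq> 1"
  using assms exps_power_antimono[of 1 s A] unfolding proper_iff by auto

lemma max_proper: "(max_upset :: 'n::finite upset) \<noteq> 1"
  unfolding proper_iff by simp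

lemma plus_max_proper:
  assumes "(A :: 'n::finite upset) \<noteq> 1" "1 \<le> r"
  shows "A + max_upset ^ r \<noteq> 1"
  using assms power_max_proper[of r, where 'n = 'n] unfolding proper_iff by auto

text \<open>K lies between J and its sum with the r-th power of the maximal ideal. Monotonicity
  handles the step from J to K; the step from K to the sum is strict, because there the upper and
  the lower bound for the count match.\<close>

lemma mixed_count_less:
  fixes J :: "'n::finite upset"
  assumes J: "cofin J" "J \<noteq> 1" and L: "card L = Suc q" and r: "1 \<le> r" and s: "1 \<le> s"
    and low: "\<And>a. a \<in> exps J \<Longrightarrow> (\<forall>j. j \<notin> L \<longrightarrow> a j = 0) \<Longrightarrow> Suc r \<le> deg a"
    and S: "S \<subseteq> {1..CARD('n)}" "card S + q = CARD('n)"
  shows "mixed_count (\<lambda>j. if j \<in> S then J + max_upset ^ r else max_upset ^ s) <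
    mixed_count (\<lambda>j. if j \<in> S then J else max_upset ^ s)"
proof -
  define K where "K = J + off_upset L r"
  have eK: "exps K = exps J \<union> {k. r \<le> deg k \<and> (\<exists>j. j \<notin> L \<and> k j \<noteq> 0)}"
    by (simp add: K_def off_upset.rep_eq)
  have cK: "cofin K" unfolding K_def using J by simp
  have pK: "K \<noteq> 1" using J(2) r unfolding proper_iff eK by (auto simp: exps_max_upset)
  have T: "cofin (max_upset ^ s :: 'n upset)" "(max_upset ^ s :: 'n upset) \<noteq> 1"
    using power_proper[OF max_proper s] by auto
  have KM: "K + max_upset ^ r = J + max_upset ^ r"
    by (rule upset_eqI) (auto simp: eK exps_max_upset_power)
  have "mixed_count (\<lambda>j. if j \<in> S then K else max_upset ^ s) \<le>
    mixed_count (\<lambda>j. if j \<in> S then J else max_upset ^ s)"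
    by (rule mixed_count_mono[OF J(1) cK T(1) J(2) pK T(2) _ S(1)]) (simp add: eK)
  moreover have "mixed_count (\<lambda>j. if j \<in> S then K + max_upset ^ r else max_upset ^ s) <
    mixed_count (\<lambda>j. if j \<in> S then K else max_upset ^ s)"
  proof -
    have lowK: "Suc r \<le> deg a" if "a \<in> exps K" "\<forall>j. j \<notin> L \<longrightarrow> a j = 0" for a
      using that low[of a] by (auto simp: eK)
    have "0 < s" using s by simp
    from large_difference_eventually[OF cK L this lowK]
    obtain \<kappa> where \<kappa>: "\<kappa> > 0" "\<And>u. \<forall>\<^sub>F w in sequentially. \<kappa> * real u ^ (CARD('n) - q) * real w ^ q \<le>
      real (card (exps ((K + max_upset ^ r) ^ u * (max_upset ^ s) ^ w) - exps (K ^ u * (max_upset ^ s) ^ w)))"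
      by blast
    have lim: "(\<lambda>w. real (card (exps ((K + max_upset ^ r) ^ u * (max_upset ^ s) ^ w) -
      exps (K ^ u * (max_upset ^ s) ^ w))) / real w ^ Suc q) \<longlonglongrightarrow> 0" for u
    proof (rule small_difference_limit[OF cK])
      \<comment> \<open>A set with q + 2 elements is not contained in L, and r times the unit vector
        at a coordinate outside L belongs to the added part of K.\<close>
      fix L' :: "'n set" assume "card L' = Suc (Suc q)"
      then have "\<not> L' \<subseteq> L" using L card_mono[of L L'] by auto
      then obtain j where j: "j \<in> L'" "j \<notin> L" by blast
      define a where "a = (\<lambda>c. if c = j then r else 0)"
      have "deg a = r" by (simp add: deg_def a_def)
      moreover have "a j \<noteq> 0" using r by (simp add: a_def)
      ultimately have "a \<in> exps K" using j(2) by (auto simp: eK)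
      then show "\<exists>a\<in>exps K. (\<forall>j. j \<notin> L' \<longrightarrow> a j = 0) \<and> deg a \<le> r"
        using j(1) \<open>deg a = r\<close> by (intro bexI[of _ a]) (auto simp: a_def)
    qed (use s in simp)
    have cS: "CARD('n) - q = card S" using S(2) by simp
    show ?thesis
      by (rule mixed_count_comparison(2)[OF cK _ T(1) pK _ T(2) _ S refl lim \<kappa>(1) \<kappa>(2)[unfolded cS]])
         (use cK plus_max_proper[OF pK r] in auto)
  qed
  ultimately show ?thesis unfolding KM by simp
qed

lemma mixed_count_eq:
  fixes J :: "'n::finite upset"
  assumes J: "cofin J" "J \<noteq> 1" and r: "1 \<le> r" and s: "1 \<le> s"
    and up: "\<And>L. card L = Suc q \<Longrightarrow> \<exists>a\<in>exps J. (\<forall>j. j \<notin> L \<longrightarrow> a j = 0) \<and> deg a \<le> r"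
    and S: "S \<subseteq> {1..CARD('n)}" "card S + q = CARD('n)"
  shows "mixed_count (\<lambda>j. if j \<in> S then J else max_upset ^ s) =
    mixed_count (\<lambda>j. if j \<in> S then J + max_upset ^ r else max_upset ^ s)"
proof (rule mixed_count_comparison(1)[OF J(1) _ _ J(2) _ _ _ S refl])
  show "(\<lambda>w. real (card (exps ((J + max_upset ^ r) ^ u * (max_upset ^ s) ^ w) -
      exps (J ^ u * (max_upset ^ s) ^ w))) / real w ^ q) \<longlonglongrightarrow> 0" for u
    by (rule small_difference_limit[OF J(1) up]) (use s in auto)
qed (use J plus_max_proper[OF J(2) r] power_proper[OF max_proper s] in auto)

section \<open>Positivity, and the threshold for powers of an ideal\<close>

lemma mixed_count_cong:
  fixes A B :: "nat \<Rightarrow> 'n::finite upset"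
  assumes "\<And>j. j \<in> {1..CARD('n)} \<Longrightarrow> A j = B j"
  shows "mixed_count A = mixed_count B"
proof -
  have "(\<Prod>j\<in>{1..CARD('n)}. A j ^ r j) = (\<Prod>j\<in>{1..CARD('n)}. B j ^ r j)" for r
    by (rule prod.cong) (auto simp: assms)
  then show ?thesis by (simp add: mixed_count_def)
qed

lemma mixed_count_1: "mixed_count (\<lambda>j. 1 :: 'n::finite upset) = 0"
  by (rule mixed_countI) (simp add: colen_def iter_diff_0)

text \<open>If the coefficient were 0, the colength of the power with exponent N + n t would be of
  order t^(n - 1). But its complement contains a cube of side t.\<close>

lemma mixed_count_max_pos: "0 < mixed_count (\<lambda>j. max_upset :: 'n::finite upset)"
proof -
  let ?n = "CARD('n)"
  have n1: "1 \<in> {1..?n}" using zero_less_card_finite[where 'a = 'n] by auto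
  obtain N where N: "\<exists>ps. (\<forall>p\<in>set ps. (\<Sum>j\<in>{0}. p j) \<le> ?n) \<and>
    (\<forall>x. colen (1 * (\<Prod>j\<in>{0}. (max_upset :: 'n upset) ^ (N + x j))) = newt {0} ps x)"
    using colen_newt[of "{0}" "\<lambda>_. max_upset :: 'n upset" 1] by (meson cofin_1 cofin_max finite.emptyI finite.insertI order_refl)
  obtain ps where ps: "\<forall>p\<in>set ps. (\<Sum>j\<in>{0}. p j) \<le> ?n"
    "\<And>x. colen (1 * (\<Prod>j\<in>{0}. (max_upset :: 'n upset) ^ (N + x j))) = newt {0} ps x"
    using N by blast
  have B: "colen (max_upset ^ N * (\<Prod>b\<in>{0}. (max_upset :: 'n upset) ^ x b)) = newt {0} ps x" for x
    using ps(2)[of x] by (simp add: power_add)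
  have cl: "count_list (map (\<lambda>_. 0 :: nat) [1..<Suc ?n]) 0 = ?n"
    by (simp add: map_replicate_const del: upt_Suc) (simp add: count_list_eq_length_filter)
  have "mixed_count (\<lambda>j. max_upset :: 'n upset) =
      int (length (filter (\<lambda>p. \<forall>b\<in>{0}. p b = count_list (map (\<lambda>_. 0 :: nat) [1..<Suc ?n]) b) ps))"
    by (rule mixed_count_blocks[where \<beta> = "\<lambda>_. 0" and A = "\<lambda>_. max_upset", OF _ _ _ _ n1 _ B])
       (use ps(1) max_proper in auto)
  then have E: "mixed_count (\<lambda>j. max_upset :: 'n upset) = int (length (filter (\<lambda>p. p 0 = ?n) ps))"
    by (simp only: ball_simps cl) simp
  have "filter (\<lambda>p. p 0 = ?n) ps \<noteq> []"
  proof
    assume e: "filter (\<lambda>p. p 0 = ?n) ps = []"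
    have "(\<Sum>j\<in>{0}. p j) \<le> ?n - 1" if "p \<in> set ps" for p
      using e ps(1) that by (fastforce simp: filter_empty_conv)
    then have up: "newt {0} ps (\<lambda>_. t) \<le> length ps * Suc t ^ (?n - 1)" for t
      by (intro newt_upper) auto
    define t where "t = length ps * Suc ?n ^ (?n - 1) + 1"
    have t1: "t \<ge> 1" by (simp add: t_def)
    have "card {k :: 'n \<Rightarrow> nat. \<forall>j. k j < t} \<le> colen (max_upset ^ (N + ?n * t) :: 'n upset)"
      unfolding colen_def
    proof (rule card_mono)
      show "finite (- exps (max_upset ^ (N + ?n * t) :: 'n upset))"
        using cofin_power[OF cofin_max] by (simp add: cofin_def)
      show "{k :: 'n \<Rightarrow> nat. \<forall>j. k j < t} \<subseteq> - exps (max_upset ^ (N + ?n * t))"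
      proof
        fix k :: "'n \<Rightarrow> nat" assume "k \<in> {k. \<forall>j. k j < t}"
        then have "deg k < (\<Sum>j\<in>(UNIV :: 'n set). t)" unfolding deg_def by (intro sum_strict_mono) auto
        then show "k \<in> - exps (max_upset ^ (N + ?n * t))" by (simp add: exps_max_upset_power)
      qed
    qed
    also have "colen (max_upset ^ (N + ?n * t) :: 'n upset) = newt {0} ps (\<lambda>_. ?n * t)"
      using ps(2)[of "\<lambda>_. ?n * t"] by simp
    also have "\<dots> \<le> length ps * Suc (?n * t) ^ (?n - 1)" by (rule up)
    also have "\<dots> \<le> length ps * (Suc ?n * t) ^ (?n - 1)"
      using t1 by (intro mult_le_mono2 power_mono) auto
    also have "\<dots> = length ps * Suc ?n ^ (?n - 1) * t ^ (?n - 1)" by (simp only: power_mult_distrib mult.assoc)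
    finally have "t ^ ?n \<le> length ps * Suc ?n ^ (?n - 1) * t ^ (?n - 1)" by (simp add: card_box)
    moreover have "t ^ ?n = t * t ^ (?n - 1)" by (metis power_eq_if zero_less_card_finite less_irrefl)
    ultimately have "t * t ^ (?n - 1) \<le> length ps * Suc ?n ^ (?n - 1) * t ^ (?n - 1)" by simp
    then have "t \<le> length ps * Suc ?n ^ (?n - 1)" using t1 by (subst (asm) mult_le_cancel2) simp
    then show False by (simp add: t_def)
  qed
  then show ?thesis unfolding E by simp
qed

text \<open>This excludes r = 0, where adding the unit ideal turns every entry into the unit ideal,
  with mixed multiplicity 0. Two uses of monotonicity compare the tuple with the one that consists
  of the maximal ideal only.\<close>

lemma mixed_count_pos:
  fixes J :: "'n::finite upset"
  assumes J: "cofin J" "J \<noteq> 1" and s: "1 \<le> s" and S: "S \<subseteq> {1..CARD('n)}"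
  shows "0 < mixed_count (\<lambda>j. if j \<in> S then J else max_upset ^ s)"
proof -
  let ?M = "max_upset :: 'n upset"
  let ?R = "{1..CARD('n)} - S"
  have T: "cofin (?M ^ s)" "?M ^ s \<noteq> 1" using power_proper[OF max_proper s] by auto
  have "mixed_count (\<lambda>j. if j \<in> S then ?M else ?M ^ s) \<le> mixed_count (\<lambda>j. if j \<in> S then J else ?M ^ s)"
    by (rule mixed_count_mono) (use J T S max_proper proper_iff in auto)
  moreover have "mixed_count (\<lambda>j. if j \<in> S then ?M else ?M ^ s) = mixed_count (\<lambda>j. if j \<in> ?R then ?M ^ s else ?M)"
    by (rule mixed_count_cong) auto
  moreover have "mixed_count (\<lambda>j. if j \<in> ?R then ?M else ?M) \<le> mixed_count (\<lambda>j. if j \<in> ?R then ?M ^ s else ?M)"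
    by (rule mixed_count_mono) (use T max_proper power_max_proper[OF s] in auto)
  ultimately show ?thesis using mixed_count_max_pos[where 'n = 'n] by simp
qed

lemma low_degree_power:
  fixes A :: "'n::finite upset"
  assumes "\<And>a. a \<in> exps A \<Longrightarrow> (\<forall>j. j \<notin> L \<longrightarrow> a j = 0) \<Longrightarrow> \<rho> \<le> deg a"
  shows "a \<in> exps (A ^ s) \<Longrightarrow> (\<forall>j. j \<notin> L \<longrightarrow> a j = 0) \<Longrightarrow> s * \<rho> \<le> deg a"
proof (induction s arbitrary: a)
  case (Suc s)
  then obtain x y where xy: "a = x + y" "x \<in> exps A" "y \<in> exps (A ^ s)" by (auto simp: exps_times)
  have "\<forall>j. j \<notin> L \<longrightarrow> x j = 0" "\<forall>j. j \<notin> L \<longrightarrow> y j = 0" using Suc.prems(2) by (auto simp: xy(1))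
  then have "\<rho> \<le> deg x" "s * \<rho> \<le> deg y" using assms[OF xy(2)] Suc.IH[OF xy(3)] by auto
  then show ?case unfolding xy(1) deg_add by simp
qed simp

text \<open>The entries equal to a power of the maximal ideal are enlarged as well. At r = s \<rho>
  this changes nothing, because \<rho> is at least 1 for a proper ideal. For smaller positive r it
  can only lower the mixed multiplicity, so the strict inequality for the other entries
  persists.\<close>

theorem mixed_count_threshold:
  fixes A :: "'n::finite upset"
  assumes A: "cofin A" "A \<noteq> 1" and i: "i \<in> {1..CARD('n)}" and s: "1 \<le> s"
    and up: "\<And>L. card L = CARD('n) + 1 - i \<Longrightarrow> \<exists>a\<in>exps A. (\<forall>j. j \<notin> L \<longrightarrow> a j = 0) \<and> deg a \<le> \<rho>"
    and L0: "card L0 = CARD('n) + 1 - i"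
      "\<And>a. a \<in> exps A \<Longrightarrow> (\<forall>j. j \<notin> L0 \<longrightarrow> a j = 0) \<Longrightarrow> \<rho> \<le> deg a"
  shows "mixed_count (\<lambda>j. (if j \<le> i then A else max_upset) ^ s) =
      mixed_count (\<lambda>j. (if j \<le> i then A else max_upset) ^ s + max_upset ^ (s * \<rho>))"
    and "r < s * \<rho> \<Longrightarrow> mixed_count (\<lambda>j. (if j \<le> i then A else max_upset) ^ s) \<noteq>
      mixed_count (\<lambda>j. (if j \<le> i then A else max_upset) ^ s + max_upset ^ r)"
proof -
  let ?M = "max_upset :: 'n upset"
  define S where "S = {1..i}"
  define q where "q = CARD('n) - i"
  have S: "S \<subseteq> {1..CARD('n)}" "card S + q = CARD('n)" using i by (auto simp: S_def q_def)
  have q: "CARD('n) + 1 - i = Suc q" using i by (simp add: q_def Suc_diff_le)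
  have J: "cofin (A ^ s)" "A ^ s \<noteq> 1" using A power_proper[OF A(2) s] by auto
  have T: "cofin (?M ^ s)" "?M ^ s \<noteq> 1" using power_proper[OF max_proper s] by auto
  obtain a0 where "a0 \<in> exps A" "deg a0 \<le> \<rho>" using up[OF L0(1)] by blast
  then have \<rho>: "1 \<le> \<rho>" using A(2) unfolding proper_iff by (force simp: exps_max_upset)
  have base: "mixed_count (\<lambda>j. (if j \<le> i then A else ?M) ^ s) = mixed_count (\<lambda>j. if j \<in> S then A ^ s else ?M ^ s)"
    by (rule mixed_count_cong) (auto simp: S_def)
  {
    have sr: "s \<le> s * \<rho>" using \<rho> by simp
    have "?M ^ s + ?M ^ (s * \<rho>) = ?M ^ s"
      by (rule upset_eqI) (use sr exps_power_antimono[OF sr, of ?M] in auto)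
    then have "mixed_count (\<lambda>j. (if j \<le> i then A else ?M) ^ s + ?M ^ (s * \<rho>)) =
        mixed_count (\<lambda>j. if j \<in> S then A ^ s + ?M ^ (s * \<rho>) else ?M ^ s)"
      by (intro mixed_count_cong) (auto simp: S_def)
    moreover have "mixed_count (\<lambda>j. if j \<in> S then A ^ s else ?M ^ s) =
        mixed_count (\<lambda>j. if j \<in> S then A ^ s + ?M ^ (s * \<rho>) else ?M ^ s)"
    proof (rule mixed_count_eq[OF J _ s _ S])
      show "1 \<le> s * \<rho>" using sr s by linarith
      fix L :: "'n set" assume "card L = Suc q"
      then obtain a where a: "a \<in> exps A" "\<forall>j. j \<notin> L \<longrightarrow> a j = 0" "deg a \<le> \<rho>"
        using up[of L] unfolding q by blast
      have "deg (\<lambda>c. s * a c) = s * deg a" by (simp add: deg_def sum_distrib_left)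
      then show "\<exists>a\<in>exps (A ^ s). (\<forall>j. j \<notin> L \<longrightarrow> a j = 0) \<and> deg a \<le> s * \<rho>"
        using scaled_in_power[OF a(1), of s] a(2,3) by (intro bexI[of _ "\<lambda>c. s * a c"]) auto
    qed
    ultimately show "mixed_count (\<lambda>j. (if j \<le> i then A else ?M) ^ s) =
      mixed_count (\<lambda>j. (if j \<le> i then A else ?M) ^ s + ?M ^ (s * \<rho>))" unfolding base by simp
  next
    assume r: "r < s * \<rho>"
    show "mixed_count (\<lambda>j. (if j \<le> i then A else ?M) ^ s) \<noteq>
      mixed_count (\<lambda>j. (if j \<le> i then A else ?M) ^ s + ?M ^ r)"
    proof (cases "r = 0")
      case True
      have "B + 1 = 1" for B :: "'n upset" by (rule upset_eqI) simp
      then have "mixed_count (\<lambda>j. (if j \<le> i then A else ?M) ^ s + ?M ^ r) = 0"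
        using True mixed_count_1[where 'n = 'n] by simp
      then show ?thesis unfolding base using mixed_count_pos[OF J s S(1)] by simp
    next
      case False
      then have r1: "1 \<le> r" by simp
      let ?R = "{1..CARD('n)} - S"
      have Jr: "cofin (A ^ s + ?M ^ r)" "A ^ s + ?M ^ r \<noteq> 1" "cofin (?M ^ s + ?M ^ r)" "?M ^ s + ?M ^ r \<noteq> 1"
        using J T plus_max_proper[OF J(2) r1] plus_max_proper[OF T(2) r1] by auto
      have "mixed_count (\<lambda>j. (if j \<le> i then A else ?M) ^ s + ?M ^ r) =
          mixed_count (\<lambda>j. if j \<in> ?R then ?M ^ s + ?M ^ r else A ^ s + ?M ^ r)"
        by (rule mixed_count_cong) (auto simp: S_def)
      also have "\<dots> \<le> mixed_count (\<lambda>j. if j \<in> ?R then ?M ^ s else A ^ s + ?M ^ r)"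
        by (rule mixed_count_mono) (use J T Jr in auto)
      also have "\<dots> = mixed_count (\<lambda>j. if j \<in> S then A ^ s + ?M ^ r else ?M ^ s)"
        by (rule mixed_count_cong) auto
      also have "\<dots> < mixed_count (\<lambda>j. if j \<in> S then A ^ s else ?M ^ s)"
      proof (rule mixed_count_less[OF J _ r1 s _ S])
        show "card L0 = Suc q" using L0(1) q by simp
        show "Suc r \<le> deg a" if "a \<in> exps (A ^ s)" "\<forall>j. j \<notin> L0 \<longrightarrow> a j = 0" for a
          using low_degree_power[OF L0(2) that] r by simp
      qed
      finally show ?thesis unfolding base by simp
    qed
  }
qed


section \<open>Expansions of germs\<close>

text \<open>Polydiscs suit power series better than balls, because a monomial is bounded by a power
  of the radius on them.\<close>

lemma eventually_polydisc:
  "(\<forall>\<^sub>F x in nhds (0 :: complex ^ 'n::finite). P x) \<longleftrightarrow> (\<exists>\<epsilon>>0. \<forall>x. (\<forall>j. norm (x $ j) \<le> \<epsilon>) \<longrightarrow> P x)"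
proof
  assume "\<forall>\<^sub>F x in nhds (0 :: complex ^ 'n). P x"
  then obtain d where d: "d > 0" "\<And>x. dist x 0 < d \<Longrightarrow> P x" by (auto simp: eventually_nhds_metric)
  define \<epsilon> where "\<epsilon> = d / (2 * real CARD('n))"
  have "\<epsilon> > 0" using d by (simp add: \<epsilon>_def)
  moreover have "P x" if "\<forall>j. norm (x $ j) \<le> \<epsilon>" for x
  proof (rule d(2))
    have "norm x \<le> (\<Sum>j\<in>UNIV. norm (x $ j))" unfolding norm_vec_def by (rule L2_set_le_sum) simp
    also have "\<dots> \<le> (\<Sum>j\<in>(UNIV :: 'n set). \<epsilon>)" by (rule sum_mono) (use that in auto)
    also have "\<dots> = d / 2" by (simp add: \<epsilon>_def)
    finally show "dist x 0 < d" using d(1) by simp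
  qed
  ultimately show "\<exists>\<epsilon>>0. \<forall>x. (\<forall>j. norm (x $ j) \<le> \<epsilon>) \<longrightarrow> P x" by blast
next
  assume "\<exists>\<epsilon>>0. \<forall>x. (\<forall>j. norm (x $ j) \<le> \<epsilon>) \<longrightarrow> P x"
  then obtain \<epsilon> where \<epsilon>: "\<epsilon> > 0" "\<And>x. \<forall>j. norm (x $ j) \<le> \<epsilon> \<Longrightarrow> P x" by blast
  have "P x" if "dist x 0 < \<epsilon>" for x
    using that by (intro \<epsilon>(2)) (auto intro: order_trans[OF Finite_Cartesian_Product.norm_nth_le])
  then show "\<forall>\<^sub>F x in nhds (0 :: complex ^ 'n). P x" using \<epsilon>(1) by (auto simp: eventually_nhds_metric)
qed

text \<open>Absolute convergence at the point with all coordinates \<epsilon>, which implies it on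
  the whole closed polydisc of this radius.\<close>

definition conv_at :: "(('n::finite \<Rightarrow> nat) \<Rightarrow> complex) \<Rightarrow> real \<Rightarrow> bool" where
  "conv_at a \<epsilon> \<longleftrightarrow> 0 < \<epsilon> \<and> (\<lambda>k. norm (a k) * \<epsilon> ^ deg k) summable_on UNIV"

definition conv :: "(('n::finite \<Rightarrow> nat) \<Rightarrow> complex) \<Rightarrow> bool" where
  "conv a \<longleftrightarrow> (\<exists>\<epsilon>. conv_at a \<epsilon>)"

lemma norm_monom_fun: "norm (monom_fun k x) = (\<Prod>j\<in>UNIV. norm (x $ j) ^ k j)"
  by (simp add: monom_fun_def norm_power flip: prod_norm)

lemma norm_monom_fun_le:
  assumes "\<forall>j. norm (x $ j) \<le> \<epsilon>"
  shows "norm (monom_fun k x) \<le> \<epsilon> ^ deg k"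
proof -
  have "norm (monom_fun k x) \<le> (\<Prod>j\<in>UNIV. \<epsilon> ^ k j)"
    unfolding norm_monom_fun using assms by (intro prod_mono) (auto intro!: power_mono)
  then show ?thesis by (simp add: deg_def power_sum)
qed

lemma monom_fun_add: "monom_fun (k + l) x = monom_fun k x * monom_fun l x"
  by (simp add: monom_fun_def power_add prod.distrib)

lemma conv_at_abs_summable:
  assumes "conv_at a \<epsilon>" "\<forall>j. norm (x $ j) \<le> \<epsilon>"
  shows "(\<lambda>k. norm (a k * monom_fun k x)) summable_on UNIV"
proof (rule Infinite_Sum.abs_summable_on_comparison_test')
  show "(\<lambda>k. norm (a k) * \<epsilon> ^ deg k) summable_on UNIV" using assms(1) by (simp add: conv_at_def)
  show "norm (a k * monom_fun k x) \<le> norm (a k) * \<epsilon> ^ deg k" for k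
    unfolding norm_mult by (intro mult_left_mono norm_monom_fun_le assms(2)) simp
qed

lemma conv_at_has_sum:
  assumes "conv_at a \<epsilon>" "\<forall>j. norm (x $ j) \<le> \<epsilon>"
  shows "((\<lambda>k. a k * monom_fun k x) has_sum (\<Sum>\<^sub>\<infinity>k. a k * monom_fun k x)) UNIV"
  using abs_summable_summable[OF conv_at_abs_summable[OF assms]] by (rule has_sum_infsum)

lemma conv_at_mono:
  assumes "conv_at a \<epsilon>" "\<And>k. norm (b k) \<le> C * norm (a k)" "0 < \<delta>" "\<delta> \<le> \<epsilon>"
  shows "conv_at b \<delta>"
  unfolding conv_at_def
proof
  have "(\<lambda>k. C * (norm (a k) * \<epsilon> ^ deg k)) summable_on UNIV"
    using assms(1) by (intro summable_on_cmult_right) (simp add: conv_at_def)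
  then show "(\<lambda>k. norm (b k) * \<delta> ^ deg k) summable_on UNIV"
  proof (rule summable_on_comparison_test)
    fix k
    have "norm (b k) * \<delta> ^ deg k \<le> (C * norm (a k)) * \<epsilon> ^ deg k"
      using assms(2)[of k] assms(3,4) by (intro mult_mono power_mono) (auto intro: order_trans[OF norm_ge_zero])
    then show "norm (b k) * \<delta> ^ deg k \<le> C * (norm (a k) * \<epsilon> ^ deg k)" by (simp add: mult.assoc)
    show "0 \<le> norm (b k) * \<delta> ^ deg k" using assms(3) by simp
  qed
qed fact

lemma conv_mono:
  assumes "conv a" "\<And>k. norm (b k) \<le> C * norm (a k)"
  shows "conv b"
  using assms conv_at_mono[of a _ b C] unfolding conv_def by (metis conv_at_def order_refl)

lemma germ_expansion_abs:
  "germ_expansion (abs_germ f) a \<longleftrightarrow>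
    (\<exists>\<epsilon>>0. \<forall>x. (\<forall>j. norm (x $ j) \<le> \<epsilon>) \<longrightarrow> ((\<lambda>k. a k * monom_fun k x) has_sum f x) UNIV)"
  unfolding germ_expansion.abs_eq eventually_polydisc ..

lemma germ_cases: obtains f where "h = abs_germ f"
proof -
  have "\<exists>f. h = abs_germ f" by (rule germ.abs_induct) blast
  then show ?thesis using that by blast
qed

text \<open>Unordered summability of complex numbers is absolute, so it suffices to evaluate the
  expansion at one point with equal positive coordinates.\<close>

lemma germ_expansion_conv:
  assumes "germ_expansion h a"
  shows "conv a"
proof -
  obtain f where h: "h = abs_germ f" by (rule germ_cases)
  obtain \<epsilon> where \<epsilon>: "\<epsilon> > 0" "\<And>x. (\<forall>j. norm (x $ j) \<le> \<epsilon>) \<Longrightarrow> ((\<lambda>k. a k * monom_fun k x) has_sum f x) UNIV"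
    using assms unfolding h germ_expansion_abs by blast
  define x :: "complex ^ 'a" where "x = (\<chi> j. complex_of_real \<epsilon>)"
  have "(\<lambda>k. a k * monom_fun k x) summable_on UNIV"
    using \<epsilon>(2)[of x] \<epsilon>(1) by (auto simp: x_def summable_on_def)
  then have "(\<lambda>k. norm (a k * monom_fun k x)) summable_on UNIV"
    by (simp add: summable_on_iff_abs_summable_on_complex)
  moreover have "norm (a k * monom_fun k x) = norm (a k) * \<epsilon> ^ deg k" for k
    using \<epsilon>(1) by (simp add: norm_mult norm_monom_fun x_def deg_def power_sum)
  ultimately have "conv_at a \<epsilon>" using \<epsilon>(1) by (simp add: conv_at_def)
  then show ?thesis by (auto simp: conv_def)
qed

definition germ_of :: "(('n::finite \<Rightarrow> nat) \<Rightarrow> complex) \<Rightarrow> 'n germ" where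
  "germ_of a = abs_germ (\<lambda>x. \<Sum>\<^sub>\<infinity>k. a k * monom_fun k x)"

lemma germ_expansion_germ_of: "conv a \<Longrightarrow> germ_expansion (germ_of a) a"
proof -
  assume "conv a"
  then obtain \<epsilon> where \<epsilon>: "conv_at a \<epsilon>" by (auto simp: conv_def)
  then have "0 < \<epsilon>" by (simp add: conv_at_def)
  then show ?thesis
    unfolding germ_of_def germ_expansion_abs using conv_at_has_sum[OF \<epsilon>] by blast
qed

lemma abs_germ_eqI:
  assumes "\<epsilon> > 0" "\<And>x. (\<forall>j. norm (x $ j) \<le> \<epsilon>) \<Longrightarrow> f x = g x"
  shows "abs_germ f = abs_germ g"
  unfolding germ.abs_eq_iff eventually_polydisc using assms by blast

lemma germ_expansion_inj:
  assumes "germ_expansion h a" "germ_expansion h' a"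
  shows "h = h'"
proof -
  obtain f where h: "h = abs_germ f" by (rule germ_cases)
  obtain g where h': "h' = abs_germ g" by (rule germ_cases)
  obtain \<epsilon> where \<epsilon>: "\<epsilon> > 0" "\<And>x. (\<forall>j. norm (x $ j) \<le> \<epsilon>) \<Longrightarrow> ((\<lambda>k. a k * monom_fun k x) has_sum f x) UNIV"
    using assms unfolding h germ_expansion_abs by blast
  obtain \<delta> where \<delta>: "\<delta> > 0" "\<And>x. (\<forall>j. norm (x $ j) \<le> \<delta>) \<Longrightarrow> ((\<lambda>k. a k * monom_fun k x) has_sum g x) UNIV"
    using assms unfolding h' germ_expansion_abs by blast
  show ?thesis unfolding h h'
  proof (rule abs_germ_eqI)
    show "min \<epsilon> \<delta> > 0" using \<epsilon> \<delta> by simp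
    show "f x = g x" if "\<forall>j. norm (x $ j) \<le> min \<epsilon> \<delta>" for x
      using has_sum_unique[OF \<epsilon>(2)[of x] \<delta>(2)[of x]] that by simp
  qed
qed

text \<open>Used to separate all exponents of one degree by a single integer weight.\<close>

lemma digits_unique:
  fixes f g :: "nat \<Rightarrow> nat"
  shows "(\<And>i. i < n \<Longrightarrow> f i < b \<and> g i < b) \<Longrightarrow> (\<Sum>i<n. f i * b ^ i) = (\<Sum>i<n. g i * b ^ i) \<Longrightarrow> i < n \<Longrightarrow> f i = g i"
proof (induction n arbitrary: f g i)
  case (Suc n)
  have e: "(\<Sum>i<Suc n. h i * b ^ i) = h 0 + b * (\<Sum>i<n. h (Suc i) * b ^ i)" for h :: "nat \<Rightarrow> nat"
    by (simp add: sum.lessThan_Suc_shift sum_distrib_left ac_simps del: sum.lessThan_Suc)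
  have eq: "f 0 + b * (\<Sum>i<n. f (Suc i) * b ^ i) = g 0 + b * (\<Sum>i<n. g (Suc i) * b ^ i)"
    using Suc.prems(2) unfolding e .
  have lt: "f 0 < b" "g 0 < b" using Suc.prems(1)[of 0] by auto
  have "f 0 = (f 0 + b * (\<Sum>i<n. f (Suc i) * b ^ i)) mod b" using lt by simp
  also have "\<dots> = g 0" unfolding eq using lt by simp
  finally have 0: "f 0 = g 0" .
  then have "(\<Sum>i<n. f (Suc i) * b ^ i) = (\<Sum>i<n. g (Suc i) * b ^ i)" using eq lt by simp
  then have "f (Suc j) = g (Suc j)" if "j < n" for j
    using Suc.IH[of "\<lambda>i. f (Suc i)" "\<lambda>i. g (Suc i)" j] Suc.prems(1) that by simp
  then show ?case using 0 Suc.prems(3) by (cases i) auto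
qed simp

text \<open>Substituting \<open>x\<^sub>j = t\<^bsup>w j\<^esup>\<close>, for weights \<open>w\<close> under which one exponent of the support has strictly
  smaller weight than all others, isolates its coefficient as \<open>t\<close> tends to 0.\<close>

lemma power_series_zero:
  fixes a :: "('n::finite \<Rightarrow> nat) \<Rightarrow> complex"
  assumes \<epsilon>: "\<epsilon> > 0" "\<And>x. (\<forall>j. norm (x $ j) \<le> \<epsilon>) \<Longrightarrow> ((\<lambda>k. a k * monom_fun k x) has_sum 0) UNIV"
  shows "a k0 = 0"
proof (rule ccontr)
  assume k0: "a k0 \<noteq> 0"
  define d where "d = (LEAST d. \<exists>k. deg k = d \<and> a k \<noteq> 0)"
  have "\<exists>k. deg k = d \<and> a k \<noteq> 0" unfolding d_def by (rule LeastI_ex) (use k0 in blast)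
  then have "{k. deg k = d \<and> a k \<noteq> 0} \<noteq> {}" (is "?S \<noteq> {}") by blast
  have d_le: "d \<le> deg k" if "a k \<noteq> 0" for k unfolding d_def by (rule Least_le) (use that in blast)
  obtain h :: "'n \<Rightarrow> nat" where h: "bij_betw h UNIV {..<CARD('n)}"
    using ex_bij_betw_finite_nat[of "UNIV :: 'n set"] by (auto simp: atLeast0LessThan)
  \<comment> \<open>The coordinates of an exponent of degree d are at most d, so they are the digits
    of a number in base d + 1, and \<phi> is injective in this degree.\<close>
  define \<phi> where "\<phi> k = (\<Sum>j\<in>UNIV. k j * Suc d ^ h j)" for k :: "'n \<Rightarrow> nat"
  have \<phi>_inj: "k = l" if kl: "deg k = d" "deg l = d" "\<phi> k = \<phi> l" for k l
  proof -
    define g where "g = inv_into UNIV h"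
    have g: "g (h j) = j" for j using h by (simp add: g_def bij_betw_def)
    have \<phi>': "\<phi> m = (\<Sum>i<CARD('n). m (g i) * Suc d ^ i)" for m
      unfolding \<phi>_def using sum.reindex_bij_betw[OF h, of "\<lambda>i. m (g i) * Suc d ^ i"] by (simp add: g)
    have "k (g i) = l (g i)" if "i < CARD('n)" for i
    proof (rule digits_unique[of "CARD('n)" "\<lambda>i. k (g i)" "Suc d" "\<lambda>i. l (g i)"])
      show "k (g i) < Suc d \<and> l (g i) < Suc d" for i
        using le_deg[of k "g i"] le_deg[of l "g i"] kl(1,2) by simp
    qed (use kl(3) that in \<open>simp_all only: \<phi>'\<close>)
    moreover have "h j < CARD('n)" for j using h by (auto simp: bij_betw_def)
    ultimately show ?thesis using g by (metis ext)
  qed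
  obtain ks where ks: "deg ks = d" "a ks \<noteq> 0" "\<And>k. deg k = d \<Longrightarrow> a k \<noteq> 0 \<Longrightarrow> \<phi> ks \<le> \<phi> k"
    using ex_has_least_nat[of "\<lambda>k. deg k = d \<and> a k \<noteq> 0" _ \<phi>] \<open>?S \<noteq> {}\<close> by blast
  \<comment> \<open>Q exceeds \<open>\<phi> ks\<close>, so one additional degree outweighs any gain
    in \<phi>. Hence ks is the only exponent of the support with weight at most W.\<close>
  define Q where "Q = Suc (\<phi> ks)"
  define wt where "wt j = Q + Suc d ^ h j" for j
  define W where "W = Q * d + \<phi> ks"
  have wsum: "(\<Sum>j\<in>UNIV. wt j * k j) = Q * deg k + \<phi> k" for k
    by (simp add: wt_def \<phi>_def deg_def sum_distrib_left algebra_simps sum.distrib)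
  have Wlt: "Suc W \<le> Q * deg k + \<phi> k" if "a k \<noteq> 0" "k \<noteq> ks" for k
  proof (cases "deg k = d")
    case True
    then have "\<phi> ks \<noteq> \<phi> k" using \<phi>_inj[of ks k] ks(1) that(2) by auto
    then show ?thesis using ks(3)[OF True that(1)] True by (simp add: W_def)
  next
    case False
    then have "Suc d \<le> deg k" using d_le[OF that(1)] by simp
    then have "Q * Suc d \<le> Q * deg k" by (rule mult_le_mono2)
    then show ?thesis by (simp add: W_def Q_def)
  qed
  define x where "x t = (\<chi> j. complex_of_real (t ^ wt j))" for t :: real
  have mx: "monom_fun k (x t) = complex_of_real (t ^ (Q * deg k + \<phi> k))" for k t
    unfolding wsum[symmetric] by (simp add: monom_fun_def x_def power_sum power_mult flip: of_real_prod of_real_power)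
  define t0 where "t0 = min 1 \<epsilon>"
  have t0: "0 < t0" "t0 \<le> 1" "t0 \<le> \<epsilon>" using \<epsilon>(1) by (auto simp: t0_def)
  have small: "\<forall>j. norm (x t $ j) \<le> \<epsilon>" if "0 < t" "t \<le> t0" for t
  proof
    fix j
    have "wt j = Suc (wt j - 1)" by (simp add: wt_def Q_def)
    then have "t ^ wt j = t * t ^ (wt j - 1)" by (metis power_Suc)
    also have "\<dots> \<le> t * 1" using that t0 by (intro mult_left_mono power_le_one) auto
    finally show "norm (x t $ j) \<le> \<epsilon>" using that t0 by (simp add: x_def norm_power)
  qed
  have sum0: "((\<lambda>k. a k * complex_of_real (t ^ (Q * deg k + \<phi> k))) has_sum 0) UNIV" if "0 < t" "t \<le> t0" for t
    using \<epsilon>(2)[OF small[OF that]] unfolding mx .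
  define N where "N k = norm (a k) * t0 ^ (Q * deg k + \<phi> k)" for k
  have "(\<lambda>k. norm (a k * complex_of_real (t0 ^ (Q * deg k + \<phi> k)))) summable_on UNIV"
    by (rule summable_on_iff_abs_summable_on_complex[THEN iffD1, OF has_sum_imp_summable[OF sum0[OF t0(1) order_refl]]])
  then have N: "N summable_on UNIV" unfolding N_def using t0 by (simp add: norm_mult norm_power)
  define S where "S = infsum N UNIV"
  \<comment> \<open>All terms except the one at ks carry at least W + 1 factors t, hence are bounded
    by a fixed summable family times (t / t0)^(W + 1). Dividing by t^W leaves one factor t.\<close>
  have bound: "norm (a ks) \<le> t * (S / t0 ^ Suc W)" if t: "0 < t" "t \<le> t0" for t
  proof -
    let ?f = "\<lambda>k. a k * complex_of_real (t ^ (Q * deg k + \<phi> k))"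
    have "(?f has_sum (0 - ?f ks)) (UNIV - {ks})"
      using has_sum_Diff[OF sum0[OF t] has_sum_finite[of "{ks}" ?f]] by simp
    then have "norm (0 - ?f ks) \<le> infsum (\<lambda>k. (t / t0) ^ Suc W * N k) (UNIV - {ks})"
    proof (rule norm_infsum_le)
      show "((\<lambda>k. (t / t0) ^ Suc W * N k) has_sum infsum (\<lambda>k. (t / t0) ^ Suc W * N k) (UNIV - {ks})) (UNIV - {ks})"
        by (intro has_sum_infsum summable_on_cmult_right summable_on_subset[OF N]) auto
      fix k assume k: "k \<in> UNIV - {ks}"
      show "norm (?f k) \<le> (t / t0) ^ Suc W * N k"
      proof (cases "a k = 0")
        case False
        let ?e = "Q * deg k + \<phi> k"
        have "(t / t0) ^ ?e \<le> (t / t0) ^ Suc W"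
          using Wlt[OF False] k t t0 by (intro power_decreasing) auto
        then have "t ^ ?e \<le> (t / t0) ^ Suc W * t0 ^ ?e" using t0 by (simp add: power_divide field_simps)
        then have "norm (a k) * t ^ ?e \<le> norm (a k) * ((t / t0) ^ Suc W * t0 ^ ?e)" by (rule mult_left_mono) simp
        then show ?thesis using t by (simp add: norm_mult norm_power N_def ac_simps)
      qed (use t t0 in \<open>simp add: N_def\<close>)
    qed
    also have "\<dots> = (t / t0) ^ Suc W * infsum N (UNIV - {ks})" by (rule infsum_cmult_right')
    also have "\<dots> \<le> (t / t0) ^ Suc W * S"
    proof (rule mult_left_mono)
      show "infsum N (UNIV - {ks}) \<le> S"
        unfolding S_def using N t0
        by (intro infsum_mono_neutral) (auto intro: summable_on_subset simp: N_def)
    qed (use t t0 in simp)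
    finally have "norm (a ks) * t ^ W \<le> (t / t0) ^ Suc W * S"
      using t by (simp add: norm_mult norm_power ks(1) W_def)
    also have "\<dots> = (t * (S / t0 ^ Suc W)) * t ^ W" by (simp add: power_divide)
    finally show ?thesis using t by (simp only: mult_le_cancel_right zero_less_power)
  qed
  have "((\<lambda>t. t * (S / t0 ^ Suc W)) \<longlongrightarrow> 0 * (S / t0 ^ Suc W)) (at_right 0)"
    by (intro tendsto_intros)
  moreover have "\<forall>\<^sub>F t in at_right 0. norm (a ks) \<le> t * (S / t0 ^ Suc W)"
    using eventually_at_right_less[of 0] eventually_at_right_real[OF t0(1)]
    by eventually_elim (use bound in auto)
  ultimately have "norm (a ks) \<le> 0 * (S / t0 ^ Suc W)"
    by (intro tendsto_lowerbound) auto
  then show False using ks(2) by simp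
qed

lemma germ_expansion_unique:
  assumes "germ_expansion h a" "germ_expansion h b"
  shows "a = b"
proof -
  obtain f where h: "h = abs_germ f" by (rule germ_cases)
  obtain \<epsilon> where \<epsilon>: "\<epsilon> > 0" "\<And>x. (\<forall>j. norm (x $ j) \<le> \<epsilon>) \<Longrightarrow> ((\<lambda>k. a k * monom_fun k x) has_sum f x) UNIV"
    using assms unfolding h germ_expansion_abs by blast
  obtain \<delta> where \<delta>: "\<delta> > 0" "\<And>x. (\<forall>j. norm (x $ j) \<le> \<delta>) \<Longrightarrow> ((\<lambda>k. b k * monom_fun k x) has_sum f x) UNIV"
    using assms unfolding h germ_expansion_abs by blast
  have "a k - b k = 0" for k
  proof (rule power_series_zero[of "min \<epsilon> \<delta>" "\<lambda>k. a k - b k"])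
    fix x :: "complex ^ 'a" assume "\<forall>j. norm (x $ j) \<le> min \<epsilon> \<delta>"
    then have "((\<lambda>k. a k * monom_fun k x + (- 1) * (b k * monom_fun k x)) has_sum (f x + (- 1) * f x)) UNIV"
      by (intro has_sum_add has_sum_cmult_right \<epsilon>(2) \<delta>(2)) auto
    then show "((\<lambda>k. (a k - b k) * monom_fun k x) has_sum 0) UNIV" by (simp add: left_diff_distrib)
  qed (use \<epsilon> \<delta> in simp)
  then show ?thesis by auto
qed

lemma germ_coeff_eq: "germ_expansion h a \<Longrightarrow> germ_coeff h = a"
  unfolding germ_coeff_def using germ_expansion_unique by (intro the_equality) auto

section \<open>Sums and products of expansions\<close>

lemma germ_expansion_add:
  assumes "germ_expansion h a" "germ_expansion h' b"
  shows "germ_expansion (germ_add h h') (\<lambda>k. a k + b k)"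
proof -
  obtain f where h: "h = abs_germ f" by (rule germ_cases)
  obtain g where h': "h' = abs_germ g" by (rule germ_cases)
  obtain \<epsilon> where \<epsilon>: "\<epsilon> > 0" "\<And>x. (\<forall>j. norm (x $ j) \<le> \<epsilon>) \<Longrightarrow> ((\<lambda>k. a k * monom_fun k x) has_sum f x) UNIV"
    using assms unfolding h germ_expansion_abs by blast
  obtain \<delta> where \<delta>: "\<delta> > 0" "\<And>x. (\<forall>j. norm (x $ j) \<le> \<delta>) \<Longrightarrow> ((\<lambda>k. b k * monom_fun k x) has_sum g x) UNIV"
    using assms unfolding h' germ_expansion_abs by blast
  show ?thesis unfolding h h' germ_add.abs_eq germ_expansion_abs
  proof (intro exI[of _ "min \<epsilon> \<delta>"] conjI allI impI)
    fix x :: "complex ^ 'a" assume "\<forall>j. norm (x $ j) \<le> min \<epsilon> \<delta>"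
    then have "((\<lambda>k. a k * monom_fun k x + b k * monom_fun k x) has_sum (f x + g x)) UNIV"
      by (intro has_sum_add \<epsilon>(2) \<delta>(2)) auto
    then show "((\<lambda>k. (a k + b k) * monom_fun k x) has_sum (f x + g x)) UNIV" by (simp add: distrib_right)
  qed (use \<epsilon> \<delta> in simp)
qed

text \<open>Both families are absolutely summable, hence so is the family of products, and it may be
  summed iteratively.\<close>

lemma has_sum_times:
  fixes f :: "'a \<Rightarrow> complex" and g :: "'b \<Rightarrow> complex"
  assumes "(f has_sum F) UNIV" "(g has_sum G) UNIV"
  shows "((\<lambda>(i, j). f i * g j) has_sum F * G) (UNIV \<times> UNIV)"
proof -
  have f: "(\<lambda>i. norm (f i)) summable_on UNIV" and g: "(\<lambda>j. norm (g j)) summable_on UNIV"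
    using assms summable_on_iff_abs_summable_on_complex has_sum_imp_summable by blast+
  have "(\<lambda>(i, j). norm (f i) * norm (g j)) summable_on (UNIV \<times> UNIV)"
  proof (rule summable_on_SigmaI)
    show "((\<lambda>j. case (i, j) of (i, j) \<Rightarrow> norm (f i) * norm (g j)) has_sum norm (f i) * infsum (\<lambda>j. norm (g j)) UNIV) UNIV" for i
      using has_sum_cmult_right[OF has_sum_infsum[OF g]] by simp
    show "(\<lambda>i. norm (f i) * infsum (\<lambda>j. norm (g j)) UNIV) summable_on UNIV"
      by (rule summable_on_cmult_left[OF f])
  qed auto
  then have "(\<lambda>p. norm (case p of (i, j) \<Rightarrow> f i * g j)) summable_on (UNIV \<times> UNIV)"
    by (simp add: case_prod_unfold norm_mult)
  then have s: "(\<lambda>(i, j). f i * g j) summable_on (UNIV \<times> UNIV)" by (rule abs_summable_summable)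
  have "infsum (\<lambda>(i, j). f i * g j) (UNIV \<times> UNIV) = (\<Sum>\<^sub>\<infinity>i. \<Sum>\<^sub>\<infinity>j. f i * g j)"
    using infsum_Sigma'_banach[of "\<lambda>i j. f i * g j" UNIV "\<lambda>_. UNIV"] s by simp
  also have "\<dots> = F * G"
    using assms by (simp add: infsum_cmult_right' infsum_cmult_left' infsumI)
  finally show ?thesis using has_sum_infsum[OF s] by simp
qed

definition cauchy :: "(('n \<Rightarrow> nat) \<Rightarrow> complex) \<Rightarrow> (('n \<Rightarrow> nat) \<Rightarrow> complex) \<Rightarrow> ('n \<Rightarrow> nat) \<Rightarrow> complex" where
  "cauchy a b k = (\<Sum>i\<in>{i. i \<le> k}. a i * b (k - i))"

text \<open>The pairs of exponents are regrouped by their sum; each group is finite because only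
  finitely many exponents lie below a given one.\<close>

lemma has_sum_cauchy:
  fixes a b :: "('n::finite \<Rightarrow> nat) \<Rightarrow> complex"
  assumes "((\<lambda>k. a k * monom_fun k x) has_sum F) UNIV" "((\<lambda>k. b k * monom_fun k x) has_sum G) UNIV"
  shows "((\<lambda>k. cauchy a b k * monom_fun k x) has_sum F * G) UNIV"
proof -
  have "((\<lambda>(i, j). (a i * monom_fun i x) * (b j * monom_fun j x)) has_sum F * G) (UNIV \<times> UNIV)"
    by (rule has_sum_times[OF assms])
  also have "?this \<longleftrightarrow> ((\<lambda>(k, i). (a i * b (k - i)) * monom_fun k x) has_sum F * G) (SIGMA k:UNIV. {i. i \<le> k})"
  proof (rule has_sum_reindex_bij_witness[where j = "\<lambda>(i, j). (i + j, i)" and i = "\<lambda>(k, i). (i, k - i)"])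
    show "(case (case p of (i, j) \<Rightarrow> (i + j, i)) of (k, i) \<Rightarrow> (a i * b (k - i)) * monom_fun k x) =
        (case p of (i, j) \<Rightarrow> (a i * monom_fun i x) * (b j * monom_fun j x))" for p
    proof (cases p)
      case (Pair i j)
      have "i + j - i = j" by (auto simp: fun_eq_iff)
      then show ?thesis using Pair by (simp only: prod.case monom_fun_add ac_simps)
    qed
  qed (auto simp: le_fun_def fun_eq_iff)
  finally have "((\<lambda>(k, i). (a i * b (k - i)) * monom_fun k x) has_sum F * G) (SIGMA k:UNIV. {i. i \<le> k})" .
  then show ?thesis
  proof (rule has_sum_SigmaD)
    fix k :: "'n \<Rightarrow> nat"
    have "((\<lambda>i. (a i * b (k - i)) * monom_fun k x) has_sum (\<Sum>i\<in>{i. i \<le> k}. (a i * b (k - i)) * monom_fun k x)) {i. i \<le> k}"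
      by (rule has_sum_finite[OF finite_below_fun])
    then show "((\<lambda>i. case (k, i) of (k, i) \<Rightarrow> (a i * b (k - i)) * monom_fun k x) has_sum cauchy a b k * monom_fun k x) {i. i \<le> k}"
      by (simp add: cauchy_def sum_distrib_right)
  qed
qed

lemma germ_expansion_mult:
  assumes "germ_expansion h a" "germ_expansion h' b"
  shows "germ_expansion (germ_mult h h') (cauchy a b)"
proof -
  obtain f where h: "h = abs_germ f" by (rule germ_cases)
  obtain g where h': "h' = abs_germ g" by (rule germ_cases)
  obtain \<epsilon> where \<epsilon>: "\<epsilon> > 0" "\<And>x. (\<forall>j. norm (x $ j) \<le> \<epsilon>) \<Longrightarrow> ((\<lambda>k. a k * monom_fun k x) has_sum f x) UNIV"
    using assms unfolding h germ_expansion_abs by blast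
  obtain \<delta> where \<delta>: "\<delta> > 0" "\<And>x. (\<forall>j. norm (x $ j) \<le> \<delta>) \<Longrightarrow> ((\<lambda>k. b k * monom_fun k x) has_sum g x) UNIV"
    using assms unfolding h' germ_expansion_abs by blast
  show ?thesis unfolding h h' germ_mult.abs_eq germ_expansion_abs
    by (intro exI[of _ "min \<epsilon> \<delta>"] conjI allI impI has_sum_cauchy \<epsilon>(2) \<delta>(2)) (use \<epsilon> \<delta> in auto)
qed

definition mono_coeff :: "('n \<Rightarrow> nat) \<Rightarrow> ('n \<Rightarrow> nat) \<Rightarrow> complex" where
  "mono_coeff g k = (if k = g then 1 else 0)"

lemma germ_expansion_scaled_monom:
  "germ_expansion (abs_germ (\<lambda>x. c * monom_fun g x)) (\<lambda>k. c * mono_coeff g k)"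
proof -
  have "((\<lambda>k. c * mono_coeff g k * monom_fun k x) has_sum c * monom_fun g x) UNIV" for x
    by (rule has_sum_finite_neutralI[of "{g}"]) (auto simp: mono_coeff_def)
  then show ?thesis unfolding germ_expansion_abs by (intro exI[of _ 1]) auto
qed

lemma germ_expansion_monom: "germ_expansion (abs_germ (monom_fun g)) (mono_coeff g)"
  using germ_expansion_scaled_monom[of 1 g] by simp

lemma monom_fun_0: "monom_fun 0 x = 1"
  by (simp add: monom_fun_def)

lemma germ_expansion_const: "germ_expansion (germ_const c) (\<lambda>k. c * mono_coeff 0 k)"
  using germ_expansion_scaled_monom[of c 0] by (simp add: monom_fun_0 germ_const.abs_eq)


section \<open>Monomial ideals\<close>

lemma germ_subring_simps [simp]:
  "mult (germ_subring L) = germ_mult" "one (germ_subring L) = germ_const 1"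
  "zero (germ_subring L) = germ_const 0" "add (germ_subring L) = germ_add"
  by (simp_all add: germ_subring_def germ_ring_def)

definition supp_in :: "'n set \<Rightarrow> ('n \<Rightarrow> nat) \<Rightarrow> bool" where
  "supp_in L k \<longleftrightarrow> (\<forall>j. j \<notin> L \<longrightarrow> k j = 0)"

lemma supp_in_add: "supp_in L (k + l) \<longleftrightarrow> supp_in L k \<and> supp_in L l"
  by (auto simp: supp_in_def)

lemma supp_in_mono: "supp_in L k \<Longrightarrow> l \<le> k \<Longrightarrow> supp_in L l"
  by (auto simp: supp_in_def le_fun_def) (metis le_zero_eq)

lemma supp_in_0: "supp_in L 0"
  by (simp add: supp_in_def)

text \<open>Setting the coordinates outside L to 0 leaves such a function unchanged and kills every
  monomial not supported on L. Afterwards the condition on representatives can be replaced by one on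
  coefficients.\<close>

lemma carrier_germ_subring:
  "h \<in> carrier (germ_subring L) \<longleftrightarrow> (\<exists>a. germ_expansion h a \<and> (\<forall>k. a k \<noteq> 0 \<longrightarrow> supp_in L k))"
proof
  assume "h \<in> carrier (germ_subring L)"
  then obtain a f where a: "germ_expansion h a" and h: "h = abs_germ f"
    and f: "\<And>x y. (\<forall>j\<in>L. x $ j = y $ j) \<Longrightarrow> f x = f y"
    by (auto simp: germ_subring_def germ_ring_def)
  obtain \<epsilon> where \<epsilon>: "\<epsilon> > 0" "\<And>x. (\<forall>j. norm (x $ j) \<le> \<epsilon>) \<Longrightarrow> ((\<lambda>k. a k * monom_fun k x) has_sum f x) UNIV"
    using a unfolding h germ_expansion_abs by blast
  define b where "b k = (if supp_in L k then a k else 0)" for k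
  have "germ_expansion h b" unfolding h germ_expansion_abs
  proof (intro exI[of _ \<epsilon>] conjI allI impI \<epsilon>(1))
    fix x :: "complex ^ 'a" assume x: "\<forall>j. norm (x $ j) \<le> \<epsilon>"
    define y where "y = (\<chi> j. if j \<in> L then x $ j else 0)"
    have "((\<lambda>k. a k * monom_fun k y) has_sum f y) UNIV"
      by (rule \<epsilon>(2)) (use x \<epsilon>(1) in \<open>auto simp: y_def\<close>)
    moreover have "f y = f x" by (rule f) (simp add: y_def)
    moreover have "a k * monom_fun k y = b k * monom_fun k x" for k
    proof (cases "supp_in L k")
      case True
      have "monom_fun k y = monom_fun k x" unfolding monom_fun_def
        by (rule prod.cong) (use True in \<open>auto simp: y_def supp_in_def\<close>)
      then show ?thesis using True by (simp add: b_def)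
    next
      case False
      then obtain j where "j \<notin> L" "k j \<noteq> 0" by (auto simp: supp_in_def)
      then have "(y $ j) ^ k j = 0" by (simp add: y_def)
      then have "monom_fun k y = 0" unfolding monom_fun_def by (auto simp: prod_zero_iff simp del: power_eq_0_iff)
      then show ?thesis using False by (simp add: b_def)
    qed
    ultimately show "((\<lambda>k. b k * monom_fun k x) has_sum f x) UNIV" by simp
  qed
  then show "\<exists>a. germ_expansion h a \<and> (\<forall>k. a k \<noteq> 0 \<longrightarrow> supp_in L k)"
    by (intro exI[of _ b]) (auto simp: b_def)
next
  assume "\<exists>a. germ_expansion h a \<and> (\<forall>k. a k \<noteq> 0 \<longrightarrow> supp_in L k)"
  then obtain a where a: "germ_expansion h a" "\<And>k. a k \<noteq> 0 \<Longrightarrow> supp_in L k" by blast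
  have h: "h = germ_of a" by (rule germ_expansion_inj[OF a(1) germ_expansion_germ_of[OF germ_expansion_conv[OF a(1)]]])
  have "(\<Sum>\<^sub>\<infinity>k. a k * monom_fun k x) = (\<Sum>\<^sub>\<infinity>k. a k * monom_fun k y)" if xy: "\<forall>j\<in>L. x $ j = y $ j" for x y
  proof (rule infsum_cong)
    fix k
    show "a k * monom_fun k x = a k * monom_fun k y"
    proof (cases "a k = 0")
      case False
      have "monom_fun k x = monom_fun k y" unfolding monom_fun_def
      proof (rule prod.cong[OF refl])
        fix j show "x $ j ^ k j = y $ j ^ k j"
          using xy a(2)[OF False] by (cases "j \<in> L") (auto simp: supp_in_def)
      qed
      then show ?thesis by simp
    qed simp
  qed
  then show "h \<in> carrier (germ_subring L)"
    using a(1) h by (auto simp: germ_subring_def germ_ring_def germ_of_def)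
qed

lemma carrier_expansion:
  assumes "h \<in> carrier (germ_subring L)"
  shows "germ_expansion h (germ_coeff h)" "germ_coeff h k \<noteq> 0 \<Longrightarrow> supp_in L k"
proof -
  obtain a where a: "germ_expansion h a" "\<And>k. a k \<noteq> 0 \<Longrightarrow> supp_in L k"
    using assms unfolding carrier_germ_subring by blast
  have "germ_coeff h = a" by (rule germ_coeff_eq[OF a(1)])
  with a show "germ_expansion h (germ_coeff h)" "germ_coeff h k \<noteq> 0 \<Longrightarrow> supp_in L k" by auto
qed

lemma germ_eqI:
  assumes "h \<in> carrier (germ_subring L)" "h' \<in> carrier (germ_subring L)" "\<And>k. germ_coeff h k = germ_coeff h' k"
  shows "h = h'"
proof -
  have "germ_coeff h = germ_coeff h'" using assms(3) by auto
  with carrier_expansion(1)[OF assms(1)] carrier_expansion(1)[OF assms(2)] show ?thesis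
    using germ_expansion_inj by metis
qed

lemma germ_subring_add:
  assumes "h \<in> carrier (germ_subring L)" "h' \<in> carrier (germ_subring L)"
  shows "germ_add h h' \<in> carrier (germ_subring L)"
    "germ_coeff (germ_add h h') k = germ_coeff h k + germ_coeff h' k"
proof -
  note e = germ_expansion_add[OF carrier_expansion(1)[OF assms(1)] carrier_expansion(1)[OF assms(2)]]
  show "germ_coeff (germ_add h h') k = germ_coeff h k + germ_coeff h' k"
    by (simp add: germ_coeff_eq[OF e])
  show "germ_add h h' \<in> carrier (germ_subring L)"
    unfolding carrier_germ_subring
    using e carrier_expansion(2)[OF assms(1)] carrier_expansion(2)[OF assms(2)]
    by (intro exI[of _ "\<lambda>k. germ_coeff h k + germ_coeff h' k"] conjI allI impI) (auto, metis add.right_neutral)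
qed

lemma cauchy_nonzero:
  assumes "cauchy a b k \<noteq> 0"
  shows "\<exists>i j. k = i + j \<and> a i \<noteq> 0 \<and> b j \<noteq> 0"
proof -
  obtain i where i: "i \<le> k" "a i * b (k - i) \<noteq> 0"
    using assms sum.not_neutral_contains_not_neutral unfolding cauchy_def by (metis (mono_tags, lifting) mem_Collect_eq)
  then show ?thesis using add_diff_fun[OF i(1)] by (metis mult_eq_0_iff)
qed

lemma germ_subring_mult:
  assumes "h \<in> carrier (germ_subring L)" "h' \<in> carrier (germ_subring L)"
  shows "germ_mult h h' \<in> carrier (germ_subring L)"
    "germ_coeff (germ_mult h h') = cauchy (germ_coeff h) (germ_coeff h')"
proof -
  note e = germ_expansion_mult[OF carrier_expansion(1)[OF assms(1)] carrier_expansion(1)[OF assms(2)]]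
  show "germ_coeff (germ_mult h h') = cauchy (germ_coeff h) (germ_coeff h')"
    by (rule germ_coeff_eq[OF e])
  have "supp_in L k" if nz: "cauchy (germ_coeff h) (germ_coeff h') k \<noteq> 0" for k
  proof -
    obtain i j where ij: "k = i + j" "germ_coeff h i \<noteq> 0" "germ_coeff h' j \<noteq> 0"
      using cauchy_nonzero[OF nz] by blast
    show ?thesis unfolding ij(1) supp_in_add
      using carrier_expansion(2)[OF assms(1) ij(2)] carrier_expansion(2)[OF assms(2) ij(3)] by blast
  qed
  then show "germ_mult h h' \<in> carrier (germ_subring L)" unfolding carrier_germ_subring using e by blast
qed

lemma germ_const_subring:
  "germ_const c \<in> carrier (germ_subring L)"
  "germ_coeff (germ_const c) k = (if k = 0 then c else 0)"
proof -
  note e = germ_expansion_const[of c]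
  show "germ_coeff (germ_const c) k = (if k = 0 then c else 0)"
    by (simp add: germ_coeff_eq[OF e] mono_coeff_def)
  show "germ_const c \<in> carrier (germ_subring L)"
    unfolding carrier_germ_subring using e
    by (intro exI[of _ "\<lambda>k. c * mono_coeff 0 k"] conjI) (auto simp: mono_coeff_def supp_in_0 split: if_splits)
qed

lemma germ_of_subring:
  assumes "conv a" "\<forall>k. a k \<noteq> 0 \<longrightarrow> supp_in L k"
  shows "germ_of a \<in> carrier (germ_subring L)" "germ_coeff (germ_of a) = a"
  using germ_expansion_germ_of[OF assms(1)] assms(2) germ_coeff_eq unfolding carrier_germ_subring by blast+

definition mon :: "('n::finite \<Rightarrow> nat) \<Rightarrow> 'n germ" where
  "mon g = abs_germ (monom_fun g)"

lemma mon_subring: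
  "supp_in L g \<Longrightarrow> mon g \<in> carrier (germ_subring L)"
  "germ_coeff (mon g) = mono_coeff g"
proof -
  note e = germ_expansion_monom[of g, folded mon_def]
  show "germ_coeff (mon g) = mono_coeff g" by (rule germ_coeff_eq[OF e])
  show "supp_in L g \<Longrightarrow> mon g \<in> carrier (germ_subring L)"
    unfolding carrier_germ_subring using e
    by (intro exI[of _ "mono_coeff g"] conjI) (auto simp: mono_coeff_def split: if_splits)
qed

lemma mon_add: "germ_mult (mon a) (mon b) = mon (a + b)"
proof -
  have "(\<lambda>x. monom_fun a x * monom_fun b x) = monom_fun (a + b)"
    by (rule ext) (simp only: monom_fun_add)
  then show ?thesis unfolding mon_def germ_mult.abs_eq by (rule arg_cong)
qed

lemma cauchy_mono_coeff: "cauchy (mono_coeff g) d k = (if g \<le> k then d (k - g) else 0)"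
  for k :: "'n::finite \<Rightarrow> nat"
proof -
  have "cauchy (mono_coeff g) d k = (\<Sum>i\<in>{i. i \<le> k}. if i = g then d (k - i) else 0)"
    unfolding cauchy_def by (rule sum.cong) (auto simp: mono_coeff_def)
  then show ?thesis using finite_below_fun[of k] by (simp add: sum.delta)
qed

lemma germ_mult_assoc: "germ_mult (germ_mult f g) h = germ_mult f (germ_mult g h)"
  and germ_mult_commute: "germ_mult f g = germ_mult g f"
  and germ_add_assoc: "germ_add (germ_add f g) h = germ_add f (germ_add g h)"
  and germ_add_commute: "germ_add f g = germ_add g f"
  and germ_one: "germ_mult (germ_const 1) f = f"
  and germ_zero: "germ_add (germ_const 0) f = f"
  and germ_neg: "germ_add (germ_mult (germ_const (- 1)) f) f = germ_const 0"
  and germ_distrib: "germ_mult (germ_add f g) h = germ_add (germ_mult f h) (germ_mult g h)"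
  by (transfer; simp add: algebra_simps)+

lemma cring_germ_subring: "cring (germ_subring L)"
proof (rule cringI)
  show "abelian_group (germ_subring L)"
  proof (rule abelian_groupI)
    fix x assume "x \<in> carrier (germ_subring L)"
    then have "germ_mult (germ_const (- 1)) x \<in> carrier (germ_subring L)"
      by (intro germ_subring_mult germ_const_subring)
    then show "\<exists>y\<in>carrier (germ_subring L). y \<oplus>\<^bsub>germ_subring L\<^esub> x = \<zero>\<^bsub>germ_subring L\<^esub>"
      by (intro bexI[of _ "germ_mult (germ_const (- 1)) x"]) (simp_all add: germ_neg)
  qed (simp_all add: germ_subring_add germ_const_subring germ_zero germ_add_assoc, rule germ_add_commute)
  show "comm_monoid (germ_subring L)"
    by (rule comm_monoidI)
       (simp_all add: germ_subring_mult germ_const_subring germ_one germ_mult_assoc, rule germ_mult_commute)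
qed (simp_all add: germ_distrib)

lemma germ_coeff_minus:
  assumes "h \<in> carrier (germ_subring L)"
  shows "germ_coeff (\<ominus>\<^bsub>germ_subring L\<^esub> h) k = - germ_coeff h k"
proof -
  interpret cring "germ_subring L" by (rule cring_germ_subring)
  have "germ_coeff (h \<oplus>\<^bsub>germ_subring L\<^esub> \<ominus>\<^bsub>germ_subring L\<^esub> h) k = germ_coeff (germ_const 0) k"
    using r_neg[OF assms] by simp
  then show ?thesis
    using germ_subring_add(2)[OF assms a_inv_closed[OF assms], of k] germ_const_subring(2)[of 0 k]
    by (simp add: add_eq_0_iff split: if_splits)
qed

text \<open>The ideal with exponent set A in the ring of germs in the variables of L, given by
  coefficients and not by generators so that membership can be tested term by term.\<close>

definition mideal :: "'n::finite set \<Rightarrow> 'n upset \<Rightarrow> 'n germ set" where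
  "mideal L A = {h \<in> carrier (germ_subring L). \<forall>k. germ_coeff h k \<noteq> 0 \<longrightarrow> k \<in> exps A}"

lemma mideal_carrier: "h \<in> mideal L A \<Longrightarrow> h \<in> carrier (germ_subring L)"
  by (simp add: mideal_def)

lemma mideal_1: "mideal L 1 = carrier (germ_subring L)"
  by (simp add: mideal_def)

lemma mideal_mono: "exps A \<subseteq> exps B \<Longrightarrow> mideal L A \<subseteq> mideal L B"
  by (auto simp: mideal_def)

lemma mideal_add_closed:
  "h \<in> mideal L A \<Longrightarrow> h' \<in> mideal L A \<Longrightarrow> germ_add h h' \<in> mideal L A"
  unfolding mideal_def by (auto simp: germ_subring_add) (metis add.right_neutral)

lemma mideal_mult:
  assumes "h \<in> mideal L A" "h' \<in> mideal L B"
  shows "germ_mult h h' \<in> mideal L (A * B)"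
proof -
  note c = mideal_carrier[OF assms(1)] mideal_carrier[OF assms(2)]
  have "k \<in> exps (A * B)" if k: "germ_coeff (germ_mult h h') k \<noteq> 0" for k
  proof -
    have "cauchy (germ_coeff h) (germ_coeff h') k \<noteq> 0" using k unfolding germ_subring_mult(2)[OF c] .
    from cauchy_nonzero[OF this] obtain i j where
      "k = i + j" "germ_coeff h i \<noteq> 0" "germ_coeff h' j \<noteq> 0" by blast
    then show ?thesis using assms by (auto simp: mideal_def intro: exps_timesI)
  qed
  then show ?thesis using germ_subring_mult(1)[OF c] by (simp add: mideal_def)
qed

lemma ideal_mideal: "ideal (mideal L A) (germ_subring L)"
proof -
  interpret cring "germ_subring L" by (rule cring_germ_subring)
  show ?thesis
  proof (rule idealI)
    show "ring (germ_subring L)" by (rule ring_axioms)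
    show "subgroup (mideal L A) (add_monoid (germ_subring L))"
    proof (rule add.subgroupI)
      show "mideal L A \<subseteq> carrier (germ_subring L)" by (auto simp: mideal_def)
      show "mideal L A \<noteq> {}"
        using germ_const_subring[of 0] by (auto simp: mideal_def intro!: exI[of _ "germ_const 0"])
      show "\<ominus>\<^bsub>germ_subring L\<^esub> a \<in> mideal L A" if "a \<in> mideal L A" for a
        using that by (auto simp: mideal_def germ_coeff_minus)
      show "a \<oplus>\<^bsub>germ_subring L\<^esub> b \<in> mideal L A" if "a \<in> mideal L A" "b \<in> mideal L A" for a b
        using mideal_add_closed[OF that] by simp
    qed
    fix a x assume ax: "a \<in> mideal L A" "x \<in> carrier (germ_subring L)"
    have "germ_mult a x \<in> mideal L (A * 1)"
      by (rule mideal_mult) (use ax mideal_1 in auto)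
    then show "a \<otimes>\<^bsub>germ_subring L\<^esub> x \<in> mideal L A" "x \<otimes>\<^bsub>germ_subring L\<^esub> a \<in> mideal L A"
      by (simp_all add: germ_mult_commute[of x a])
  qed
qed

lemma mon_mideal: "g \<in> exps A \<Longrightarrow> supp_in L g \<Longrightarrow> mon g \<in> mideal L A"
  by (auto simp: mideal_def mon_subring mono_coeff_def split: if_splits)

lemma mon_mideal_iff: "supp_in L g \<Longrightarrow> mon g \<in> mideal L A \<longleftrightarrow> g \<in> exps A"
  by (auto simp: mideal_def mon_subring mono_coeff_def split: if_splits)

text \<open>This is division of a series by a monomial: up to the constant factor from the degree of
  g, the new norms form a part of the old family.\<close>

lemma conv_translate:
  fixes a :: "('n::finite \<Rightarrow> nat) \<Rightarrow> complex"
  assumes "conv a"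
  shows "conv (\<lambda>k. a (k + g))"
proof -
  obtain \<epsilon> where \<epsilon>: "0 < \<epsilon>" "(\<lambda>k. norm (a k) * \<epsilon> ^ deg k) summable_on UNIV"
    using assms by (auto simp: conv_def conv_at_def)
  have inj: "inj (\<lambda>k. k + g)" by (rule injI) (auto simp: fun_eq_iff)
  have "(\<lambda>k. norm (a k) * \<epsilon> ^ deg k) summable_on range (\<lambda>k. k + g)"
    by (rule summable_on_subset[OF \<epsilon>(2)]) simp
  then have "(\<lambda>k. norm (a (k + g)) * \<epsilon> ^ deg (k + g)) summable_on UNIV"
    by (subst (asm) summable_on_reindex[OF inj]) (simp add: o_def)
  then have "(\<lambda>k. norm (a (k + g)) * \<epsilon> ^ deg (k + g) * (1 / \<epsilon> ^ deg g)) summable_on UNIV"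
    by (rule summable_on_cmult_left)
  moreover have "norm (a (k + g)) * \<epsilon> ^ deg (k + g) * (1 / \<epsilon> ^ deg g) = norm (a (k + g)) * \<epsilon> ^ deg k" for k
    unfolding deg_add using \<epsilon>(1) by (simp add: power_add)
  ultimately show ?thesis using \<epsilon>(1) by (auto simp: conv_def conv_at_def)
qed

text \<open>The terms divisible by one generator g are split off and divided by its monomial; the
  quotient still converges, so this part lies in Q. The rest is left to the other generators. In
  this way infinitely many terms are treated with finitely many multiplications.\<close>

lemma ideal_contains_supported:
  fixes h :: "'n::finite germ"
  assumes Q: "ideal Q (germ_subring L)" and "finite G"
    and "\<And>g. g \<in> G \<Longrightarrow> supp_in L g \<Longrightarrow> mon g \<in> Q"
    and "h \<in> carrier (germ_subring L)" "\<And>k. germ_coeff h k \<noteq> 0 \<Longrightarrow> \<exists>g\<in>G. g \<le> k"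
  shows "h \<in> Q"
  using assms(2-)
proof (induction G arbitrary: h rule: finite_induct)
  case empty
  interpret ideal Q "germ_subring L" by (rule Q)
  have "h = germ_const 0"
  proof (rule germ_eqI[OF empty(2) germ_const_subring(1)])
    fix k
    have "germ_coeff h k = 0" using empty(3)[of k] by blast
    then show "germ_coeff h k = germ_coeff (germ_const 0) k" by (simp add: germ_const_subring(2))
  qed
  then show ?case using additive_subgroup.zero_closed[OF is_additive_subgroup] by simp
next
  case (insert g G)
  interpret ideal Q "germ_subring L" by (rule Q)
  let ?a = "germ_coeff h"
  have ca: "conv ?a" by (rule germ_expansion_conv[OF carrier_expansion(1)[OF insert.prems(2)]])
  define b where "b k = (if g \<le> k then ?a k else 0)" for k
  define c where "c k = (if g \<le> k then 0 else ?a k)" for k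
  have conv_b: "conv b" by (rule conv_mono[OF ca, of _ 1]) (simp add: b_def)
  have conv_c: "conv c" by (rule conv_mono[OF ca, of _ 1]) (simp add: c_def)
  have sa: "?a k \<noteq> 0 \<Longrightarrow> supp_in L k" for k by (rule carrier_expansion(2)[OF insert.prems(2)])
  have supp_b: "\<forall>k. b k \<noteq> 0 \<longrightarrow> supp_in L k" and supp_c: "\<forall>k. c k \<noteq> 0 \<longrightarrow> supp_in L k"
    using sa by (auto simp: b_def c_def split: if_splits)
  note gb = germ_of_subring[OF conv_b supp_b] and gc = germ_of_subring[OF conv_c supp_c]
  have h: "h = germ_add (germ_of b) (germ_of c)"
  proof (rule germ_eqI[OF insert.prems(2) germ_subring_add(1)[OF gb(1) gc(1)]])
    fix k show "?a k = germ_coeff (germ_add (germ_of b) (germ_of c)) k"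
      unfolding germ_subring_add(2)[OF gb(1) gc(1)] gb(2) gc(2) by (simp add: b_def c_def)
  qed
  have "germ_of c \<in> Q"
  proof (rule insert.IH)
    show "mon g' \<in> Q" if "g' \<in> G" "supp_in L g'" for g' using insert.prems(1) that by simp
    show "\<exists>g\<in>G. g \<le> k" if "germ_coeff (germ_of c) k \<noteq> 0" for k
      using that insert.prems(3)[of k] unfolding gc(2) by (auto simp: c_def split: if_splits)
  qed (rule gc(1))
  moreover have "germ_of b \<in> Q"
  proof (cases "supp_in L g")
    case True
    define d where "d k = ?a (k + g)" for k
    have conv_d: "conv d" unfolding d_def by (rule conv_translate[OF ca])
    have supp_d: "\<forall>k. d k \<noteq> 0 \<longrightarrow> supp_in L k"
      using sa unfolding d_def by (metis supp_in_add)
    note gd = germ_of_subring[OF conv_d supp_d]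
    have m: "mon g \<in> carrier (germ_subring L)" by (rule mon_subring(1)[OF True])
    have "germ_of b = germ_mult (mon g) (germ_of d)"
    proof (rule germ_eqI[OF gb(1) germ_subring_mult(1)[OF m gd(1)]])
      fix k
      have "k - g + g = k" if "g \<le> k" using add_diff_fun[OF that] by (simp only: add.commute)
      then show "germ_coeff (germ_of b) k = germ_coeff (germ_mult (mon g) (germ_of d)) k"
        unfolding germ_subring_mult(2)[OF m gd(1)] gd(2) gb(2) mon_subring(2) cauchy_mono_coeff
        by (auto simp: b_def d_def)
    qed
    then show ?thesis using I_r_closed[OF insert.prems(1)[OF insertI1 True] gd(1)] by simp
  next
    \<comment> \<open>A generator not supported on L divides no exponent occurring in h, so nothing
      was split off.\<close>
    case False
    have b0: "b k = 0" for k using False sa[of k] supp_in_mono[of L k g] by (auto simp: b_def)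
    have "germ_of b = germ_const 0"
    proof (rule germ_eqI[OF gb(1) germ_const_subring(1)])
      fix k show "germ_coeff (germ_of b) k = germ_coeff (germ_const 0) k"
        unfolding gb(2) germ_const_subring(2) b0 by simp
    qed
    then show ?thesis using additive_subgroup.zero_closed[OF is_additive_subgroup] by simp
  qed
  ultimately show ?case unfolding h using additive_subgroup.a_closed[OF is_additive_subgroup] by fastforce
qed

text \<open>Finitely many monomials of A suffice by Dickson's lemma, although a germ has infinitely
  many terms. This reduces inclusions of monomial ideals in other ideals to a check on
  monomials.\<close>

lemma mideal_subset_ideal:
  assumes "ideal Q (germ_subring L)" "\<And>g. g \<in> exps A \<Longrightarrow> supp_in L g \<Longrightarrow> mon g \<in> Q"
  shows "mideal L A \<subseteq> Q"
proof
  fix h assume h: "h \<in> mideal L A"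
  from up_closed_finite_generators[OF up_closed_exps[of A]]
  obtain G where "finite G \<and> G \<subseteq> exps A \<and> (\<forall>k\<in>exps A. \<exists>g\<in>G. g \<le> k)" ..
  then have G: "finite G" "G \<subseteq> exps A" "\<forall>k\<in>exps A. \<exists>g\<in>G. g \<le> k" by simp_all
  show "h \<in> Q"
  proof (rule ideal_contains_supported[OF assms(1) G(1)])
    show "mon g \<in> Q" if "g \<in> G" "supp_in L g" for g using assms(2)[of g] that G(2) by blast
    show "h \<in> carrier (germ_subring L)" by (rule mideal_carrier[OF h])
    fix k assume "germ_coeff h k \<noteq> 0"
    then have "k \<in> exps A" using h by (simp add: mideal_def)
    then show "\<exists>g\<in>G. g \<le> k" using G(3) by blast
  qed
qed

section \<open>Products, sums and powers of monomial ideals\<close>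

lemma mideal_prod: "ideal_prod (germ_subring L) (mideal L A) (mideal L B) = mideal L (A * B)"
proof
  interpret cring "germ_subring L" by (rule cring_germ_subring)
  show "ideal_prod (germ_subring L) (mideal L A) (mideal L B) \<subseteq> mideal L (A * B)"
  proof
    fix h assume "h \<in> ideal_prod (germ_subring L) (mideal L A) (mideal L B)"
    then show "h \<in> mideal L (A * B)"
      by (induction rule: ideal_prod.induct) (auto intro: mideal_mult mideal_add_closed)
  qed
  show "mideal L (A * B) \<subseteq> ideal_prod (germ_subring L) (mideal L A) (mideal L B)"
  proof (rule mideal_subset_ideal)
    show "ideal (ideal_prod (germ_subring L) (mideal L A) (mideal L B)) (germ_subring L)"
      by (rule ideal_prod_is_ideal[OF ideal_mideal ideal_mideal])
    fix g assume "g \<in> exps (A * B)" "supp_in L g"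
    then obtain a b where ab: "g = a + b" "a \<in> exps A" "b \<in> exps B" by (auto simp: exps_times)
    then have "supp_in L a" "supp_in L b" using \<open>supp_in L g\<close> by (simp_all only: supp_in_add)
    then have "mon a \<otimes>\<^bsub>germ_subring L\<^esub> mon b \<in> ideal_prod (germ_subring L) (mideal L A) (mideal L B)"
      using ab by (intro ideal_prod.prod mon_mideal)
    then show "mon g \<in> ideal_prod (germ_subring L) (mideal L A) (mideal L B)" by (simp add: mon_add ab(1))
  qed
qed

lemma mideal_sum: "mideal L A <+>\<^bsub>germ_subring L\<^esub> mideal L B = mideal L (A + B)"
proof
  interpret cring "germ_subring L" by (rule cring_germ_subring)
  show "mideal L A <+>\<^bsub>germ_subring L\<^esub> mideal L B \<subseteq> mideal L (A + B)"
    using mideal_mono[of A "A + B" L] mideal_mono[of B "A + B" L]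
    by (auto simp: set_add_def set_mult_def intro!: mideal_add_closed)
  show "mideal L (A + B) \<subseteq> mideal L A <+>\<^bsub>germ_subring L\<^esub> mideal L B"
  proof (rule mideal_subset_ideal)
    show "ideal (mideal L A <+>\<^bsub>germ_subring L\<^esub> mideal L B) (germ_subring L)"
      by (rule add_ideals[OF ideal_mideal ideal_mideal])
    fix g assume g: "g \<in> exps (A + B)" "supp_in L g"
    have z: "germ_const 0 \<in> mideal L C" for C
      using additive_subgroup.zero_closed[OF ideal.axioms(1)[OF ideal_mideal]] by simp
    have "mon g = germ_add (mon g) (germ_const 0)" "mon g = germ_add (germ_const 0) (mon g)"
      using germ_zero[of "mon g"] germ_add_commute[of "mon g"] by simp_all
    then show "mon g \<in> mideal L A <+>\<^bsub>germ_subring L\<^esub> mideal L B"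
      using g mon_mideal[of g A L] mon_mideal[of g B L] z[of A] z[of B]
      unfolding set_add_def set_mult_def by auto
  qed
qed

lemma ideals_set_simps [simp]:
  "carrier (ideals_set R) = {I. ideal I R}" "mult (ideals_set R) = ideal_prod R" "one (ideals_set R) = carrier R"
  by (simp_all add: ideals_set_def)

lemma mideal_power: "ideal_power (germ_subring L) (mideal L A) r = mideal L (A ^ r)"
proof -
  interpret cring "germ_subring L" by (rule cring_germ_subring)
  interpret I: comm_monoid "ideals_set (germ_subring L)" by (rule ideals_set_is_comm_monoid)
  show ?thesis
  proof (induction r)
    case 0
    show ?case by (simp add: I.nat_pow_0 mideal_1)
  next
    case (Suc r)
    then show ?case by (simp add: I.nat_pow_Suc mideal_prod mult.commute)
  qed
qed

lemma mideal_finprod: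
  assumes "finite V"
  shows "finprod (ideals_set (germ_subring L)) (\<lambda>j. mideal L (A j)) V = mideal L (\<Prod>j\<in>V. A j)"
proof -
  interpret cring "germ_subring L" by (rule cring_germ_subring)
  interpret I: comm_monoid "ideals_set (germ_subring L)" by (rule ideals_set_is_comm_monoid)
  show ?thesis
    using assms
  proof (induction V rule: finite_induct)
    case empty
    show ?case by (simp add: mideal_1)
  next
    case (insert j V)
    have "finprod (ideals_set (germ_subring L)) (\<lambda>j. mideal L (A j)) (insert j V) =
      mideal L (A j) \<otimes>\<^bsub>ideals_set (germ_subring L)\<^esub> finprod (ideals_set (germ_subring L)) (\<lambda>j. mideal L (A j)) V"
      by (rule I.finprod_insert) (use insert ideal_mideal in auto)
    then show ?case using insert by (simp add: mideal_prod)
  qed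
qed


section \<open>Units, orders and lengths\<close>

text \<open>The coefficients of the inverse series, found by solving the Cauchy product for the
  coefficient of highest degree.\<close>

function inv_coeff :: "(('n::finite \<Rightarrow> nat) \<Rightarrow> complex) \<Rightarrow> ('n \<Rightarrow> nat) \<Rightarrow> complex" where
  "inv_coeff a k = (if k = 0 then 1 / a 0
     else - (\<Sum>i\<in>{i. i \<le> k \<and> i \<noteq> 0}. a i * inv_coeff a (k - i)) / a 0)"
  by pat_completeness auto
termination
proof (relation "Wellfounded.measure (\<lambda>(a, k). deg k)", simp, clarify)
  fix a :: "('n::finite \<Rightarrow> nat) \<Rightarrow> complex" and k i :: "'n \<Rightarrow> nat"
  assume i: "i \<le> k" "i \<noteq> 0"
  have "deg k = deg i + deg (k - i)" using add_diff_fun[OF i(1)] by (metis deg_add)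
  moreover have "0 < deg i" using i(2) by (metis deg_eq_0_iff gr0I)
  ultimately show "((a, k - i), (a, k)) \<in> Wellfounded.measure (\<lambda>(a, k). deg k)" by simp
qed

declare inv_coeff.simps [simp del]

lemma cauchy_inv_coeff:
  fixes a :: "('n::finite \<Rightarrow> nat) \<Rightarrow> complex"
  assumes "a 0 \<noteq> 0"
  shows "cauchy a (inv_coeff a) k = (if k = 0 then 1 else 0)"
proof (cases "k = 0")
  case True
  have "{i. i \<le> (0 :: 'n \<Rightarrow> nat)} = {0}" by (auto simp: le_fun_def fun_eq_iff)
  then show ?thesis using True assms by (simp add: cauchy_def inv_coeff.simps[of a 0])
next
  case False
  have "{i. i \<le> k} = insert 0 {i. i \<le> k \<and> i \<noteq> 0}" by (auto simp: le_fun_def)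
  moreover have "finite {i. i \<le> k \<and> i \<noteq> 0}" by (rule finite_subset[OF _ finite_below_fun[of k]]) auto
  ultimately have "cauchy a (inv_coeff a) k = a 0 * inv_coeff a (k - 0) +
      (\<Sum>i\<in>{i. i \<le> k \<and> i \<noteq> 0}. a i * inv_coeff a (k - i))"
    unfolding cauchy_def by simp
  moreover have "k - 0 = k" by (simp add: fun_eq_iff)
  moreover have "a 0 * inv_coeff a k = - (\<Sum>i\<in>{i. i \<le> k \<and> i \<noteq> 0}. a i * inv_coeff a (k - i))"
    using False assms by (subst inv_coeff.simps) simp
  ultimately show ?thesis using False by simp
qed

lemma inv_coeff_supp:
  fixes a :: "('n::finite \<Rightarrow> nat) \<Rightarrow> complex"
  assumes "\<And>k. a k \<noteq> 0 \<Longrightarrow> supp_in L k"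
  shows "inv_coeff a k \<noteq> 0 \<Longrightarrow> supp_in L k"
proof (induction "deg k" arbitrary: k rule: less_induct)
  case less
  show ?case
  proof (cases "k = 0")
    case True
    then show ?thesis by (simp only: supp_in_0)
  next
    case False
    then have "(\<Sum>i\<in>{i. i \<le> k \<and> i \<noteq> 0}. a i * inv_coeff a (k - i)) \<noteq> 0"
      using less.prems inv_coeff.simps[of a k] by auto
    then obtain i where i: "i \<le> k" "i \<noteq> 0" "a i * inv_coeff a (k - i) \<noteq> 0"
      by (metis (mono_tags, lifting) mem_Collect_eq sum.not_neutral_contains_not_neutral)
    have d: "deg k = deg i + deg (k - i)" using add_diff_fun[OF i(1)] by (metis deg_add)
    have "0 < deg i" using i(2) by (metis deg_eq_0_iff gr0I)
    then have "supp_in L (k - i)" using less.hyps[of "k - i"] d i(3) by simp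
    moreover have "supp_in L i" using assms[of i] i(3) by simp
    ultimately show ?thesis using add_diff_fun[OF i(1)] by (metis supp_in_add)
  qed
qed

text \<open>On a small polydisc the nonconstant terms of \<open>a\<close> have total weight at most half of that of \<open>a 0\<close>; the recursion
  then bounds the partial sums of the inverse series.\<close>

lemma conv_inv_coeff:
  fixes a :: "('n::finite \<Rightarrow> nat) \<Rightarrow> complex"
  assumes "conv a" "a 0 \<noteq> 0"
  shows "conv (inv_coeff a)"
proof -
  obtain \<epsilon>0 where e0: "0 < \<epsilon>0" "(\<lambda>k. norm (a k) * \<epsilon>0 ^ deg k) summable_on UNIV"
    using assms(1) by (auto simp: conv_def conv_at_def)
  define S where "S = infsum (\<lambda>k. norm (a k) * \<epsilon>0 ^ deg k) UNIV"
  have S0: "0 \<le> S" unfolding S_def using e0(1) by (intro infsum_nonneg) simp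
  define \<alpha> where "\<alpha> = norm (a 0)"
  have \<alpha>: "0 < \<alpha>" using assms(2) by (simp add: \<alpha>_def)
  \<comment> \<open>Shrinking the radius by the factor \<theta> multiplies each nonconstant term by
    at most \<theta>, which brings their sum down to \<alpha> / 2.\<close>
  define \<theta> where "\<theta> = min 1 (\<alpha> / (2 * (S + 1)))"
  have \<theta>: "0 < \<theta>" "\<theta> \<le> 1" using \<alpha> S0 by (auto simp: \<theta>_def)
  have \<theta>S: "\<theta> * S \<le> \<alpha> / 2"
  proof -
    have "\<theta> * S \<le> \<alpha> / (2 * (S + 1)) * (S + 1)"
      using \<theta> S0 by (intro mult_mono) (auto simp: \<theta>_def)
    also have "\<dots> = \<alpha> / 2" using S0 by (simp add: field_simps)
    finally show ?thesis .
  qed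
  define \<epsilon> where "\<epsilon> = \<theta> * \<epsilon>0"
  have \<epsilon>: "0 < \<epsilon>" using \<theta> e0 by (simp add: \<epsilon>_def)
  define f where "f k = norm (a k) * \<epsilon> ^ deg k" for k
  define g where "g k = norm (inv_coeff a k) * \<epsilon> ^ deg k" for k
  have f0: "0 \<le> f k" and g0: "0 \<le> g k" for k using \<epsilon> by (simp_all add: f_def g_def)
  have f_sum: "(\<Sum>k\<in>F. f k) \<le> \<alpha> / 2" if F: "finite F" "0 \<notin> F" for F
  proof -
    have "(\<Sum>k\<in>F. f k) \<le> (\<Sum>k\<in>F. \<theta> * (norm (a k) * \<epsilon>0 ^ deg k))"
    proof (rule sum_mono)
      fix k assume "k \<in> F"
      then have "k \<noteq> 0" using F by auto
      then obtain d where d: "deg k = Suc d" by (metis deg_eq_0_iff not0_implies_Suc)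
      have "\<theta> ^ deg k \<le> \<theta>" unfolding d using \<theta> by (simp add: mult_left_le power_le_one)
      then have "norm (a k) * \<epsilon>0 ^ deg k * \<theta> ^ deg k \<le> norm (a k) * \<epsilon>0 ^ deg k * \<theta>"
        using e0(1) by (intro mult_left_mono) auto
      then show "f k \<le> \<theta> * (norm (a k) * \<epsilon>0 ^ deg k)"
        by (simp add: f_def \<epsilon>_def power_mult_distrib ac_simps)
    qed
    also have "\<dots> = \<theta> * (\<Sum>k\<in>F. norm (a k) * \<epsilon>0 ^ deg k)" by (simp add: sum_distrib_left)
    also have "\<dots> \<le> \<theta> * S" unfolding S_def
      using \<theta> e0 F by (intro mult_left_mono finite_sum_le_infsum) auto
    finally show ?thesis using \<theta>S by simp
  qed
  have g_rec: "\<alpha> * g k \<le> (\<Sum>i\<in>{i. i \<le> k \<and> i \<noteq> 0}. f i * g (k - i))" if "k \<noteq> 0" for k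
  proof -
    have "\<alpha> * norm (inv_coeff a k) = norm (\<Sum>i\<in>{i. i \<le> k \<and> i \<noteq> 0}. a i * inv_coeff a (k - i))"
      using that \<alpha> by (subst inv_coeff.simps) (simp add: norm_divide \<alpha>_def)
    also have "\<dots> \<le> (\<Sum>i\<in>{i. i \<le> k \<and> i \<noteq> 0}. norm (a i) * norm (inv_coeff a (k - i)))"
      by (rule order_trans[OF norm_sum]) (simp add: norm_mult)
    finally have "\<alpha> * norm (inv_coeff a k) * \<epsilon> ^ deg k \<le>
        (\<Sum>i\<in>{i. i \<le> k \<and> i \<noteq> 0}. norm (a i) * norm (inv_coeff a (k - i))) * \<epsilon> ^ deg k"
      using \<epsilon> by (intro mult_right_mono) auto
    also have "\<dots> = (\<Sum>i\<in>{i. i \<le> k \<and> i \<noteq> 0}. f i * g (k - i))"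
      unfolding sum_distrib_right
    proof (rule sum.cong[OF refl])
      fix i assume "i \<in> {i. i \<le> k \<and> i \<noteq> 0}"
      then have "deg k = deg i + deg (k - i)" using add_diff_fun[of i k] by (metis deg_add mem_Collect_eq)
      then have "\<epsilon> ^ deg k = \<epsilon> ^ deg i * \<epsilon> ^ deg (k - i)" by (simp only: power_add)
      then show "norm (a i) * norm (inv_coeff a (k - i)) * \<epsilon> ^ deg k = f i * g (k - i)"
        by (simp add: f_def g_def ac_simps)
    qed
    finally show ?thesis by (simp add: g_def mult.assoc)
  qed
  \<comment> \<open>Summing the recursion over all degrees up to d bounds the finite partial sum B
    by 1 / \<alpha> + B / 2, so B can be absorbed.\<close>
  have g_bound: "(\<Sum>k\<in>{k. deg k \<le> d}. g k) \<le> 2 / \<alpha>" for d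
  proof -
    define D where "D = {k :: 'n \<Rightarrow> nat. deg k \<le> d}"
    have finD: "finite D" unfolding D_def by (rule finite_deg_le)
    have 0: "0 \<in> D" by (simp add: D_def)
    define B where "B = (\<Sum>k\<in>D. g k)"
    have "\<alpha> * (\<Sum>k\<in>D - {0}. g k) \<le> (\<Sum>k\<in>D - {0}. \<Sum>i\<in>{i. i \<le> k \<and> i \<noteq> 0}. f i * g (k - i))"
      unfolding sum_distrib_left by (rule sum_mono) (use g_rec in auto)
    also have "\<dots> = (\<Sum>(k, i)\<in>(SIGMA k:D - {0}. {i. i \<le> k \<and> i \<noteq> 0}). f i * g (k - i))"
    proof (rule sum.Sigma)
      show "\<forall>k\<in>D - {0}. finite {i. i \<le> k \<and> i \<noteq> 0}"
        by (auto intro: finite_subset[OF _ finite_below_fun])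
    qed (use finD in auto)
    also have "\<dots> = (\<Sum>p\<in>(\<lambda>(k, i). (i, k - i)) ` (SIGMA k:D - {0}. {i. i \<le> k \<and> i \<noteq> 0}). f (fst p) * g (snd p))"
    proof (subst sum.reindex)
      show "inj_on (\<lambda>(k, i). (i, k - i)) (SIGMA k:D - {0}. {i. i \<le> k \<and> i \<noteq> 0})"
      proof (rule inj_onI)
        fix p q assume "p \<in> (SIGMA k:D - {0}. {i. i \<le> k \<and> i \<noteq> 0})" "q \<in> (SIGMA k:D - {0}. {i. i \<le> k \<and> i \<noteq> 0})"
          "(\<lambda>(k, i). (i, k - i)) p = (\<lambda>(k, i). (i, k - i)) q"
        then obtain k i l where h: "p = (k, i)" "q = (l, i)" "i \<le> k" "i \<le> l" "k - i = l - i" by auto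
        have "k = i + (k - i)" "l = i + (l - i)" using add_diff_fun[OF h(3)] add_diff_fun[OF h(4)] by simp_all
        then show "p = q" using h(1,2,5) by metis
      qed
    qed (simp add: case_prod_unfold)
    also have "\<dots> \<le> (\<Sum>p\<in>(D - {0}) \<times> D. f (fst p) * g (snd p))"
    proof (rule sum_mono2)
      show "(\<lambda>(k, i). (i, k - i)) ` (SIGMA k:D - {0}. {i. i \<le> k \<and> i \<noteq> 0}) \<subseteq> (D - {0}) \<times> D"
      proof
        fix p assume "p \<in> (\<lambda>(k, i). (i, k - i)) ` (SIGMA k:D - {0}. {i. i \<le> k \<and> i \<noteq> 0})"
        then obtain k i where p: "p = (i, k - i)" "k \<in> D" "i \<le> k" "i \<noteq> 0" by auto
        have "k - i \<le> k" by (simp add: le_fun_def)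
        then show "p \<in> (D - {0}) \<times> D"
          using p deg_mono[OF p(3)] deg_mono[of "k - i" k] by (auto simp: D_def)
      qed
    qed (use finD f0 g0 in auto)
    also have "\<dots> = (\<Sum>i\<in>D - {0}. f i) * B"
      by (simp add: B_def sum_product sum.cartesian_product case_prod_unfold)
    also have "\<dots> \<le> \<alpha> / 2 * B"
      using f_sum[of "D - {0}"] finD g0 by (intro mult_right_mono) (auto simp: B_def intro: sum_nonneg)
    finally have 1: "\<alpha> * (\<Sum>k\<in>D - {0}. g k) \<le> \<alpha> / 2 * B" .
    have "g 0 = 1 / \<alpha>" by (simp add: g_def inv_coeff.simps[of a 0] norm_divide \<alpha>_def)
    moreover have "B = g 0 + (\<Sum>k\<in>D - {0}. g k)" unfolding B_def by (rule sum.remove[OF finD 0])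
    ultimately have "\<alpha> * B = 1 + \<alpha> * (\<Sum>k\<in>D - {0}. g k)" using \<alpha> by (simp add: distrib_left)
    then have "\<alpha> * B \<le> 2" using 1 by simp
    then show ?thesis using \<alpha> unfolding B_def D_def by (simp add: field_simps)
  qed
  have "g summable_on UNIV"
  proof (rule nonneg_bdd_above_summable_on)
    show "bdd_above (sum g ` {F. F \<subseteq> UNIV \<and> finite F})"
    proof (rule bdd_aboveI2)
      fix F :: "('n \<Rightarrow> nat) set" assume "F \<in> {F. F \<subseteq> UNIV \<and> finite F}"
      then have F: "finite F" by simp
      define d where "d = (\<Sum>k\<in>F. deg k)"
      have "F \<subseteq> {k. deg k \<le> d}" using F by (auto simp: d_def intro: member_le_sum)
      then have "sum g F \<le> (\<Sum>k\<in>{k. deg k \<le> d}. g k)"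
        using g0 finite_deg_le by (intro sum_mono2) auto
      then show "sum g F \<le> 2 / \<alpha>" using g_bound[of d] by simp
    qed
  qed (rule g0)
  then show ?thesis using \<epsilon> unfolding conv_def conv_at_def g_def by blast
qed

lemma germ_unit:
  assumes h: "h \<in> carrier (germ_subring L)" "germ_coeff h 0 \<noteq> 0"
  shows "\<exists>h'\<in>carrier (germ_subring L). germ_mult h h' = germ_const 1"
proof -
  let ?a = "germ_coeff h"
  have ca: "conv ?a" by (rule germ_expansion_conv[OF carrier_expansion(1)[OF h(1)]])
  have "\<forall>k. inv_coeff ?a k \<noteq> 0 \<longrightarrow> supp_in L k"
    using inv_coeff_supp[of ?a L] carrier_expansion(2)[OF h(1)] by blast
  note i = germ_of_subring[OF conv_inv_coeff[OF ca h(2)] this]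
  have "germ_mult h (germ_of (inv_coeff ?a)) = germ_const 1"
  proof (rule germ_eqI[OF germ_subring_mult(1)[OF h(1) i(1)] germ_const_subring(1)])
    show "germ_coeff (germ_mult h (germ_of (inv_coeff ?a))) k = germ_coeff (germ_const 1) k" for k
      unfolding germ_subring_mult(2)[OF h(1) i(1)] i(2) germ_const_subring(2) by (rule cauchy_inv_coeff[where a = "germ_coeff h", OF h(2)])
  qed
  then show ?thesis using i(1) by blast
qed

section \<open>The maximal ideal and orders of restricted ideals\<close>

lemma mideal_max_iff: "h \<in> mideal L max_upset \<longleftrightarrow> h \<in> carrier (germ_subring L) \<and> germ_coeff h 0 = 0"
  by (auto simp: mideal_def max_upset.rep_eq)

lemma ideal_with_unit:
  assumes "ideal J (germ_subring L)" "h \<in> J" "germ_coeff h 0 \<noteq> 0"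
  shows "J = carrier (germ_subring L)"
proof -
  interpret ideal J "germ_subring L" by (rule assms(1))
  have "h \<in> carrier (germ_subring L)" using assms(2) by (rule Icarr)
  then obtain h' where h': "h' \<in> carrier (germ_subring L)" "germ_mult h h' = germ_const 1"
    using germ_unit assms(3) by blast
  then have "\<one>\<^bsub>germ_subring L\<^esub> \<in> J" using I_r_closed[OF assms(2) h'(1)] by simp
  then show ?thesis by (rule one_imp_carrier)
qed

text \<open>A germ with nonzero constant term is a unit, so every proper ideal consists of germs
  vanishing at 0. This also gives the uniqueness required by the definite description.\<close>

lemma max_ideal_germ_subring: "max_ideal (germ_subring L) = mideal L max_upset"
  unfolding max_ideal_def
proof (rule the_equality)
  have one: "germ_const 1 \<in> carrier (germ_subring L)" "germ_const 1 \<notin> mideal L max_upset"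
    by (simp_all add: germ_const_subring mideal_max_iff)
  show "maximalideal (mideal L max_upset) (germ_subring L)"
  proof (rule maximalidealI[OF ideal_mideal])
    show "carrier (germ_subring L) \<noteq> mideal L max_upset" using one by auto
    fix J assume J: "ideal J (germ_subring L)" "mideal L max_upset \<subseteq> J" "J \<subseteq> carrier (germ_subring L)"
    show "J = mideal L max_upset \<or> J = carrier (germ_subring L)"
    proof (cases "\<exists>h\<in>J. germ_coeff h 0 \<noteq> 0")
      case True
      then show ?thesis using ideal_with_unit[OF J(1)] by blast
    next
      case False
      then have "J \<subseteq> mideal L max_upset" using J(3) by (auto simp: mideal_max_iff)
      then show ?thesis using J(2) by blast
    qed
  qed
  fix M assume M: "maximalideal M (germ_subring L)"
  interpret maximalideal M "germ_subring L" by (rule M)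
  have "M \<subseteq> mideal L max_upset"
  proof
    fix h assume h: "h \<in> M"
    have "germ_coeff h 0 = 0"
      using ideal_with_unit[OF is_ideal h] I_notcarr by blast
    then show "h \<in> mideal L max_upset" using Icarr[OF h] by (simp add: mideal_max_iff)
  qed
  then have "mideal L max_upset = M \<or> mideal L max_upset = carrier (germ_subring L)"
    using I_maximal[OF ideal_mideal] by (auto simp: mideal_def)
  then show "M = mideal L max_upset" using one by blast
qed

text \<open>Two vectors that agree in all coordinates are equal, so every representative qualifies.
  The whole ring is thereby treated together with its subrings.\<close>

lemma germ_subring_UNIV: "germ_subring UNIV = (germ_ring :: 'n::finite germ ring)"
proof -
  have "\<exists>f. h = abs_germ f \<and> (\<forall>x y. (\<forall>j\<in>UNIV. x $ j = y $ j) \<longrightarrow> f x = f y)" for h :: "'n germ"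
  proof -
    obtain f where "h = abs_germ f" by (rule germ_cases)
    moreover have "\<forall>x y. (\<forall>j\<in>UNIV. x $ j = y $ j) \<longrightarrow> f x = f y"
      by (metis UNIV_I vec_eq_iff)
    ultimately show ?thesis by blast
  qed
  then show ?thesis by (simp add: germ_subring_def germ_ring_def)
qed

lemma supp_in_UNIV [simp]: "supp_in UNIV k"
  by (simp add: supp_in_def)

lemma germ_part_expansion:
  assumes h: "h \<in> carrier (germ_subring UNIV)"
  shows "germ_part L h \<in> carrier (germ_subring L)"
    "germ_coeff (germ_part L h) k = (if supp_in L k then germ_coeff h k else 0)"
proof -
  define b where "b k = (if supp_in L k then germ_coeff h k else 0)" for k
  have "conv (germ_coeff h)" by (rule germ_expansion_conv[OF carrier_expansion(1)[OF h]])
  then have conv_b: "conv b" by (rule conv_mono[of _ _ 1]) (simp add: b_def)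
  have supp_b: "\<forall>k. b k \<noteq> 0 \<longrightarrow> supp_in L k" by (simp add: b_def)
  have "(\<Sum>\<^sub>\<infinity>k\<in>{k. \<forall>j. j \<notin> L \<longrightarrow> k j = 0}. germ_coeff h k * monom_fun k x) = (\<Sum>\<^sub>\<infinity>k. b k * monom_fun k x)" for x
    by (rule infsum_cong_neutral) (auto simp: b_def supp_in_def)
  then have g: "germ_part L h = germ_of b" unfolding germ_part_def germ_of_def by simp
  show "germ_part L h \<in> carrier (germ_subring L)" unfolding g by (rule germ_of_subring(1)[OF conv_b supp_b])
  show "germ_coeff (germ_part L h) k = (if supp_in L k then germ_coeff h k else 0)"
    unfolding g germ_of_subring(2)[OF conv_b supp_b] by (rule b_def)
qed

text \<open>Restriction to L retains exactly the terms supported on L: monomials of A supported on L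
  survive unchanged, and no new exponents arise. The order is therefore the least degree of such a
  monomial.\<close>

lemma restricted_ideal_subset_iff:
  "restricted_ideal L (mideal UNIV A) \<subseteq> mideal L (max_upset ^ r) \<longleftrightarrow>
    (\<forall>a\<in>exps A. supp_in L a \<longrightarrow> r \<le> deg a)"
proof
  interpret cring "germ_subring L" by (rule cring_germ_subring)
  have sub: "germ_part L ` mideal UNIV A \<subseteq> carrier (germ_subring L)"
    using germ_part_expansion(1) mideal_carrier by blast
  {
    assume h: "restricted_ideal L (mideal UNIV A) \<subseteq> mideal L (max_upset ^ r)"
    show "\<forall>a\<in>exps A. supp_in L a \<longrightarrow> r \<le> deg a"
    proof (intro ballI impI)
      fix a assume a: "a \<in> exps A" "supp_in L a"
      have m: "mon a \<in> mideal UNIV A" by (rule mon_mideal[OF a(1)]) simp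
      note gp = germ_part_expansion[OF mideal_carrier[OF m], of L]
      have "germ_part L (mon a) = mon a"
        by (rule germ_eqI[OF gp(1) mon_subring(1)[OF a(2)]])
           (use a(2) in \<open>simp add: gp(2) mon_subring(2) mono_coeff_def\<close>)
      moreover have "germ_part L (mon a) \<in> restricted_ideal L (mideal UNIV A)"
        unfolding restricted_ideal_def using genideal_self[OF sub] m by blast
      ultimately have "mon a \<in> mideal L (max_upset ^ r)" using h by auto
      then show "r \<le> deg a" using mon_mideal_iff[OF a(2)] by (simp add: exps_max_upset_power)
    qed
  next
    assume h: "\<forall>a\<in>exps A. supp_in L a \<longrightarrow> r \<le> deg a"
    show "restricted_ideal L (mideal UNIV A) \<subseteq> mideal L (max_upset ^ r)"
      unfolding restricted_ideal_def
    proof (rule genideal_minimal[OF ideal_mideal], rule subsetI)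
      fix g assume "g \<in> germ_part L ` mideal UNIV A"
      then obtain f where f: "f \<in> mideal UNIV A" "g = germ_part L f" by blast
      note gp = germ_part_expansion[OF mideal_carrier[OF f(1)], of L]
      have "r \<le> deg k" if "germ_coeff g k \<noteq> 0" for k
        using that f(1) h unfolding f(2) gp(2) by (auto simp: mideal_def split: if_splits)
      then show "g \<in> mideal L (max_upset ^ r)" using gp(1) by (simp add: mideal_def f(2) exps_max_upset_power)
    qed
  }
qed

lemma ideal_ord_restricted:
  assumes a: "a0 \<in> exps A" "supp_in L a0" and min: "\<And>a. a \<in> exps A \<Longrightarrow> supp_in L a \<Longrightarrow> deg a0 \<le> deg a"
  shows "ideal_ord (germ_subring L) (restricted_ideal L (mideal UNIV A)) = deg a0"
  unfolding ideal_ord_def max_ideal_germ_subring mideal_power restricted_ideal_subset_iff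
  by (rule Greatest_equality) (use a min in auto)

text \<open>An exponent of largest degree outside A may be added, since everything strictly above it
  has larger degree and already lies in A.\<close>

lemma upset_chain:
  fixes A :: "'n::finite upset"
  assumes "cofin A"
  shows "\<exists>U :: nat \<Rightarrow> 'n upset. U 0 = A \<and> (\<forall>j<colen A. exps (U j) \<subset> exps (U (Suc j)))"
  using assms
proof (induction "colen A" arbitrary: A)
  case 0
  show ?case by (intro exI[of _ "\<lambda>_. A"]) (simp flip: 0(1))
next
  case (Suc N)
  have fin: "finite (- exps A)" using Suc.prems by (simp add: cofin_def)
  have "- exps A \<noteq> {}" using Suc.hyps(2) by (auto simp: colen_def)
  then have "Max (deg ` (- exps A)) \<in> deg ` (- exps A)" using fin by (intro Max_in) auto
  then obtain k where k: "k \<notin> exps A" "deg k = Max (deg ` (- exps A))" by auto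
  have kmax: "deg l \<le> deg k" if "l \<notin> exps A" for l
    unfolding k(2) using fin that by (intro Max_ge) auto
  have up: "up_closed (insert k (exps A))"
    unfolding up_closed_def
  proof (intro ballI allI impI)
    fix x l assume x: "x \<in> insert k (exps A)" "x \<le> l"
    show "l \<in> insert k (exps A)"
    proof (cases "x = k")
      case True
      have d: "deg l = deg k + deg (l - k)" using add_diff_fun[of k l] x(2) True by (metis deg_add)
      show ?thesis
      proof (rule ccontr)
        assume n: "l \<notin> insert k (exps A)"
        then have "deg (l - k) = 0" using kmax[of l] d by simp
        then have "l - k = 0" by (simp only: deg_eq_0_iff)
        then have "l = k" using add_diff_fun[of k l] x(2) True by simp
        then show False using n by simp
      qed
    qed (use x exps_up in auto)
  qed
  define A' where "A' = Abs_upset (insert k (exps A))"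
  have eA': "exps A' = insert k (exps A)" unfolding A'_def using up by (simp add: Abs_upset_inverse)
  have cA': "cofin A'" unfolding cofin_def eA' by (rule finite_subset[OF _ fin]) auto
  have "- exps A' = - exps A - {k}" unfolding eA' by auto
  then have "colen A' = N" using Suc.hyps(2) fin k(1) by (simp add: colen_def)
  then obtain U where U: "U 0 = A'" "\<forall>j<N. exps (U j) \<subset> exps (U (Suc j))"
    using Suc.hyps(1)[of A'] cA' by auto
  define U' where "U' j = (case j of 0 \<Rightarrow> A | Suc i \<Rightarrow> U i)" for j
  have "exps (U' j) \<subset> exps (U' (Suc j))" if "j < colen A" for j
  proof (cases j)
    case 0
    then show ?thesis using k(1) by (auto simp: U'_def U(1) eA')
  next
    case (Suc i)
    then show ?thesis using that U(2) Suc.hyps(2) by (simp add: U'_def)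
  qed
  then show ?case by (intro exI[of _ U']) (simp add: U'_def)
qed

lemma ring_length_ge:
  fixes A :: "'n::finite upset"
  assumes I: "ideal I (germ_subring UNIV)" "I \<subseteq> mideal UNIV A" and A: "cofin A"
  shows "enat (colen A) \<le> ring_length (germ_subring UNIV Quot I)"
proof -
  let ?R = "germ_subring UNIV :: 'n germ ring"
  interpret cring ?R by (rule cring_germ_subring)
  interpret I: ideal I ?R by (rule I(1))
  obtain U :: "nat \<Rightarrow> 'n upset" where U: "U 0 = A" "\<And>j. j < colen A \<Longrightarrow> exps (U j) \<subset> exps (U (Suc j))"
    using upset_chain[OF A] by blast
  have U0: "j \<le> colen A \<Longrightarrow> exps A \<subseteq> exps (U j)" for j
  proof (induction j)
    case (Suc j)
    then show ?case using U(2)[of j] by auto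
  qed (simp add: U(1))
  define C where "C j = (+>\<^bsub>?R\<^esub>) I ` mideal UNIV (U j)" for j
  have "ideal (C j) (?R Quot I)" for j
    unfolding C_def by (rule ring_ideal_imp_quot_ideal[OF I(1) ideal_mideal])
  moreover have "C j \<subset> C (Suc j)" if j: "j < colen A" for j
  proof -
    have "C j \<subseteq> C (Suc j)" unfolding C_def using U(2)[OF j] mideal_mono[of "U j" "U (Suc j)"] by blast
    moreover obtain k where k: "k \<in> exps (U (Suc j))" "k \<notin> exps (U j)" using U(2)[OF j] by blast
    have "I +>\<^bsub>?R\<^esub> mon k \<in> C (Suc j)" unfolding C_def using mon_mideal[OF k(1)] by auto
    moreover have "I +>\<^bsub>?R\<^esub> mon k \<notin> C j"
    proof
      assume "I +>\<^bsub>?R\<^esub> mon k \<in> C j"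
      then obtain h where h: "h \<in> mideal UNIV (U j)" "I +>\<^bsub>?R\<^esub> mon k = I +>\<^bsub>?R\<^esub> h" by (auto simp: C_def)
      have "mon k \<in> I +>\<^bsub>?R\<^esub> mon k" by (rule I.a_rcos_self) (simp add: mon_subring)
      then obtain i where i: "i \<in> I" "mon k = germ_add i h"
        unfolding h(2) by (auto simp: a_r_coset_def')
      have "i \<in> mideal UNIV (U j)" using i(1) I(2) mideal_mono[OF U0[of j]] j by auto
      then have "mon k \<in> mideal UNIV (U j)" unfolding i(2) using h(1) by (rule mideal_add_closed)
      then show False using k(2) mon_mideal_iff[of UNIV k "U j"] by simp
    qed
    ultimately show ?thesis by blast
  qed
  ultimately show ?thesis unfolding ring_length_def by (intro SUP_upper) blast
qed

lemma germ_coeff_scale: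
  assumes "h \<in> carrier (germ_subring L)"
  shows "germ_coeff (germ_mult (germ_const c) h) k = c * germ_coeff h k"
proof -
  have "germ_coeff (germ_const c :: 'a germ) i = c * mono_coeff 0 i" for i
    by (simp add: germ_const_subring(2) mono_coeff_def)
  then have "germ_coeff (germ_mult (germ_const c) h) k = c * cauchy (mono_coeff 0) (germ_coeff h) k"
    unfolding germ_subring_mult(2)[OF germ_const_subring(1) assms] cauchy_def by (simp add: sum_distrib_left mult.assoc)
  moreover have "0 \<le> k" "k - 0 = k" by (simp_all add: le_fun_def fun_eq_iff)
  ultimately show ?thesis unfolding cauchy_mono_coeff by simp
qed

text \<open>Gaussian elimination modulo the monomial ideal: multiples of elements of P clear the
  coefficients outside A one after another, in the order given by \<iota>, until an element of
  \<open>mideal UNIV A\<close> is left. Only scalar multiples are used, hence any enumeration serves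
  as the order.\<close>

lemma ideal_eq_of_leading:
  fixes A :: "'n::finite upset" and \<iota> :: "('n \<Rightarrow> nat) \<Rightarrow> nat"
  assumes P: "ideal P (germ_subring UNIV)" "mideal UNIV A \<subseteq> P"
    and P': "ideal P' (germ_subring UNIV)" "P \<subseteq> P'"
    and \<iota>: "bij_betw \<iota> (- exps A) {..<N}"
    and lead: "\<And>s h. s \<notin> exps A \<Longrightarrow> h \<in> P' \<Longrightarrow> germ_coeff h s \<noteq> 0 \<Longrightarrow>
      (\<And>t. t \<notin> exps A \<Longrightarrow> \<iota> t < \<iota> s \<Longrightarrow> germ_coeff h t = 0) \<Longrightarrow>
      \<exists>g\<in>P. germ_coeff g s \<noteq> 0 \<and> (\<forall>t. t \<notin> exps A \<longrightarrow> \<iota> t < \<iota> s \<longrightarrow> germ_coeff g t = 0)"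
  shows "P' \<subseteq> P"
proof -
  interpret P: ideal P "germ_subring UNIV" by (rule P(1))
  interpret P': ideal P' "germ_subring UNIV" by (rule P'(1))
  have add: "germ_add x y \<in> P" if "x \<in> P" "y \<in> P" for x y
    using additive_subgroup.a_closed[OF P.is_additive_subgroup that] by simp
  have add': "germ_add x y \<in> P'" if "x \<in> P'" "y \<in> P'" for x y
    using additive_subgroup.a_closed[OF P'.is_additive_subgroup that] by simp
  have scale: "germ_mult (germ_const c) x \<in> P" if "x \<in> P" for c x
    using P.I_l_closed[OF that germ_const_subring(1)] by simp
  \<comment> \<open>Induction on the number m of final positions where a coefficient may still be
    nonzero.\<close>
  have "h \<in> P" if "h \<in> P'" "\<And>t. t \<notin> exps A \<Longrightarrow> \<iota> t < N - m \<Longrightarrow> germ_coeff h t = 0" for h m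
    using that
  proof (induction m arbitrary: h)
    case 0
    have "germ_coeff h t = 0" if "t \<notin> exps A" for t
      using 0(2)[OF that] \<iota> that by (auto simp: bij_betw_def)
    then have "h \<in> mideal UNIV A" using P'.Icarr[OF 0(1)] by (auto simp: mideal_def)
    then show ?case using P(2) by blast
  next
    case (Suc m)
    show ?case
    proof (cases "N \<le> m")
      case True
      then show ?thesis using Suc by simp
    next
      case False
      then have "N - Suc m \<in> \<iota> ` (- exps A)" using \<iota> by (auto simp: bij_betw_def)
      then obtain s where s: "s \<notin> exps A" "\<iota> s = N - Suc m" by auto
      have below: "\<iota> t < \<iota> s \<or> t = s" if "t \<notin> exps A" "\<iota> t < N - m" for t
      proof -
        have "\<iota> t < \<iota> s \<or> \<iota> t = \<iota> s" using that(2) False s(2) by linarith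
        then show ?thesis using \<iota> that(1) s(1) by (auto simp: bij_betw_def dest: inj_onD)
      qed
      show ?thesis
      proof (cases "germ_coeff h s = 0")
        case True
        show ?thesis
        proof (rule Suc.IH[OF Suc.prems(1)])
          fix t assume "t \<notin> exps A" "\<iota> t < N - m"
          then show "germ_coeff h t = 0" using below Suc.prems(2)[of t] True s(2) by auto
        qed
      next
        case False
        obtain g where g: "g \<in> P" "germ_coeff g s \<noteq> 0"
          "\<And>t. t \<notin> exps A \<Longrightarrow> \<iota> t < \<iota> s \<Longrightarrow> germ_coeff g t = 0"
          using lead[OF s(1) Suc.prems(1) False] Suc.prems(2) s(2) by auto
        define c where "c = germ_coeff h s / germ_coeff g s"
        define h' where "h' = germ_add h (germ_mult (germ_const (- c)) g)"
        note hc = P'.Icarr[OF Suc.prems(1)] and gc = P.Icarr[OF g(1)]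
        have sc: "germ_mult (germ_const d) g \<in> carrier (germ_subring UNIV)" for d
          by (rule germ_subring_mult(1)[OF germ_const_subring(1) gc])
        have co: "germ_coeff h' t = germ_coeff h t - c * germ_coeff g t" for t
          unfolding h'_def germ_subring_add(2)[OF hc sc] germ_coeff_scale[OF gc] by simp
        have "h' \<in> P'" unfolding h'_def using Suc.prems(1) scale[OF g(1)] P'(2) by (intro add') auto
        then have "h' \<in> P"
        proof (rule Suc.IH)
          fix t assume t: "t \<notin> exps A" "\<iota> t < N - m"
          show "germ_coeff h' t = 0"
            using below[OF t] g(2) g(3)[OF t(1)] Suc.prems(2)[OF t(1)] s(2) unfolding co by (auto simp: c_def)
        qed
        moreover have "h = germ_add h' (germ_mult (germ_const c) g)"
        proof (rule germ_eqI[OF hc germ_subring_add(1)[OF P.Icarr[OF \<open>h' \<in> P\<close>] sc]])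
          show "germ_coeff h k = germ_coeff (germ_add h' (germ_mult (germ_const c) g)) k" for k
            unfolding germ_subring_add(2)[OF P.Icarr[OF \<open>h' \<in> P\<close>] sc] germ_coeff_scale[OF gc] co by simp
        qed
        ultimately show ?thesis using add scale[OF g(1)] by metis
      qed
    qed
  qed
  from this[where m = N] show ?thesis by auto
qed

text \<open>Each strict inclusion of ideals above the monomial ideal adds a leading exponent outside
  A, and there are only \<open>colen A\<close> of these.\<close>

lemma ring_length_le:
  fixes A :: "'n::finite upset"
  assumes A: "cofin A"
  shows "ring_length (germ_subring UNIV Quot mideal UNIV A) \<le> enat (colen A)"
  unfolding ring_length_def
proof (rule SUP_least)
  let ?R = "germ_subring UNIV :: 'n germ ring"
  let ?I = "mideal UNIV A"
  interpret cring ?R by (rule cring_germ_subring)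
  interpret I: ideal ?I ?R by (rule ideal_mideal)
  interpret h: ring_hom_ring ?R "?R Quot ?I" "(+>\<^bsub>?R\<^esub>) ?I" by (rule I.rcos_ring_hom_ring)
  fix k assume "k \<in> {k. \<exists>C. (\<forall>j\<le>k. ideal (C j) (?R Quot ?I)) \<and> (\<forall>j<k. C j \<subset> C (Suc j))}"
  then obtain C where C: "\<And>j. j \<le> k \<Longrightarrow> ideal (C j) (?R Quot ?I)" "\<And>j. j < k \<Longrightarrow> C j \<subset> C (Suc j)" by blast
  \<comment> \<open>The chain is pulled back to the ring of germs, where coefficients are
    available.\<close>
  define P where "P j = {r \<in> carrier ?R. ?I +>\<^bsub>?R\<^esub> r \<in> C j}" for j
  have Pid: "ideal (P j) ?R" if "j \<le> k" for j unfolding P_def by (rule h.ideal_vimage[OF C(1)[OF that]])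
  have PI: "?I \<subseteq> P j" if "j \<le> k" for j
  proof
    fix x assume x: "x \<in> ?I"
    have "?I +>\<^bsub>?R\<^esub> x = \<zero>\<^bsub>?R Quot ?I\<^esub>" using I.a_rcos_const[OF x] by (simp add: FactRing_def)
    then have "?I +>\<^bsub>?R\<^esub> x \<in> C j"
      using additive_subgroup.zero_closed[OF ideal.axioms(1)[OF C(1)[OF that]]] by simp
    then show "x \<in> P j" using I.Icarr[OF x] by (simp add: P_def)
  qed
  have Psub: "P j \<subset> P (Suc j)" if j: "j < k" for j
  proof -
    obtain X where X: "X \<in> C (Suc j)" "X \<notin> C j" using C(2)[OF j] by blast
    have "X \<in> carrier (?R Quot ?I)" using ideal.Icarr[OF C(1) X(1)] j by simp
    then obtain r where r: "r \<in> carrier ?R" "X = ?I +>\<^bsub>?R\<^esub> r" by (auto simp: FactRing_def A_RCOSETS_def')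
    then show ?thesis using X C(2)[OF j] by (auto simp: P_def)
  qed
  have fin: "finite (- exps A)" using A by (simp add: cofin_def)
  obtain \<iota> :: "('n \<Rightarrow> nat) \<Rightarrow> nat" where \<iota>: "bij_betw \<iota> (- exps A) {..<colen A}"
    using ex_bij_betw_finite_nat[OF fin] by (auto simp: colen_def atLeast0LessThan)
  define lead where "lead Q = {s \<in> - exps A. \<exists>h\<in>Q. germ_coeff h s \<noteq> 0 \<and>
      (\<forall>t. t \<notin> exps A \<longrightarrow> \<iota> t < \<iota> s \<longrightarrow> germ_coeff h t = 0)}" for Q :: "'n germ set"
  have lead_S: "lead Q \<subseteq> - exps A" for Q by (auto simp: lead_def)
  have lead_fin: "finite (lead Q)" "lead Q \<subseteq> - exps A" for Q
    using finite_subset[OF lead_S fin] lead_S by auto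
  have lead_sub: "lead (P j) \<subset> lead (P (Suc j))" if j: "j < k" for j
  proof -
    have "lead (P j) \<subseteq> lead (P (Suc j))" using Psub[OF j] by (auto simp: lead_def)
    moreover have "\<not> lead (P (Suc j)) \<subseteq> lead (P j)"
    proof
      assume sub: "lead (P (Suc j)) \<subseteq> lead (P j)"
      have "P (Suc j) \<subseteq> P j"
      proof (rule ideal_eq_of_leading[OF Pid PI Pid _ \<iota>])
        fix s h assume h: "s \<notin> exps A" "h \<in> P (Suc j)" "germ_coeff h s \<noteq> 0"
          "\<And>t. t \<notin> exps A \<Longrightarrow> \<iota> t < \<iota> s \<Longrightarrow> germ_coeff h t = 0"
        then have "s \<in> lead (P (Suc j))" by (auto simp: lead_def)
        then have "s \<in> lead (P j)" using sub by blast
        then show "\<exists>g\<in>P j. germ_coeff g s \<noteq> 0 \<and> (\<forall>t. t \<notin> exps A \<longrightarrow> \<iota> t < \<iota> s \<longrightarrow> germ_coeff g t = 0)"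
          by (simp add: lead_def)
      qed (use j Psub[OF j] in auto)
      then show False using Psub[OF j] by blast
    qed
    ultimately show ?thesis by blast
  qed
  have "j \<le> k \<Longrightarrow> j \<le> card (lead (P j))" for j
  proof (induction j)
    case (Suc j)
    then have "card (lead (P j)) < card (lead (P (Suc j)))"
      using lead_sub[of j] lead_fin by (intro psubset_card_mono) auto
    then show ?case using Suc by simp
  qed simp
  then have "k \<le> card (lead (P k))" by simp
  also have "\<dots> \<le> colen A" unfolding colen_def using fin lead_fin by (intro card_mono) auto
  finally show "enat k \<le> enat (colen A)" by simp
qed

lemma ring_length_mideal:
  "cofin A \<Longrightarrow> ring_length (germ_subring UNIV Quot mideal UNIV A) = enat (colen A)"
  using ring_length_le[of A] ring_length_ge[OF ideal_mideal order_refl, of A] by (rule order_antisym)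

text \<open>If infinitely many exponents were missing from A, adding high powers of the maximal
  ideal would produce ideals above I of arbitrarily large finite colength.\<close>

lemma monomial_ideal_finite_colength:
  fixes I :: "'n::finite germ set"
  assumes mono: "monomial_ideal I" and fin: "finite_colength germ_ring I"
  shows "\<exists>A. cofin A \<and> I = mideal UNIV A"
proof -
  let ?R = "germ_subring UNIV :: 'n germ ring"
  interpret cring ?R by (rule cring_germ_subring)
  obtain A0 :: "('n \<Rightarrow> nat) set" where I: "I = Idl\<^bsub>?R\<^esub> (mon ` A0)"
    using mono unfolding monomial_ideal_def mon_def[symmetric] germ_subring_UNIV by blast
  have sub: "mon ` A0 \<subseteq> carrier ?R" by (auto simp: mon_subring)
  have Iid: "ideal I ?R" unfolding I by (rule genideal_ideal[OF sub])
  interpret I: ideal I ?R by (rule Iid)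
  have up: "up_closed {l. \<exists>k\<in>A0. k \<le> l}" unfolding up_closed_def by (auto intro: order_trans)
  define A where "A = Abs_upset {l. \<exists>k\<in>A0. k \<le> l}"
  have eA: "exps A = {l. \<exists>k\<in>A0. k \<le> l}" unfolding A_def using up by (simp add: Abs_upset_inverse)
  have IA: "I \<subseteq> mideal UNIV A" unfolding I
    by (rule genideal_minimal[OF ideal_mideal]) (auto simp: eA intro!: mon_mideal)
  have AI: "mideal UNIV A \<subseteq> I"
  proof (rule mideal_subset_ideal[OF Iid])
    fix g assume "g \<in> exps A"
    then obtain k where k: "k \<in> A0" "k \<le> g" by (auto simp: eA)
    have "mon k \<in> I" unfolding I using genideal_self[OF sub] k(1) by blast
    then have "mon k \<otimes>\<^bsub>?R\<^esub> mon (g - k) \<in> I" by (rule I.I_r_closed) (simp add: mon_subring)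
    then show "mon g \<in> I" unfolding germ_subring_simps mon_add add_diff_fun[OF k(2)] .
  qed
  have "cofin A"
  proof (rule ccontr)
    assume "\<not> cofin A"
    then have inf: "infinite (- exps A)" by (simp add: cofin_def)
    obtain N where N: "ring_length (?R Quot I) = enat N"
      using fin unfolding finite_colength_def germ_subring_UNIV by auto
    obtain F where F: "finite F" "card F = Suc N" "F \<subseteq> - exps A"
      using infinite_arbitrarily_large[OF inf] by blast
    \<comment> \<open>Beyond the degrees of all exponents in F, so that the enlarged ideal B still
      misses them.\<close>
    define t where "t = Suc (\<Sum>k\<in>F. deg k)"
    define B where "B = A + max_upset ^ t"
    have cB: "cofin B" unfolding B_def by (subst add.commute) auto
    have "F \<subseteq> - exps B"
    proof
      fix k assume k: "k \<in> F"
      then have "deg k \<le> (\<Sum>k\<in>F. deg k)" using F(1) by (intro member_le_sum) auto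
      then have "deg k < t" by (simp add: t_def)
      then show "k \<in> - exps B" using k F(3) by (auto simp: B_def exps_max_upset_power)
    qed
    then have "Suc N \<le> colen B" unfolding colen_def F(2)[symmetric] using cB by (intro card_mono) (simp add: cofin_def)
    moreover have "enat (colen B) \<le> enat N" unfolding N[symmetric]
    proof (rule ring_length_ge[OF Iid _ cB])
      show "I \<subseteq> mideal UNIV B" using IA mideal_mono[of A B UNIV] by (auto simp: B_def)
    qed
    ultimately show False by simp
  qed
  then show ?thesis using IA AI by blast
qed


section \<open>Polynomials and the main result\<close>

definition mono_eval :: "(nat \<Rightarrow>\<^sub>0 nat) \<Rightarrow> (nat \<Rightarrow> nat) \<Rightarrow> rat" where
  "mono_eval m r = (\<Prod>j\<in>Poly_Mapping.keys m. of_nat (r j) ^ Poly_Mapping.lookup m j)"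

lemma mono_eval_superset:
  assumes "finite V" "Poly_Mapping.keys m \<subseteq> V"
  shows "mono_eval m r = (\<Prod>j\<in>V. of_nat (r j) ^ Poly_Mapping.lookup m j)"
  unfolding mono_eval_def
  by (rule prod.mono_neutral_left) (use assms in \<open>auto simp: in_keys_iff\<close>)

lemma mpoly_eval_add: "mpoly_eval (P + Q) r = mpoly_eval P r + mpoly_eval Q r"
  unfolding mpoly_eval_def
  by (rule setsum_keys_plus_distrib) (simp_all add: distrib_right)

lemma mpoly_eval_single: "mpoly_eval (Poly_Mapping.single m c) r = c * mono_eval m r"
  by (simp add: mpoly_eval_def mono_eval_def)

text \<open>A predicate on functions, so that closure properties can be used without writing down
  the coefficients of a product.\<close>

definition is_mpoly :: "nat \<Rightarrow> nat \<Rightarrow> ((nat \<Rightarrow> nat) \<Rightarrow> rat) \<Rightarrow> bool" where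
  "is_mpoly n d f \<longleftrightarrow> (\<exists>P. mpoly_vars_degree_le n d P \<and> (\<forall>r. mpoly_eval P r = f r))"

lemma is_mpoly_mono: "is_mpoly n d f \<Longrightarrow> d \<le> d' \<Longrightarrow> is_mpoly n d' f"
  unfolding is_mpoly_def mpoly_vars_degree_le_def by (meson order_trans)

lemma is_mpoly_add:
  assumes "is_mpoly n d f" "is_mpoly n d g"
  shows "is_mpoly n d (\<lambda>r. f r + g r)"
proof -
  obtain P Q where "mpoly_vars_degree_le n d P" "\<forall>r. mpoly_eval P r = f r"
    and "mpoly_vars_degree_le n d Q" "\<forall>r. mpoly_eval Q r = g r"
    using assms unfolding is_mpoly_def by blast
  then have "mpoly_vars_degree_le n d (P + Q)" "\<forall>r. mpoly_eval (P + Q) r = f r + g r"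
    using keys_add[of P Q] unfolding mpoly_vars_degree_le_def mpoly_eval_add by (blast, simp)
  then show ?thesis unfolding is_mpoly_def by blast
qed

lemma is_mpoly_single:
  assumes "Poly_Mapping.keys m \<subseteq> {1..n}" "(\<Sum>j\<in>{1..n}. Poly_Mapping.lookup m j) \<le> d"
  shows "is_mpoly n d (\<lambda>r. c * mono_eval m r)"
proof -
  have "(\<Sum>j\<in>Poly_Mapping.keys m. Poly_Mapping.lookup m j) \<le> (\<Sum>j\<in>{1..n}. Poly_Mapping.lookup m j)"
    using assms(1) by (intro sum_mono2) auto
  then have "mpoly_vars_degree_le n d (Poly_Mapping.single m c)"
    using assms by (auto simp: mpoly_vars_degree_le_def)
  then show ?thesis unfolding is_mpoly_def using mpoly_eval_single by blast
qed

lemma is_mpoly_const: "is_mpoly n d (\<lambda>r. c)"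
  using is_mpoly_single[of 0 n d c] by (simp add: mono_eval_def)

lemma is_mpoly_sum:
  "finite S \<Longrightarrow> (\<And>m. m \<in> S \<Longrightarrow> is_mpoly n d (f m)) \<Longrightarrow> is_mpoly n d (\<lambda>r. \<Sum>m\<in>S. f m r)"
  by (induction S rule: finite_induct) (simp_all add: is_mpoly_const is_mpoly_add)

lemma sum_lookup_keys:
  fixes m :: "nat \<Rightarrow>\<^sub>0 nat"
  assumes "Poly_Mapping.keys m \<subseteq> {1..n}"
  shows "(\<Sum>j\<in>Poly_Mapping.keys m. Poly_Mapping.lookup m j) = (\<Sum>j\<in>{1..n}. Poly_Mapping.lookup m j)"
  by (rule sum.mono_neutral_left) (use assms in \<open>auto simp: in_keys_iff\<close>)

lemma is_mpoly_linear:
  assumes f: "is_mpoly n d f" and j: "j \<in> {1..n}"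
  shows "is_mpoly n (Suc d) (\<lambda>r. f r * (a * of_nat (r j) + b))"
proof -
  obtain P where P: "mpoly_vars_degree_le n d P" "\<And>r. mpoly_eval P r = f r"
    using f unfolding is_mpoly_def by blast
  let ?s = "Poly_Mapping.single j (1::nat)" and ?c = "Poly_Mapping.lookup P"
  have m: "Poly_Mapping.keys m \<subseteq> {1..n}" "(\<Sum>j\<in>{1..n}. Poly_Mapping.lookup m j) \<le> d"
    if "m \<in> Poly_Mapping.keys P" for m
    using P(1) that sum_lookup_keys[of m n] by (auto simp: mpoly_vars_degree_le_def)
  have k: "Poly_Mapping.keys (m + ?s) \<subseteq> {1..n}" if "m \<in> Poly_Mapping.keys P" for m
    using m(1)[OF that] keys_add[of m ?s] j by auto
  have e: "mono_eval (m + ?s) r = mono_eval m r * of_nat (r j)" if mP: "m \<in> Poly_Mapping.keys P" for m r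
  proof -
    have "(\<Prod>i\<in>{1..n}. (of_nat (r i) :: rat) ^ Poly_Mapping.lookup ?s i) =
        (\<Prod>i\<in>{1..n}. if i = j then of_nat (r i) else 1)"
      by (rule prod.cong) (auto simp: lookup_single)
    also have "\<dots> = of_nat (r j)" using j by simp
    finally show ?thesis
      using mono_eval_superset[OF _ k[OF mP], of r] mono_eval_superset[OF _ m(1)[OF mP], of r]
      by (simp add: lookup_add power_add prod.distrib)
  qed
  have s: "(\<Sum>i\<in>{1..n}. Poly_Mapping.lookup (m + ?s) i) \<le> Suc d" if mP: "m \<in> Poly_Mapping.keys P" for m
  proof -
    have "(\<Sum>i\<in>{1..n}. Poly_Mapping.lookup ?s i) = (\<Sum>i\<in>{1..n}. if i = j then 1 else 0)"
      by (rule sum.cong) (auto simp: lookup_single)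
    also have "\<dots> = 1" using j by simp
    finally show ?thesis using m(2)[OF mP] by (simp add: lookup_add sum.distrib)
  qed
  have "f r * (a * of_nat (r j) + b) = (\<Sum>m\<in>Poly_Mapping.keys P.
      (?c m * a) * mono_eval (m + ?s) r + (?c m * b) * mono_eval m r)" for r
  proof -
    have "f r = (\<Sum>m\<in>Poly_Mapping.keys P. ?c m * mono_eval m r)"
      unfolding P(2)[symmetric] mpoly_eval_def mono_eval_def ..
    then show ?thesis
      by (simp only: sum_distrib_right) (rule sum.cong[OF refl], simp only: e, simp add: algebra_simps)
  qed
  moreover have "is_mpoly n (Suc d) (\<lambda>r. \<Sum>m\<in>Poly_Mapping.keys P.
      (?c m * a) * mono_eval (m + ?s) r + (?c m * b) * mono_eval m r)"
  proof (rule is_mpoly_sum)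
    fix m assume mP: "m \<in> Poly_Mapping.keys P"
    show "is_mpoly n (Suc d) (\<lambda>r. (?c m * a) * mono_eval (m + ?s) r + (?c m * b) * mono_eval m r)"
      using is_mpoly_single[OF k[OF mP] s[OF mP]] is_mpoly_single[OF m(1)[OF mP]] m(2)[OF mP]
      by (intro is_mpoly_add) auto
  qed simp
  ultimately show ?thesis by simp
qed

text \<open>Each step in k contributes one linear factor. The generalised binomial is polynomial in
  r also where r j < c, in contrast to one formed with truncated subtraction.\<close>

lemma is_mpoly_gchoose:
  assumes f: "is_mpoly n d f" and j: "j \<in> {1..n}"
  shows "is_mpoly n (d + k) (\<lambda>r. f r * ((of_nat (r j) - c) gchoose k))"
proof (induction k)
  case (Suc k)
  have "((of_nat (r j) - c) gchoose Suc k) =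
      ((of_nat (r j) - c) gchoose k) * (inverse (of_nat (Suc k)) * of_nat (r j) + - (c + of_nat k) / of_nat (Suc k))"
    for r :: "nat \<Rightarrow> nat"
    using gbinomial_absorb_comp[of "of_nat (r j) - c" k] gbinomial_absorption[of k "of_nat (r j) - c"]
    by (simp add: field_simps del: of_nat_Suc)
  then show ?case using is_mpoly_linear[OF Suc.IH j, of "inverse (of_nat (Suc k))" "- (c + of_nat k) / of_nat (Suc k)"]
    by (simp add: mult.assoc)
qed (use f in simp)

lemma is_mpoly_prod_gchoose:
  assumes "V \<subseteq> {1..n}"
  shows "is_mpoly n (\<Sum>j\<in>V. p j) (\<lambda>r. \<Prod>j\<in>V. ((of_nat (r j) - c) gchoose p j))"
proof -
  have "finite V" using assms finite_subset by blast
  then show ?thesis using assms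
  proof (induction V rule: finite_induct)
    case (insert j V)
    then show ?case
      using is_mpoly_gchoose[of n "sum p V" "\<lambda>r. \<Prod>j\<in>V. ((of_nat (r j) - c) gchoose p j)" j "p j" c]
      by (simp add: add.commute mult.commute)
  qed (simp add: is_mpoly_const)
qed

text \<open>The passage from the shifted variable x back to r = N + x takes place inside the
  polynomial, over the rationals.\<close>

lemma mpoly_of_newt:
  assumes "\<forall>p\<in>set ps. (\<Sum>j\<in>{1..n}. p j) \<le> d"
  shows "\<exists>P. mpoly_vars_degree_le n d P \<and>
    (\<forall>x. mpoly_eval P (\<lambda>j. N + x j) = of_nat (newt {1..n} ps x))"
proof -
  have "is_mpoly n d (\<lambda>r. \<Sum>p\<leftarrow>ps. \<Prod>j\<in>{1..n}. ((of_nat (r j) - of_nat N) gchoose p j))"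
    using assms
  proof (induction ps)
    case (Cons p ps)
    have "is_mpoly n d (\<lambda>r. \<Prod>j\<in>{1..n}. ((of_nat (r j) - of_nat N) gchoose p j))"
      by (rule is_mpoly_mono[OF is_mpoly_prod_gchoose]) (use Cons.prems in auto)
    then show ?case using is_mpoly_add Cons by simp
  qed (simp add: is_mpoly_const)
  then obtain P where P: "mpoly_vars_degree_le n d P"
    "\<And>r. mpoly_eval P r = (\<Sum>p\<leftarrow>ps. \<Prod>j\<in>{1..n}. ((of_nat (r j) - of_nat N) gchoose p j))"
    unfolding is_mpoly_def by blast
  have "mpoly_eval P (\<lambda>j. N + x j) = of_nat (newt {1..n} ps x)" for x
    unfolding P(2) by (induction ps) (simp_all add: binomial_gbinomial)
  then show ?thesis using P(1) by blast
qed

section \<open>Coefficients from iterated differences\<close>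

lemma fdiff_add: "fdiff j (\<lambda>x. f x + g x) = (\<lambda>x. fdiff j f x + fdiff j g x)"
  by (auto simp: fdiff_def)

lemma iter_diff_add: "iter_diff js (\<lambda>x. f x + g x) y = iter_diff js f y + iter_diff js g y"
  by (induction js arbitrary: f g) (simp_all add: fdiff_add)

lemma iter_diff_sum: "iter_diff js (\<lambda>x. \<Sum>m\<in>S. f m x) y = (\<Sum>m\<in>S. iter_diff js (f m) y)"
  by (induction S rule: infinite_finite_induct) (simp_all add: iter_diff_0 iter_diff_add)

lemma iter_diff_scale: "iter_diff js (\<lambda>x. c * f x) y = c * iter_diff js f (y :: nat \<Rightarrow> nat)" for c :: "'a::comm_ring_1"
proof -
  have "fdiff j (\<lambda>x. c * f x) = (\<lambda>x. c * fdiff j f x)" for j and f :: "(nat \<Rightarrow> nat) \<Rightarrow> 'a"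
    by (auto simp: fdiff_def right_diff_distrib)
  then show ?thesis by (induction js arbitrary: f) simp_all
qed

lemma iter_diff_of_int: "iter_diff js (\<lambda>x. of_int (f x)) y = (of_int (iter_diff js f y) :: 'a::ring_1)"
proof -
  have "fdiff j (\<lambda>x. of_int (f x) :: 'a) = (\<lambda>x. of_int (fdiff j f x))" for j and f :: "(nat \<Rightarrow> nat) \<Rightarrow> int"
    by (auto simp: fdiff_def)
  then show ?thesis by (induction js arbitrary: f) simp_all
qed

text \<open>Differences in distinct directions act on distinct factors.\<close>

lemma iter_diff_prod:
  fixes g :: "nat \<Rightarrow> nat \<Rightarrow> 'a::comm_ring_1"
  assumes "finite V" "set js \<subseteq> V" "distinct js"
  shows "iter_diff js (\<lambda>r. \<Prod>j\<in>V. g j (r j)) r =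
    (\<Prod>j\<in>V. if j \<in> set js then g j (Suc (r j)) - g j (r j) else g j (r j))"
  using assms(2,3)
proof (induction js arbitrary: g)
  case (Cons j js)
  define h where "h = g(j := (\<lambda>x. g j (Suc x) - g j x))"
  have j: "j \<in> V" using Cons.prems by simp
  have "fdiff j (\<lambda>r. \<Prod>j\<in>V. g j (r j)) r = (\<Prod>j\<in>V. h j (r j))" for r
  proof -
    have 1: "(\<Prod>i\<in>V - {j}. g i ((r(j := Suc (r j))) i)) = (\<Prod>i\<in>V - {j}. g i (r i))"
      "(\<Prod>i\<in>V - {j}. h i (r i)) = (\<Prod>i\<in>V - {j}. g i (r i))"
      by (auto intro!: prod.cong simp: h_def)
    show ?thesis
      unfolding fdiff_def prod.remove[OF assms(1) j] 1 by (simp add: h_def left_diff_distrib)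
  qed
  then have "fdiff j (\<lambda>r. \<Prod>j\<in>V. g j (r j)) = (\<lambda>r. \<Prod>j\<in>V. h j (r j))" by (rule ext)
  then have "iter_diff (j # js) (\<lambda>r. \<Prod>j\<in>V. g j (r j)) r = iter_diff js (\<lambda>r. \<Prod>j\<in>V. h j (r j)) r"
    by (simp only: iter_diff.simps)
  also have "\<dots> = (\<Prod>i\<in>V. if i \<in> set js then h i (Suc (r i)) - h i (r i) else h i (r i))"
    by (rule Cons.IH) (use Cons.prems in auto)
  also have "\<dots> = (\<Prod>i\<in>V. if i \<in> set (j # js) then g i (Suc (r i)) - g i (r i) else g i (r i))"
    by (rule prod.cong) (use Cons.prems in \<open>auto simp: h_def\<close>)
  finally show ?case .
qed simp

lemma exponents_eq_one:
  fixes e :: "nat \<Rightarrow> nat"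
  assumes "(\<Sum>j\<in>{1..n}. e j) \<le> n" "\<And>j. j \<in> {1..n} \<Longrightarrow> e j \<noteq> 0" "j \<in> {1..n}"
  shows "e j = 1"
proof (rule ccontr)
  assume "e j \<noteq> 1"
  then have "1 < e j" using assms(2)[OF assms(3)] by linarith
  then have "(\<Sum>j\<in>{1..n}. 1) < (\<Sum>j\<in>{1..n}. e j)"
    using assms(2,3) by (intro sum_strict_mono_ex1) (auto simp: Suc_le_eq)
  then show False using assms(1) by simp
qed

text \<open>A monomial in which some variable is missing is killed by the difference in that
  direction. A monomial of degree at most n that contains all n variables is their product, and on
  it the n differences give 1.\<close>

lemma coeff_eq_iter_diff:
  assumes P: "mpoly_vars_degree_le n n P"
  shows "iter_diff [1..<Suc n] (mpoly_eval P) r = Poly_Mapping.lookup P (\<Sum>j\<in>{1..n}. Poly_Mapping.single j 1)"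
proof -
  let ?t = "\<Sum>j\<in>{1..n}. Poly_Mapping.single j (1::nat)"
  have t: "Poly_Mapping.lookup ?t i = (if i \<in> {1..n} then 1 else 0)" for i
    by (simp add: lookup_sum lookup_single when_def)
  have m: "iter_diff [1..<Suc n] (mono_eval m) r = (if m = ?t then 1 else 0)" if mP: "m \<in> Poly_Mapping.keys P" for m
  proof -
    have k: "Poly_Mapping.keys m \<subseteq> {1..n}" "(\<Sum>j\<in>{1..n}. Poly_Mapping.lookup m j) \<le> n"
      using P mP sum_lookup_keys[of m n] by (auto simp: mpoly_vars_degree_le_def)
    have "mono_eval m = (\<lambda>r. \<Prod>j\<in>{1..n}. of_nat (r j) ^ Poly_Mapping.lookup m j)"
      by (rule ext, rule mono_eval_superset) (use k in auto)
    then have "iter_diff [1..<Suc n] (mono_eval m) r =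
        iter_diff [1..<Suc n] (\<lambda>r. \<Prod>j\<in>{1..n}. (\<lambda>x. of_nat x ^ Poly_Mapping.lookup m j) (r j)) r" by (simp only:)
    also have "\<dots> = (\<Prod>j\<in>{1..n}. of_nat (Suc (r j)) ^ Poly_Mapping.lookup m j - of_nat (r j) ^ Poly_Mapping.lookup m j)"
      by (subst iter_diff_prod) (auto intro!: prod.cong simp del: upt_Suc)
    also have "\<dots> = (if m = ?t then 1 else 0)"
    proof (cases "\<exists>j\<in>{1..n}. Poly_Mapping.lookup m j = 0")
      case True
      then have "m \<noteq> ?t" using t by (metis zero_neq_one)
      moreover have "\<exists>j\<in>{1..n}. (of_nat (Suc (r j)) :: rat) ^ Poly_Mapping.lookup m j - of_nat (r j) ^ Poly_Mapping.lookup m j = 0"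
        using True by (metis diff_self power_0)
      ultimately show ?thesis by (simp add: prod_zero_iff)
    next
      case False
      have one: "Poly_Mapping.lookup m j = 1" if "j \<in> {1..n}" for j
        by (rule exponents_eq_one[OF k(2) _ that]) (metis False)
      have "m = ?t"
      proof (rule poly_mapping_eqI)
        fix i show "Poly_Mapping.lookup m i = Poly_Mapping.lookup ?t i"
          unfolding t using one[of i] k(1) by (auto simp: in_keys_iff)
      qed
      moreover have "(\<Prod>j\<in>{1..n}. (of_nat (Suc (r j)) :: rat) ^ Poly_Mapping.lookup m j - of_nat (r j) ^ Poly_Mapping.lookup m j) = 1"
        by (rule prod.neutral) (simp add: one)
      ultimately show ?thesis by simp
    qed
    finally show ?thesis .
  qed
  have "mpoly_eval P = (\<lambda>r. \<Sum>m\<in>Poly_Mapping.keys P. Poly_Mapping.lookup P m * mono_eval m r)"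
    by (rule ext) (simp add: mpoly_eval_def mono_eval_def)
  then have "iter_diff [1..<Suc n] (mpoly_eval P) r =
      (\<Sum>m\<in>Poly_Mapping.keys P. Poly_Mapping.lookup P m * iter_diff [1..<Suc n] (mono_eval m) r)"
    by (simp only: iter_diff_sum iter_diff_scale)
  also have "\<dots> = (\<Sum>m\<in>Poly_Mapping.keys P. if m = ?t then Poly_Mapping.lookup P ?t else 0)"
    by (rule sum.cong[OF refl]) (simp only: m, simp)
  also have "\<dots> = Poly_Mapping.lookup P ?t" by (simp add: in_keys_iff)
  finally show ?thesis .
qed

text \<open>The coefficient of any admissible polynomial is the eventual value of the iterated
  difference of the colength. This one fact yields both the value and the uniqueness required by the
  definite description; existence comes from the Newton form.\<close>

lemma mixed_mult_mideal:
  fixes A :: "nat \<Rightarrow> 'n::finite upset"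
  assumes A: "\<And>j. j \<in> {1..CARD('n)} \<Longrightarrow> cofin (A j)"
  shows "mixed_mult germ_ring CARD('n) (\<lambda>j. mideal UNIV (A j)) = of_int (mixed_count A)"
proof -
  let ?n = "CARD('n)" and ?R = "germ_subring UNIV :: 'n germ ring"
  let ?F = "\<lambda>r. colen (\<Prod>j\<in>{1..?n}. A j ^ r j)"
  let ?t = "\<Sum>j\<in>{1..?n}. Poly_Mapping.single j (1::nat)"
  have len: "ring_length (germ_ring Quot finprod (ideals_set germ_ring)
      (\<lambda>j. ideal_power germ_ring (mideal UNIV (A j)) (r j)) {1..?n}) = enat (?F r)" for r :: "nat \<Rightarrow> nat"
    unfolding germ_subring_UNIV[symmetric] mideal_power mideal_finprod[OF finite_atLeastAtMost]
    by (rule ring_length_mideal) (use A in auto)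
  have lookup: "Poly_Mapping.lookup Q ?t = of_int (mixed_count A)"
    if Q: "mpoly_vars_degree_le ?n ?n Q"
      and QF: "\<And>r. \<forall>j\<in>{1..?n}. M \<le> r j \<Longrightarrow> mpoly_eval Q r = of_nat (?F r)" for Q M
  proof -
    have c: "of_int (iter_diff [1..<Suc ?n] (\<lambda>r. int (?F r)) r) = Poly_Mapping.lookup Q ?t"
      if r: "\<And>j. M \<le> r j" for r
    proof -
      have "of_int (iter_diff [1..<Suc ?n] (\<lambda>r. int (?F r)) r) = iter_diff [1..<Suc ?n] (\<lambda>r. of_int (int (?F r)) :: rat) r"
        by (rule iter_diff_of_int[symmetric])
      also have "\<dots> = iter_diff [1..<Suc ?n] (mpoly_eval Q) r"
      proof (rule iter_diff_cong)
        fix x assume "r \<le> x"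
        then have "\<forall>j\<in>{1..?n}. M \<le> x j" using r by (meson le_funD order_trans)
        from QF[OF this] show "of_int (int (?F x)) = mpoly_eval Q x" by simp
      qed
      also have "\<dots> = Poly_Mapping.lookup Q ?t" by (rule coeff_eq_iter_diff[OF Q])
      finally show ?thesis .
    qed
    have "mixed_count A = iter_diff [1..<Suc ?n] (\<lambda>r. int (?F r)) (\<lambda>_. M)"
    proof (rule mixed_countI)
      fix r :: "nat \<Rightarrow> nat" assume r: "\<And>j. M \<le> r j"
      have "rat_of_int (iter_diff [1..<Suc ?n] (\<lambda>r. int (?F r)) r) =
          of_int (iter_diff [1..<Suc ?n] (\<lambda>r. int (?F r)) (\<lambda>_. M))"
        using c[of r, OF r] c[of "\<lambda>_. M", OF order_refl] by (rule trans[OF _ sym])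
      then show "iter_diff [1..<Suc ?n] (\<lambda>r. int (?F r)) r = iter_diff [1..<Suc ?n] (\<lambda>r. int (?F r)) (\<lambda>_. M)"
        by (simp only: of_int_eq_iff)
    qed
    then show ?thesis using c[of "\<lambda>_. M"] by (simp del: upt_Suc)
  qed
  have "\<exists>N0. \<forall>N\<ge>N0. \<exists>ps. (\<forall>p\<in>set ps. (\<Sum>j\<in>{1..?n}. p j) \<le> ?n) \<and>
      (\<forall>x. colen (1 * (\<Prod>j\<in>{1..?n}. A j ^ (N + x j))) = newt {1..?n} ps x)"
    by (rule colen_newt) (use A in simp_all)
  then obtain N where "\<exists>ps. (\<forall>p\<in>set ps. (\<Sum>j\<in>{1..?n}. p j) \<le> ?n) \<and>
      (\<forall>x. colen (1 * (\<Prod>j\<in>{1..?n}. A j ^ (N + x j))) = newt {1..?n} ps x)" by blast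
  then obtain ps where ps: "\<forall>p\<in>set ps. (\<Sum>j\<in>{1..?n}. p j) \<le> ?n"
    and F: "\<And>x. ?F (\<lambda>j. N + x j) = newt {1..?n} ps x"
    by (auto simp only: mult_1)
  from mpoly_of_newt[OF ps, of N] obtain P where P: "mpoly_vars_degree_le ?n ?n P"
    and PF: "\<And>x. mpoly_eval P (\<lambda>j. N + x j) = of_nat (newt {1..?n} ps x)"
    by blast
  have keys_P: "Poly_Mapping.keys m \<subseteq> {1..?n}" if "m \<in> Poly_Mapping.keys P" for m
    using P that by (auto simp: mpoly_vars_degree_le_def)
  \<comment> \<open>The bound by N concerns only the positions from 1 to n. There r equals N + x,
    and neither the polynomial nor the product looks at other positions.\<close>
  have PE: "mpoly_eval P r = of_nat (?F r)" if r: "\<forall>j\<in>{1..?n}. N \<le> r j" for r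
  proof -
    define x where "x = (\<lambda>j. r j - N)"
    have e: "N + x j = r j" if "j \<in> {1..?n}" for j using r that by (simp add: x_def)
    have "mpoly_eval P r = mpoly_eval P (\<lambda>j. N + x j)"
      unfolding mpoly_eval_def
    proof (rule sum.cong[OF refl])
      fix m assume m: "m \<in> Poly_Mapping.keys P"
      have "(\<Prod>j\<in>Poly_Mapping.keys m. (of_nat (r j) :: rat) ^ Poly_Mapping.lookup m j) =
          (\<Prod>j\<in>Poly_Mapping.keys m. of_nat (N + x j) ^ Poly_Mapping.lookup m j)"
        by (rule prod.cong[OF refl], subst e) (use keys_P[OF m] in auto)
      then show "Poly_Mapping.lookup P m * (\<Prod>j\<in>Poly_Mapping.keys m. of_nat (r j) ^ Poly_Mapping.lookup m j) =
          Poly_Mapping.lookup P m * (\<Prod>j\<in>Poly_Mapping.keys m. of_nat (N + x j) ^ Poly_Mapping.lookup m j)"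
        by (rule arg_cong)
    qed
    also have "\<dots> = of_nat (?F (\<lambda>j. N + x j))" unfolding PF F ..
    also have "?F (\<lambda>j. N + x j) = ?F r"
      by (rule arg_cong[of _ _ colen], rule prod.cong[OF refl], subst e) auto
    finally show ?thesis .
  qed
  show ?thesis
    unfolding mixed_mult_def len
  proof (rule the_equality)
    have "of_int (mixed_count A) = Poly_Mapping.lookup P ?t"
      by (rule lookup[OF P PE, symmetric])
    then show "\<exists>P. mpoly_vars_degree_le ?n ?n P \<and> (\<exists>N. \<forall>r. (\<forall>j\<in>{1..?n}. N \<le> r j) \<longrightarrow>
        (\<exists>l. enat (?F r) = enat l \<and> mpoly_eval P r = of_nat l)) \<and>
        of_int (mixed_count A) = Poly_Mapping.lookup P ?t"
      using P PE by blast
  next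
    fix c assume "\<exists>P. mpoly_vars_degree_le ?n ?n P \<and> (\<exists>N. \<forall>r. (\<forall>j\<in>{1..?n}. N \<le> r j) \<longrightarrow>
        (\<exists>l. enat (?F r) = enat l \<and> mpoly_eval P r = of_nat l)) \<and> c = Poly_Mapping.lookup P ?t"
    then obtain Q M where Q: "mpoly_vars_degree_le ?n ?n Q" "c = Poly_Mapping.lookup Q ?t"
      and QE: "\<forall>r. (\<forall>j\<in>{1..?n}. M \<le> r j) \<longrightarrow> (\<exists>l. enat (?F r) = enat l \<and> mpoly_eval Q r = of_nat l)"
      by blast
    have "mpoly_eval Q r = of_nat (?F r)" if "\<forall>j\<in>{1..?n}. M \<le> r j" for r
      using QE that by (metis enat.inject)
    from lookup[OF Q(1) this] show "c = of_int (mixed_count A)" unfolding Q(2) by blast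
  qed
qed

theorem corollary5p2:
  fixes I :: "'n::finite germ set" and i :: nat
  assumes "ideal I germ_ring"
    and "I \<noteq> carrier germ_ring"
    and "monomial_ideal I"
    and "finite_colength germ_ring I"
    and "i \<in> {1..CARD('n)}"
  shows "rel_lojasiewicz germ_ring CARD('n) i I =
    real (Max {ideal_ord (germ_subring L) (restricted_ideal L I) | L :: 'n set.
                 card L = CARD('n) + 1 - i})"
proof -
  obtain A :: "'n upset" where A: "cofin A" "I = mideal UNIV A"
    using monomial_ideal_finite_colength[OF assms(3,4)] by blast
  have A1: "A \<noteq> 1" using assms(2) mideal_1[of UNIV] unfolding A(2) germ_subring_UNIV by blast
  let ?n = "CARD('n)" and ?M = "max_upset :: 'n upset"
  let ?c = "?n + 1 - i"
  let ?ord = "\<lambda>L :: 'n set. ideal_ord (germ_subring L) (restricted_ideal L I)"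
  define \<rho> where "\<rho> = Max {?ord L | L :: 'n set. card L = ?c}"
  have c: "0 < ?c" "?c \<le> ?n" using assms(5) by auto
  have ord: "\<exists>a\<in>exps A. supp_in L a \<and> deg a = ?ord L \<and> (\<forall>b\<in>exps A. supp_in L b \<longrightarrow> deg a \<le> deg b)"
    if "card L = ?c" for L :: "'n set"
  proof -
    obtain D where D: "exps (?M ^ D) \<subseteq> exps A" using A(1) unfolding cofin_iff by blast
    have "L \<noteq> {}" using c(1) that by auto
    then obtain l where l: "l \<in> L" by blast
    \<comment> \<open>A pure power of one variable in L; it belongs to A because A contains a power
      of the maximal ideal. So exponents of A supported on L exist, and one of least degree realises
      the order.\<close>
    define e where "e j = (if j = l then D else 0)" for j
    have "D \<le> deg e" unfolding deg_def e_def by simp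
    then have "e \<in> exps A" "supp_in L e" using D l by (auto simp: exps_max_upset_power supp_in_def e_def)
    then have "\<exists>a. a \<in> exps A \<and> supp_in L a" by blast
    from this exists_least_iff[of "\<lambda>d. \<exists>a. a \<in> exps A \<and> supp_in L a \<and> deg a = d"]
    obtain a where a: "a \<in> exps A" "supp_in L a" "\<And>b. b \<in> exps A \<Longrightarrow> supp_in L b \<Longrightarrow> deg a \<le> deg b"
      by (metis not_le)
    have "deg a = ?ord L" unfolding A(2) by (rule ideal_ord_restricted[OF a, symmetric])
    then show ?thesis using a by blast
  qed
  have fin: "finite {?ord L | L :: 'n set. card L = ?c}" by simp
  obtain L1 :: "'n set" where "card L1 = ?c"
    using c(2) by (rule obtain_subset_with_card_n)
  then have "{?ord L | L :: 'n set. card L = ?c} \<noteq> {}" by blast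
  then have "\<rho> \<in> {?ord L | L :: 'n set. card L = ?c}" unfolding \<rho>_def by (rule Max_in[OF fin])
  then have "\<exists>L. \<rho> = ?ord L \<and> card L = ?c" by (simp only: mem_Collect_eq)
  then obtain L0 where L0: "card L0 = ?c" "\<rho> = ?ord L0" by blast
  have le: "?ord L \<le> \<rho>" if "card L = ?c" for L
    unfolding \<rho>_def by (rule Max_ge[OF fin], rule CollectI, rule exI, rule conjI[OF refl that])
  \<comment> \<open>Equality at s \<rho> needs the bound by the maximum for every L of this size;
    strictness below s \<rho> needs one set L0 that attains the maximum, as in
    \<open>low\<close>.\<close>
  have up: "\<exists>a\<in>exps A. (\<forall>j. j \<notin> L \<longrightarrow> a j = 0) \<and> deg a \<le> \<rho>" if L: "card L = ?c" for L
  proof -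
    obtain a where "a \<in> exps A" "supp_in L a" "deg a = ?ord L" using ord[OF L] by (elim bexE conjE)
    then show ?thesis using le[OF L] by (intro bexI[of _ a] conjI) (simp_all only: supp_in_def)
  qed
  have low: "\<rho> \<le> deg a" if "a \<in> exps A" "\<forall>j. j \<notin> L0 \<longrightarrow> a j = 0" for a
  proof -
    obtain b :: "'n \<Rightarrow> nat" where b: "deg b = ?ord L0" "\<forall>a\<in>exps A. supp_in L0 a \<longrightarrow> deg b \<le> deg a"
      using ord[OF L0(1)] by (elim bexE conjE)
    have "supp_in L0 a" using that(2) by (simp only: supp_in_def)
    then show ?thesis unfolding L0(2) b(1)[symmetric] using b(2) that(1) by (simp only:)
  qed
  let ?B = "\<lambda>j::nat. if j \<le> i then A else ?M"
  have cofB: "cofin (?B j)" for j using A(1) by simp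
  have tuple: "(if j \<le> i then I else max_ideal germ_ring) = mideal UNIV (?B j)" for j
    unfolding A(2) germ_subring_UNIV[symmetric] max_ideal_germ_subring by simp
  have r0: "r_zero germ_ring ?n (\<lambda>j. ideal_power germ_ring (mideal UNIV (?B j)) s) = s * \<rho>"
    if s: "1 \<le> s" for s
  proof -
    have 1: "mixed_mult germ_ring ?n (\<lambda>j. ideal_power germ_ring (mideal UNIV (?B j)) s) =
        of_int (mixed_count (\<lambda>j. ?B j ^ s))"
      unfolding germ_subring_UNIV[symmetric] mideal_power
      unfolding germ_subring_UNIV by (rule mixed_mult_mideal) (rule cofin_power[OF cofB])
    have 2: "mixed_mult germ_ring ?n (\<lambda>j. ideal_power germ_ring (mideal UNIV (?B j)) s
          <+>\<^bsub>germ_ring\<^esub> ideal_power germ_ring (max_ideal germ_ring) r) =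
        of_int (mixed_count (\<lambda>j. ?B j ^ s + ?M ^ r))" for r
      unfolding germ_subring_UNIV[symmetric] max_ideal_germ_subring mideal_power mideal_sum
      unfolding germ_subring_UNIV
      by (rule mixed_mult_mideal) (rule cofin_plus[OF cofin_power[OF cofB]])
    note th = mixed_count_threshold[OF A(1) A1 assms(5) s up L0(1) low]
    show ?thesis
      unfolding r_zero_def 1 2 of_int_eq_iff
    proof (rule Least_equality)
      show "mixed_count (\<lambda>j. ?B j ^ s) = mixed_count (\<lambda>j. ?B j ^ s + ?M ^ (s * \<rho>))" by (rule th(1))
    next
      fix r assume "mixed_count (\<lambda>j. ?B j ^ s) = mixed_count (\<lambda>j. ?B j ^ s + ?M ^ r)"
      then show "s * \<rho> \<le> r" using th(2)[of r] by (meson not_le)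
    qed
  qed
  have "rel_lojasiewicz germ_ring ?n i I = (INF s\<in>{1::nat..}. real \<rho>)"
    unfolding rel_lojasiewicz_def lojasiewicz_def tuple
    by (rule INF_cong[OF refl]) (simp add: r0)
  then show ?thesis unfolding \<rho>_def by simp
qed

end
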